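(* Let $G$ be a simple, simply connected compact Lie group of rank $n$ and let $k\ge 1$ be an integer level. For any node $v\in\{1,\dots,n\}$ of the Dynkin diagram of $G$, with induction maps $d^{e,o}:R[Z_e]\to R[G]$ and $d^{e,v}:R[Z_e]\to R_k[Z_v]$ as in the context, the level $k$ fusion ring is $$F_k[G]=R[G]\,/\,\big\langle d^{e,o}(\ker d^{e,v})\big\rangle,$$ i.e. the level $k$ fusion ideal $I_k\subset R[G]$ equals $\langle d^{e,o}(\ker d^{e,v})\rangle$.
   Context: Notation. $\Lambda_W$ is the weight lattice of $G$ in the dual $\mathfrak t^*$ of the Cartan algebra, $W$ the Weyl group, $\alpha_1,\dots,\alpha_n$ simple roots, $\alpha_0$ minus the highest root, $w_i$ the reflection in $\alpha_i$, $\rho$ the half sum of positive roots. The level is $\mathrm{Lv}(\lambda)=\langle\lambda,-\alpha_0^\vee\rangle$. For an integer $m$, $w_{m\cdot\alpha_0}$ is the reflection of $\mathfrak t^*$ in the hyperplane $\{\mathrm{Lv}=m\}$, $\lambda\mapsto\lambda+(\mathrm{Lv}(\lambda)-m)\alpha_0$. For a finite reflection group $U$ acting on weights, $A^U_\mu=\sum_{u\in U}(-1)^u e^{u\mu}$, with $(-1)^u$ the determinant of the linear part of $u$. Centralizers. Fix $v\in\{1,\dots,n\}$. The vertex $v$ of the Weyl alcove is the vertex at which all simple affine roots except $\alpha_v$ vanish, and $e$ is the edge joining the origin to $v$. $Z_e\subset Z_v\subset G$ are the centralizers of the (exponentials of the) edge $e$ and the vertex $v$; their root systems have simple roots $\{\alpha_i: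 i\ne 0,v\}$ and $\{\alpha_i: 0\le i\le n,\ i\neq v\}$ respectively, and $\rho_e,\rho_v$ are the half sums of the corresponding positive roots. Put $W^e=\langle w_i: i\neq 0,v\rangle$, $W^v=\langle W^e, w_{k\cdot\alpha_0}\rangle$ and $W^{v,0}=\langle W^e,w_{0\cdot\alpha_0}\rangle$. Then $R[G]=\mathbb Z[\Lambda_W]^W$, $R[Z_e]=\mathbb Z[\Lambda_W]^{W^e}$, and the twisted representation module is $R_k[Z_v]=\mathbb Z[\Lambda_W]^{W^v}$; all are $R[G]$-modules by multiplication in $\mathbb Z[\Lambda_W]$. Let $C_e=\{x:\langle x,\alpha_i^\vee\rangle\ge0,\ i\ne0,v\}$. For $\lambda\in C_e\cap\Lambda_W$ let $[\lambda]_e=A^{W^e}_{\lambda+\rho_e}/A^{W^e}_{\rho_e}$; these form a $\mathbb Z$-basis of $R[Z_e]$. The $R[G]$-module maps $d^{e,o}$ and $d^{e,v}$ (written $d^{\widehat{0v},\widehat 0}$, $d^{\widehat{0v},\widehat v}$ up to an irrelevant global sign) are defined by $$d^{e,o}([\lambda]_e)=A^{W}_{\lambda+\rho}/A^{W}_{\rho},\qquad d^{e,v}([\lambda]_e)=A^{W^v}_{\lambda+\rho_v}/A^{W^{v,0}}_{\rho_v}.$$ $\langle X\rangle$ denotes the ideal of $R[G]$ generated by $X$. Fusion ring. For dominant $\lambda$ let $[\lambda]\in R[G]$ be the irreducible representation of highest weight $\lambda$. Let $A_k$ be the set of dominant weights of level at most $k$, and $\widehat W$ the group generated by $\lambda\mapsto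 w_i(\lambda+\rho)-\rho$, $1\le i\le n$, and $w_{(k+1)\cdot\alpha_0}$. Let $S_k$ be the set of weights with nontrivial stabilizer in $\widehat W$; for $\lambda\in\Lambda_W\setminus S_k$ there is a unique $a_\lambda\in\widehat W$ with $a_\lambda\cdot\lambda\in A_k$. The fusion ideal $I_k\subset R[G]$ is generated by $[\lambda]-(-1)^{a_\lambda}[a_\lambda\cdot\lambda]$ for $\lambda$ dominant, $\lambda\notin A_k\cup S_k$, and $[\lambda]$ for $\lambda$ dominant, $\lambda\in S_k$; the fusion ring of positive energy representations of the level $k$ central extension of the loop group of $G$ is $F_k[G]=R[G]/I_k$. *)

theory Defs
  imports "HOL-Analysis.Analysis" "HOL-Library.Poly_Mapping" "HOL-Algebra.QuotRing" "HOL-Algebra.Module" "HOL-Algebra.Bij" "HOL-Algebra.Generated_Groups"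
begin

text \<open>
  A simple, simply connected compact Lie group of rank \<open>n = CARD('n)\<close> enters through its root system
  \<open>\<Phi>\<close> in \<open>\<tt>\<^sup>* = real ^ 'n\<close>, the inner product being the restriction of an invariant form. The
  vectors \<open>\<alpha> 1, \<dots>, \<alpha> n\<close> are the simple roots and \<open>\<alpha> 0\<close> is minus the highest root; simple
  connectedness means that the weight lattice consists of all integral functionals.
\<close>

definition pairing :: "real ^ 'n \<Rightarrow> real ^ 'n \<Rightarrow> real" where
  "pairing x \<beta> = 2 * (x \<bullet> \<beta>) / (\<beta> \<bullet> \<beta>)"  \<comment> \<open>\<open>\<langle>x, \<beta>\<^sup>\<or>\<rangle>\<close>\<close>

definition root_refl :: "real ^ 'n \<Rightarrow> real ^ 'n \<Rightarrow> real ^ 'n" where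
  "root_refl \<beta> x = x - pairing x \<beta> *\<^sub>R \<beta>"

definition root_system :: "(real ^ 'n) set \<Rightarrow> bool" where
  "root_system \<Phi> \<longleftrightarrow> finite \<Phi> \<and> span \<Phi> = UNIV \<and> 0 \<notin> \<Phi> \<and>
     (\<forall>\<beta>\<in>\<Phi>. root_refl \<beta> ` \<Phi> = \<Phi>) \<and>
     (\<forall>\<beta>\<in>\<Phi>. \<forall>\<gamma>\<in>\<Phi>. pairing \<gamma> \<beta> \<in> \<int>) \<and>
     (\<forall>\<beta>\<in>\<Phi>. \<forall>c. c *\<^sub>R \<beta> \<in> \<Phi> \<longrightarrow> c = 1 \<or> c = -1)"

definition irreducible_system :: "(real ^ 'n) set \<Rightarrow> bool" where
  "irreducible_system \<Phi> \<longleftrightarrow>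
     \<not> (\<exists>\<Phi>\<^sub>1 \<Phi>\<^sub>2. \<Phi>\<^sub>1 \<noteq> {} \<and> \<Phi>\<^sub>2 \<noteq> {} \<and> \<Phi> = \<Phi>\<^sub>1 \<union> \<Phi>\<^sub>2 \<and> (\<forall>\<beta>\<in>\<Phi>\<^sub>1. \<forall>\<gamma>\<in>\<Phi>\<^sub>2. \<beta> \<bullet> \<gamma> = 0))"

definition nat_comb :: "(nat \<Rightarrow> real ^ 'n) \<Rightarrow> nat set \<Rightarrow> real ^ 'n \<Rightarrow> bool" where
  "nat_comb \<alpha> J \<beta> \<longleftrightarrow> (\<exists>c :: nat \<Rightarrow> nat. \<beta> = (\<Sum>i\<in>J. real (c i) *\<^sub>R \<alpha> i))"

definition simple_roots :: "(real ^ 'n) set \<Rightarrow> (nat \<Rightarrow> real ^ 'n) \<Rightarrow> bool" where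
  "simple_roots \<Phi> \<alpha> \<longleftrightarrow>
     inj_on \<alpha> {1..CARD('n)} \<and> \<alpha> ` {1..CARD('n)} \<subseteq> \<Phi> \<and> independent (\<alpha> ` {1..CARD('n)}) \<and>
     (\<forall>\<beta>\<in>\<Phi>. nat_comb \<alpha> {1..CARD('n)} \<beta> \<or> nat_comb \<alpha> {1..CARD('n)} (- \<beta>))"

definition highest_root :: "(real ^ 'n) set \<Rightarrow> (nat \<Rightarrow> real ^ 'n) \<Rightarrow> real ^ 'n \<Rightarrow> bool" where
  "highest_root \<Phi> \<alpha> \<theta> \<longleftrightarrow> \<theta> \<in> \<Phi> \<and> (\<forall>\<beta>\<in>\<Phi>. nat_comb \<alpha> {1..CARD('n)} (\<theta> - \<beta>))"

definition simple_group_data :: "(real ^ 'n) set \<Rightarrow> (nat \<Rightarrow> real ^ 'n) \<Rightarrow> bool" where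
  "simple_group_data \<Phi> \<alpha> \<longleftrightarrow>
     root_system \<Phi> \<and> irreducible_system \<Phi> \<and> simple_roots \<Phi> \<alpha> \<and> highest_root \<Phi> \<alpha> (- \<alpha> 0)"

definition weight_lattice :: "(real ^ 'n) set \<Rightarrow> (real ^ 'n) set" where
  "weight_lattice \<Phi> = {x. \<forall>\<beta>\<in>\<Phi>. pairing x \<beta> \<in> \<int>}"

definition level :: "(nat \<Rightarrow> real ^ 'n) \<Rightarrow> real ^ 'n \<Rightarrow> real" where
  "level \<alpha> x = pairing x (- \<alpha> 0)"

definition level_refl :: "(nat \<Rightarrow> real ^ 'n) \<Rightarrow> nat \<Rightarrow> real ^ 'n \<Rightarrow> real ^ 'n" where
  "level_refl \<alpha> m x = x + (level \<alpha> x - real m) *\<^sub>R \<alpha> 0"  \<comment> \<open>\<open>w\<^bsub>m\<cdot>\<alpha>\<^sub>0\<^esub>\<close>\<close>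

text \<open>
  Half sum of the positive roots of the subsystem with simple roots \<open>\<alpha> i\<close>, \<open>i \<in> J\<close>. It gives \<open>\<rho>\<close>,
  \<open>\<rho>\<^sub>e\<close>, \<open>\<rho>\<^sub>v\<close> for \<open>J = {1..n}\<close>, \<open>{1..n} - {v}\<close>, \<open>{0..n} - {v}\<close>: in the last two cases the roots of the
  centralizer are those constant on \<open>e\<close>, respectively integral at the vertex \<open>v\<close>, so every root of
  \<open>G\<close> that is a nonnegative integral combination of the \<open>\<alpha> i\<close>, \<open>i \<in> J\<close>, is one of them.
\<close>

definition half_sum :: "(real ^ 'n) set \<Rightarrow> (nat \<Rightarrow> real ^ 'n) \<Rightarrow> nat set \<Rightarrow> real ^ 'n" where
  "half_sum \<Phi> \<alpha> J = (1 / 2) *\<^sub>R \<Sum>{\<beta> \<in> \<Phi>. nat_comb \<alpha> J \<beta>}"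

definition rho :: "(real ^ 'n) set \<Rightarrow> (nat \<Rightarrow> real ^ 'n) \<Rightarrow> real ^ 'n" where
  "rho \<Phi> \<alpha> = half_sum \<Phi> \<alpha> {1..CARD('n)}"

definition rho_e :: "(real ^ 'n) set \<Rightarrow> (nat \<Rightarrow> real ^ 'n) \<Rightarrow> nat \<Rightarrow> real ^ 'n" where
  "rho_e \<Phi> \<alpha> v = half_sum \<Phi> \<alpha> ({1..CARD('n)} - {v})"

definition rho_v :: "(real ^ 'n) set \<Rightarrow> (nat \<Rightarrow> real ^ 'n) \<Rightarrow> nat \<Rightarrow> real ^ 'n" where
  "rho_v \<Phi> \<alpha> v = half_sum \<Phi> \<alpha> ({0..CARD('n)} - {v})"

abbreviation generated :: "(real ^ 'n \<Rightarrow> real ^ 'n) set \<Rightarrow> (real ^ 'n \<Rightarrow> real ^ 'n) set" where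
  "generated \<equiv> generate (BijGroup UNIV)"

definition weyl :: "(nat \<Rightarrow> real ^ 'n) \<Rightarrow> (real ^ 'n \<Rightarrow> real ^ 'n) set" where
  "weyl \<alpha> = generated ((\<lambda>i. root_refl (\<alpha> i)) ` {1..CARD('n)})"

definition weyl_e :: "(nat \<Rightarrow> real ^ 'n) \<Rightarrow> nat \<Rightarrow> (real ^ 'n \<Rightarrow> real ^ 'n) set" where
  "weyl_e \<alpha> v = generated ((\<lambda>i. root_refl (\<alpha> i)) ` ({1..CARD('n)} - {v}))"

text \<open>\<open>weyl_v \<alpha> k v\<close> is \<open>W\<^sup>v\<close>, and \<open>weyl_v \<alpha> 0 v\<close> is \<open>W\<^bsup>v,0\<^esup>\<close>.\<close>

definition weyl_v :: "(nat \<Rightarrow> real ^ 'n) \<Rightarrow> nat \<Rightarrow> nat \<Rightarrow> (real ^ 'n \<Rightarrow> real ^ 'n) set" where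
  "weyl_v \<alpha> m v = generated (insert (level_refl \<alpha> m) (weyl_e \<alpha> v))"

text \<open>\<open>(-1)\<^sup>u\<close> for an affine map \<open>u\<close>; the determinant is \<open>\<plusminus>1\<close> for all \<open>u\<close> in question, and \<open>floor\<close>
  only turns it into an \<^typ>\<open>int\<close>.\<close>

definition lin_sign :: "(real ^ 'n \<Rightarrow> real ^ 'n) \<Rightarrow> int" where
  "lin_sign u = \<lfloor>det (matrix (\<lambda>x. u x - u 0))\<rfloor>"

text \<open>
  Formal exponential sums live in the group ring \<open>\<int>[\<tt>\<^sup>*]\<close>, rendered as \<open>real ^ 'n \<Rightarrow>\<^sub>0 int\<close> with its
  convolution product, and not only in \<open>\<int>[\<Lambda>\<^sub>W]\<close>, because \<open>\<rho>\<^sub>e\<close> and \<open>\<rho>\<^sub>v\<close> need not be weights of \<open>G\<close>.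
  This ring has no zero divisors, so a quotient by a nonzero element is unique if it exists.
\<close>

definition alt_sum :: "(real ^ 'n \<Rightarrow> real ^ 'n) set \<Rightarrow> real ^ 'n \<Rightarrow> (real ^ 'n \<Rightarrow>\<^sub>0 int)" where
  "alt_sum U \<mu> = (\<Sum>u\<in>U. Poly_Mapping.single (u \<mu>) (lin_sign u))"

definition exact_quotient :: "(real ^ 'n \<Rightarrow>\<^sub>0 int) \<Rightarrow> (real ^ 'n \<Rightarrow>\<^sub>0 int) \<Rightarrow> (real ^ 'n \<Rightarrow>\<^sub>0 int)" where
  "exact_quotient a b = (THE x. x * b = a)"

text \<open>
  \<open>\<int>[\<Lambda>\<^sub>W]\<^sup>U\<close>, with the multiplication of \<open>\<int>[\<Lambda>\<^sub>W]\<close> also as scalar multiplication. It is a ring if \<open>U\<close>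
  acts linearly; for affine \<open>U\<close> only its structure of a module over \<open>R[G]\<close> is meaningful.
\<close>

definition invariants :: "(real ^ 'n) set \<Rightarrow> (real ^ 'n \<Rightarrow> real ^ 'n) set \<Rightarrow>
    (real ^ 'n \<Rightarrow>\<^sub>0 int, real ^ 'n \<Rightarrow>\<^sub>0 int) module" where
  "invariants \<Phi> U =
     \<lparr>carrier = {x. Poly_Mapping.keys x \<subseteq> weight_lattice \<Phi> \<and>
                   (\<forall>u\<in>U. \<forall>\<mu>. Poly_Mapping.lookup x (u \<mu>) = Poly_Mapping.lookup x \<mu>)},
      mult = (*), one = 1, zero = 0, add = (+), smult = (*)\<rparr>"

definition rep_G :: "(real ^ 'n) set \<Rightarrow> (nat \<Rightarrow> real ^ 'n) \<Rightarrow>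
    (real ^ 'n \<Rightarrow>\<^sub>0 int, real ^ 'n \<Rightarrow>\<^sub>0 int) module" where
  "rep_G \<Phi> \<alpha> = invariants \<Phi> (weyl \<alpha>)"

definition rep_Ze :: "(real ^ 'n) set \<Rightarrow> (nat \<Rightarrow> real ^ 'n) \<Rightarrow> nat \<Rightarrow>
    (real ^ 'n \<Rightarrow>\<^sub>0 int, real ^ 'n \<Rightarrow>\<^sub>0 int) module" where
  "rep_Ze \<Phi> \<alpha> v = invariants \<Phi> (weyl_e \<alpha> v)"

definition rep_Zv :: "(real ^ 'n) set \<Rightarrow> (nat \<Rightarrow> real ^ 'n) \<Rightarrow> nat \<Rightarrow> nat \<Rightarrow>
    (real ^ 'n \<Rightarrow>\<^sub>0 int, real ^ 'n \<Rightarrow>\<^sub>0 int) module" where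
  "rep_Zv \<Phi> \<alpha> k v = invariants \<Phi> (weyl_v \<alpha> k v)"

definition dominant_e :: "(real ^ 'n) set \<Rightarrow> (nat \<Rightarrow> real ^ 'n) \<Rightarrow> nat \<Rightarrow> (real ^ 'n) set" where
  "dominant_e \<Phi> \<alpha> v = {x \<in> weight_lattice \<Phi>. \<forall>i\<in>{1..CARD('n)} - {v}. pairing x (\<alpha> i) \<ge> 0}"

definition basis_e :: "(real ^ 'n) set \<Rightarrow> (nat \<Rightarrow> real ^ 'n) \<Rightarrow> nat \<Rightarrow> real ^ 'n \<Rightarrow> (real ^ 'n \<Rightarrow>\<^sub>0 int)" where
  "basis_e \<Phi> \<alpha> v \<mu> =
     exact_quotient (alt_sum (weyl_e \<alpha> v) (\<mu> + rho_e \<Phi> \<alpha> v)) (alt_sum (weyl_e \<alpha> v) (rho_e \<Phi> \<alpha> v))"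

text \<open>The additive map on \<open>R[Z\<^sub>e]\<close> with values \<open>f \<mu>\<close> on the \<open>\<int>\<close>-basis \<open>[\<mu>]\<^sub>e\<close>, \<open>\<mu> \<in> C\<^sub>e \<inter> \<Lambda>\<^sub>W\<close>.\<close>

definition extend_e :: "(real ^ 'n) set \<Rightarrow> (nat \<Rightarrow> real ^ 'n) \<Rightarrow> nat \<Rightarrow>
    (real ^ 'n \<Rightarrow> (real ^ 'n \<Rightarrow>\<^sub>0 int)) \<Rightarrow> (real ^ 'n \<Rightarrow>\<^sub>0 int) \<Rightarrow> (real ^ 'n \<Rightarrow>\<^sub>0 int)" where
  "extend_e \<Phi> \<alpha> v f x = frag_extend f
     (THE c. Poly_Mapping.keys c \<subseteq> dominant_e \<Phi> \<alpha> v \<and> frag_extend (basis_e \<Phi> \<alpha> v) c = x)"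

text \<open>For dominant \<open>\<mu>\<close> this is the character of the irreducible representation of highest weight \<open>\<mu>\<close>.\<close>

definition weyl_char :: "(real ^ 'n) set \<Rightarrow> (nat \<Rightarrow> real ^ 'n) \<Rightarrow> real ^ 'n \<Rightarrow> (real ^ 'n \<Rightarrow>\<^sub>0 int)" where
  "weyl_char \<Phi> \<alpha> \<mu> = exact_quotient (alt_sum (weyl \<alpha>) (\<mu> + rho \<Phi> \<alpha>)) (alt_sum (weyl \<alpha>) (rho \<Phi> \<alpha>))"

definition d_eo :: "(real ^ 'n) set \<Rightarrow> (nat \<Rightarrow> real ^ 'n) \<Rightarrow> nat \<Rightarrow>
    (real ^ 'n \<Rightarrow>\<^sub>0 int) \<Rightarrow> (real ^ 'n \<Rightarrow>\<^sub>0 int)" where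
  "d_eo \<Phi> \<alpha> v = extend_e \<Phi> \<alpha> v (weyl_char \<Phi> \<alpha>)"

definition d_ev :: "(real ^ 'n) set \<Rightarrow> (nat \<Rightarrow> real ^ 'n) \<Rightarrow> nat \<Rightarrow> nat \<Rightarrow>
    (real ^ 'n \<Rightarrow>\<^sub>0 int) \<Rightarrow> (real ^ 'n \<Rightarrow>\<^sub>0 int)" where
  "d_ev \<Phi> \<alpha> k v = extend_e \<Phi> \<alpha> v
     (\<lambda>\<mu>. exact_quotient (alt_sum (weyl_v \<alpha> k v) (\<mu> + rho_v \<Phi> \<alpha> v)) (alt_sum (weyl_v \<alpha> 0 v) (rho_v \<Phi> \<alpha> v)))"

definition dominant :: "(real ^ 'n) set \<Rightarrow> (nat \<Rightarrow> real ^ 'n) \<Rightarrow> (real ^ 'n) set" where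
  "dominant \<Phi> \<alpha> = {x \<in> weight_lattice \<Phi>. \<forall>i\<in>{1..CARD('n)}. pairing x (\<alpha> i) \<ge> 0}"

definition alcove :: "(real ^ 'n) set \<Rightarrow> (nat \<Rightarrow> real ^ 'n) \<Rightarrow> nat \<Rightarrow> (real ^ 'n) set" where
  "alcove \<Phi> \<alpha> k = {x \<in> dominant \<Phi> \<alpha>. level \<alpha> x \<le> real k}"

definition affine_weyl :: "(real ^ 'n) set \<Rightarrow> (nat \<Rightarrow> real ^ 'n) \<Rightarrow> nat \<Rightarrow> (real ^ 'n \<Rightarrow> real ^ 'n) set" where
  "affine_weyl \<Phi> \<alpha> k = generated (insert (level_refl \<alpha> (k + 1))
     ((\<lambda>i x. root_refl (\<alpha> i) (x + rho \<Phi> \<alpha>) - rho \<Phi> \<alpha>) ` {1..CARD('n)}))"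

definition singular :: "(real ^ 'n) set \<Rightarrow> (nat \<Rightarrow> real ^ 'n) \<Rightarrow> nat \<Rightarrow> (real ^ 'n) set" where
  "singular \<Phi> \<alpha> k = {x \<in> weight_lattice \<Phi>. \<exists>a\<in>affine_weyl \<Phi> \<alpha> k. a \<noteq> id \<and> a x = x}"

text \<open>For a nonsingular weight \<open>\<mu>\<close>, exactly one \<open>a\<close> in the affine Weyl group satisfies
  \<open>a \<mu> \<in> alcove \<Phi> \<alpha> k\<close>, namely \<open>a\<^sub>\<mu>\<close>.\<close>

definition fusion_ideal :: "(real ^ 'n) set \<Rightarrow> (nat \<Rightarrow> real ^ 'n) \<Rightarrow> nat \<Rightarrow> (real ^ 'n \<Rightarrow>\<^sub>0 int) set" where
  "fusion_ideal \<Phi> \<alpha> k = Idl\<^bsub>rep_G \<Phi> \<alpha>\<^esub>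
     ({weyl_char \<Phi> \<alpha> \<mu> - frag_cmul (lin_sign a) (weyl_char \<Phi> \<alpha> (a \<mu>)) | \<mu> a.
         \<mu> \<in> dominant \<Phi> \<alpha> \<and> \<mu> \<notin> alcove \<Phi> \<alpha> k \<union> singular \<Phi> \<alpha> k \<and>
         a \<in> affine_weyl \<Phi> \<alpha> k \<and> a \<mu> \<in> alcove \<Phi> \<alpha> k}
      \<union> weyl_char \<Phi> \<alpha> ` (dominant \<Phi> \<alpha> \<inter> singular \<Phi> \<alpha> k))"

definition fusion_ring :: "(real ^ 'n) set \<Rightarrow> (nat \<Rightarrow> real ^ 'n) \<Rightarrow> nat \<Rightarrow> (real ^ 'n \<Rightarrow>\<^sub>0 int) set ring" where
  "fusion_ring \<Phi> \<alpha> k = rep_G \<Phi> \<alpha> Quot fusion_ideal \<Phi> \<alpha> k"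

end

theory Submission
  imports Defs
begin

text \<open>
  The Weyl numerators \<open>A (\<lambda> + \<rho>)\<close> make sense for every weight \<open>\<lambda>\<close>, so that \<open>[\<lambda>]\<close>, \<open>[\<lambda>]\<^sub>e\<close> and
  \<open>d\<^bsup>e,v\<^esup> [\<lambda>]\<^sub>e\<close> extend to all weights and are antisymmetric for the shifted actions of \<open>W\<close>, \<open>W\<^sup>e\<close> and
  \<open>W\<^sup>v\<close>. With the shift these are the actions of parabolic subgroups of the affine Weyl group, which
  \<open>W\<close> and the affine reflection \<open>s\<close>, lying in \<open>W\<^sup>v\<close>, generate together.

  The element \<open>[\<lambda>]\<^sub>e + [s \<lambda>]\<^sub>e\<close>, or \<open>[\<lambda>]\<^sub>e\<close> if \<open>s\<close> fixes \<open>\<lambda>\<close>, lies in the kernel of \<open>d\<^bsup>e,v\<^esup>\<close>. Modulo the image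
  of the kernel, \<open>[\<lambda>]\<close> is therefore antisymmetric under the whole affine Weyl group and vanishes on its
  walls, and this gives the fusion relations. Conversely the fusion relations make \<open>[\<lambda>]\<close>
  antisymmetric, and the coefficients of \<open>\<Sum> c\<^sub>\<lambda> A (\<lambda> + \<rho>\<^sub>v)\<close> in the open Weyl chamber of \<open>W\<^sup>v\<close>
  determine \<open>\<Sum> c\<^sub>\<lambda> [\<lambda>]\<close> modulo them. Only additive subgroups are involved, so the two generating sets
  are contained in the same ideals.
\<close>

section \<open>Reflection words\<close>

text \<open>The three half sums are different vectors, but each pairs to 1 with the simple coroots
  of its own group. Shifting by them therefore moves the walls of all three groups to common
  offsets: 1 at \<open>\<alpha> 1, ..., \<alpha> n\<close>, and \<open>k + 1\<close> at
  \<open>\<alpha> 0\<close>. This is how the level k of W^v meets the level k + 1 of the fusion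
  relations, and why a single family of reflections acts on the weights throughout.

  Two obstacles shape the rest. Quotients and additive extensions are definite descriptions, so
  nothing is known about them until the numerators are shown to be divisible, the denominators
  cancellable and the elements [\<lambda>]_e a basis. Divisibility is proved for linear groups only;
  W^v is affine, but it fixes a point, and translating that point to the origin makes it linear. The
  point need not be a weight, so divisibility has to cover translates of the weight lattice.

  Further, antisymmetry modulo a subgroup does not give vanishing on the walls, because the subgroup
  may contain twice an element without containing the element. The wall relations are therefore
  carried along separately.\<close>

lemma pairing_add: "pairing (x + y) b = pairing x b + pairing y b"
  by (simp add: pairing_def inner_add_left add_divide_distrib distrib_left)

lemma pairing_diff: "pairing (x - y) b = pairing x b - pairing y b"
  by (simp add: pairing_def inner_diff_left diff_divide_distrib right_diff_distrib)

lemma pairing_scaleR: "pairing (r *\<^sub>R x) b = r * pairing x b"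
  by (simp add: pairing_def)

lemma pairing_minus: "pairing (- x) b = - pairing x b"
  by (simp add: pairing_def)

lemma pairing_minus_right: "pairing x (- b) = - pairing x b"
  by (simp add: pairing_def)

lemma pairing_zero: "pairing 0 b = 0"
  by (simp add: pairing_def)

lemma pairing_self: "b \<noteq> 0 \<Longrightarrow> pairing b b = 2"
  by (simp add: pairing_def)

lemmas pairing_simps = pairing_add pairing_diff pairing_scaleR pairing_minus pairing_zero

lemma linear_root_refl: "linear (root_refl b)"
  by (auto simp: linear_iff root_refl_def pairing_simps algebra_simps)

text \<open>The reflection in the hyperplane \<open>\<langle>x, \<alpha>\<^sub>i\<^sup>\<or>\<rangle> + p\<^sub>i = 0\<close>. The offsets \<open>p\<close> make the linear,
  the level and the \<open>\<rho>\<close>-shifted actions instances of one construction.\<close>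

definition srefl :: "(nat \<Rightarrow> real ^ 'n) \<Rightarrow> (nat \<Rightarrow> real) \<Rightarrow> nat \<Rightarrow> real ^ 'n \<Rightarrow> real ^ 'n" where
  "srefl \<alpha> p i x = x - (pairing x (\<alpha> i) + p i) *\<^sub>R \<alpha> i"

text \<open>Lists rather than group elements: the same letters can be read with several offsets, and
  the length supplies both the sign and the induction measure.\<close>

definition word :: "(nat \<Rightarrow> real ^ 'n) \<Rightarrow> (nat \<Rightarrow> real) \<Rightarrow> nat list \<Rightarrow> real ^ 'n \<Rightarrow> real ^ 'n" where
  "word \<alpha> p ws = foldr (\<lambda>i f. srefl \<alpha> p i \<circ> f) ws id"

lemma word_Nil [simp]: "word \<alpha> p [] = id"
  and word_Cons [simp]: "word \<alpha> p (i # ws) = srefl \<alpha> p i \<circ> word \<alpha> p ws"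
  by (simp_all add: word_def)

definition wgroup :: "(nat \<Rightarrow> real ^ 'n) \<Rightarrow> (nat \<Rightarrow> real) \<Rightarrow> nat set \<Rightarrow> (real ^ 'n \<Rightarrow> real ^ 'n) set" where
  "wgroup \<alpha> p J = {word \<alpha> p ws | ws. set ws \<subseteq> J}"

abbreviation zoff :: "nat \<Rightarrow> real" where "zoff \<equiv> \<lambda>_. 0"

lemma srefl_zoff: "srefl \<alpha> zoff i = root_refl (\<alpha> i)"
  by (auto simp: srefl_def root_refl_def)

text \<open>Conjugation by a translation changes nothing but the offsets; every comparison of
  shifted and unshifted actions rests on this.\<close>

lemma srefl_shift:
  "srefl \<alpha> p i (x + t) = srefl \<alpha> (\<lambda>j. p j + pairing t (\<alpha> j)) i x + t"
  by (simp add: srefl_def pairing_simps algebra_simps)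

lemma srefl_diff: "srefl \<alpha> p i x - srefl \<alpha> p i y = srefl \<alpha> zoff i (x - y)"
  by (simp add: srefl_def pairing_simps algebra_simps)

lemma srefl_invol: "\<alpha> i \<noteq> 0 \<Longrightarrow> srefl \<alpha> p i (srefl \<alpha> p i x) = x"
  by (simp add: srefl_def pairing_simps pairing_self algebra_simps)

lemma srefl_fixed_iff: "\<alpha> i \<noteq> 0 \<Longrightarrow> srefl \<alpha> p i x = x \<longleftrightarrow> pairing x (\<alpha> i) + p i = 0"
  by (simp add: srefl_def)

lemma srefl_neq_id:
  assumes "\<alpha> i \<noteq> 0" shows "srefl \<alpha> p i \<noteq> id"
proof
  assume *: "srefl \<alpha> p i = id"
  have "srefl \<alpha> p i 0 = 0" "srefl \<alpha> p i (\<alpha> i) = \<alpha> i" using * by auto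
  then show False using assms by (simp add: srefl_fixed_iff pairing_zero pairing_self)
qed

lemma srefl_inner:
  assumes "\<alpha> i \<noteq> 0" shows "srefl \<alpha> zoff i x \<bullet> srefl \<alpha> zoff i y = x \<bullet> y"
proof -
  define a where "a = \<alpha> i \<bullet> \<alpha> i"
  have "x \<bullet> \<alpha> i = pairing x (\<alpha> i) * a / 2" "\<alpha> i \<bullet> y = pairing y (\<alpha> i) * a / 2"
    using assms by (simp_all add: a_def pairing_def inner_commute)
  note * = this
  show ?thesis
    by (simp add: srefl_def inner_diff_left inner_diff_right * flip: a_def)
qed

lemma srefl_cong: "p i = p' i \<Longrightarrow> srefl \<alpha> p i = srefl \<alpha> p' i"
  by (auto simp: srefl_def)

lemma word_cong: "(\<And>i. i \<in> set ws \<Longrightarrow> p i = p' i) \<Longrightarrow> word \<alpha> p ws = word \<alpha> p' ws"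
  by (induction ws) (auto simp: srefl_cong[of p _ p'])

lemma word_append: "word \<alpha> p (us @ ws) = word \<alpha> p us \<circ> word \<alpha> p ws"
  by (induction us) (auto simp: comp_assoc)

lemma word_rev:
  assumes "\<And>i. i \<in> set ws \<Longrightarrow> \<alpha> i \<noteq> 0"
  shows "word \<alpha> p ws (word \<alpha> p (rev ws) x) = x"
  using assms
proof (induction ws arbitrary: x)
  case (Cons i ws)
  have "word \<alpha> p (i # ws) (word \<alpha> p (rev (i # ws)) x)
      = srefl \<alpha> p i (word \<alpha> p ws (word \<alpha> p (rev ws) (srefl \<alpha> p i x)))"
    by (simp add: word_append)
  also have "\<dots> = x" using Cons by (simp add: srefl_invol)
  finally show ?case .
qed simp

lemma word_diff: "word \<alpha> p ws x - word \<alpha> p ws y = word \<alpha> zoff ws (x - y)"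
  by (induction ws) (auto simp: srefl_diff)

lemma linear_word: "linear (word \<alpha> zoff ws)"
proof (induction ws)
  case (Cons i ws)
  then show ?case using linear_compose[OF Cons linear_root_refl] by (simp add: srefl_zoff o_def)
qed (simp add: linear_iff)

lemma word_shift:
  "word \<alpha> p ws (x + t) = word \<alpha> (\<lambda>j. p j + pairing t (\<alpha> j)) ws x + t"
  by (induction ws) (auto simp: srefl_shift)

lemma word_inner:
  assumes "\<And>i. i \<in> set ws \<Longrightarrow> \<alpha> i \<noteq> 0"
  shows "word \<alpha> zoff ws x \<bullet> word \<alpha> zoff ws y = x \<bullet> y"
  using assms by (induction ws) (auto simp: srefl_inner)

lemma word_norm:
  assumes "\<And>i. i \<in> set ws \<Longrightarrow> \<alpha> i \<noteq> 0"
  shows "norm (word \<alpha> zoff ws x) = norm x"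
  using word_inner[OF assms, where x=x and y=x] by (simp add: norm_eq_sqrt_inner)

lemma id_in_wgroup: "id \<in> wgroup \<alpha> p J"
  unfolding wgroup_def by (rule CollectI, rule exI[of _ "[]"]) simp

lemma srefl_in_wgroup: "i \<in> J \<Longrightarrow> srefl \<alpha> p i \<in> wgroup \<alpha> p J"
  unfolding wgroup_def by (rule CollectI, rule exI[of _ "[i]"]) simp

lemma comp_in_wgroup: "u \<in> wgroup \<alpha> p J \<Longrightarrow> w \<in> wgroup \<alpha> p J \<Longrightarrow> u \<circ> w \<in> wgroup \<alpha> p J"
proof -
  assume "u \<in> wgroup \<alpha> p J" "w \<in> wgroup \<alpha> p J"
  then obtain us ws where "u = word \<alpha> p us" "set us \<subseteq> J" "w = word \<alpha> p ws" "set ws \<subseteq> J"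
    by (auto simp: wgroup_def)
  then show ?thesis
    unfolding wgroup_def by (intro CollectI exI[of _ "us @ ws"]) (simp add: word_append)
qed

lemma wgroup_inverse:
  assumes "\<And>i. i \<in> J \<Longrightarrow> \<alpha> i \<noteq> 0" "u \<in> wgroup \<alpha> p J"
  obtains w where "w \<in> wgroup \<alpha> p J" "u \<circ> w = id" "w \<circ> u = id"
proof -
  obtain ws where ws: "u = word \<alpha> p ws" "set ws \<subseteq> J" using assms(2) by (auto simp: wgroup_def)
  have nz: "\<alpha> i \<noteq> 0" if "i \<in> set ws" for i using ws assms(1) that by auto
  show thesis
  proof (rule that[of "word \<alpha> p (rev ws)"])
    show "word \<alpha> p (rev ws) \<in> wgroup \<alpha> p J" using ws by (auto simp: wgroup_def intro!: exI[of _ "rev ws"])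
    show "u \<circ> word \<alpha> p (rev ws) = id" using word_rev[of ws \<alpha> p] nz unfolding ws(1) fun_eq_iff by simp
    show "word \<alpha> p (rev ws) \<circ> u = id" using word_rev[of "rev ws" \<alpha> p] nz unfolding ws(1) fun_eq_iff by simp
  qed
qed

lemma bij_srefl: "\<alpha> i \<noteq> 0 \<Longrightarrow> bij (srefl \<alpha> p i)"
  by (rule o_bij[of "srefl \<alpha> p i"]) (auto simp: srefl_invol)

lemma bij_wgroup:
  assumes "\<And>i. i \<in> J \<Longrightarrow> \<alpha> i \<noteq> 0" "u \<in> wgroup \<alpha> p J"
  shows "bij u"
proof -
  obtain w where "w \<in> wgroup \<alpha> p J" "u \<circ> w = id" "w \<circ> u = id"
    using wgroup_inverse[OF assms] by blast
  then show ?thesis by (intro o_bij[of w u])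
qed

text \<open>The generators are involutions, so products without inverses already exhaust the
  group.\<close>

lemma generated_srefl:
  fixes \<alpha> :: "nat \<Rightarrow> real ^ 'n"
  assumes nz: "\<And>i. i \<in> J \<Longrightarrow> \<alpha> i \<noteq> 0"
  shows "generated (srefl \<alpha> p ` J) = wgroup \<alpha> p J"
proof
  have Bij: "u \<in> Bij UNIV" if "u \<in> wgroup \<alpha> p J" for u
    using bij_wgroup[OF nz that] by (simp add: Bij_def)
  have inv_s: "inv\<^bsub>BijGroup UNIV\<^esub> (srefl \<alpha> p i) = srefl \<alpha> p i" if "i \<in> J" for i
  proof -
    have "inv\<^bsub>BijGroup UNIV\<^esub> (srefl \<alpha> p i) = inv_into UNIV (srefl \<alpha> p i)"
      using Bij srefl_in_wgroup[OF that] by (subst inv_BijGroup) auto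
    also have "\<dots> = srefl \<alpha> p i"
      by (rule inv_unique_comp) (auto simp: srefl_invol nz that fun_eq_iff)
    finally show ?thesis .
  qed
  show "generated (srefl \<alpha> p ` J) \<subseteq> wgroup \<alpha> p J"
  proof
    fix u assume "u \<in> generated (srefl \<alpha> p ` J)"
    then show "u \<in> wgroup \<alpha> p J"
    proof (induction rule: generate.induct)
      case one
      then show ?case using id_in_wgroup[of \<alpha> p J] by (simp add: BijGroup_def id_def)
    next
      case (incl h) then show ?case by (auto simp: srefl_in_wgroup)
    next
      case (inv h) then show ?case by (auto simp: inv_s srefl_in_wgroup)
    next
      case (eng h1 h2)
      then have "h1 \<otimes>\<^bsub>BijGroup UNIV\<^esub> h2 = h1 \<circ> h2"
        using Bij by (auto simp: BijGroup_def compose_def)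
      then show ?case using comp_in_wgroup[OF eng(3,4)] by (simp only:)
    qed
  qed
  have "word \<alpha> p ws \<in> generated (srefl \<alpha> p ` J)" if "set ws \<subseteq> J" for ws
    using that
  proof (induction ws)
    case Nil
    have "\<one>\<^bsub>BijGroup UNIV\<^esub> = (id :: real ^ 'n \<Rightarrow> real ^ 'n)" by (auto simp: BijGroup_def)
    then show ?case using generate.one[of "BijGroup UNIV" "srefl \<alpha> p ` J"] by (simp only: word_Nil)
  next
    case (Cons i ws)
    have "srefl \<alpha> p i \<otimes>\<^bsub>BijGroup UNIV\<^esub> word \<alpha> p ws \<in> generated (srefl \<alpha> p ` J)"
      using Cons by (intro generate.eng generate.incl[of "srefl \<alpha> p i"]) auto
    moreover have "srefl \<alpha> p i \<in> Bij UNIV" "word \<alpha> p ws \<in> Bij UNIV"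
      using Cons by (auto intro!: Bij srefl_in_wgroup simp: wgroup_def)
    then have "srefl \<alpha> p i \<otimes>\<^bsub>BijGroup UNIV\<^esub> word \<alpha> p ws = word \<alpha> p (i # ws)"
      by (auto simp: BijGroup_def compose_def)
    ultimately show ?case by (simp only:)
  qed
  then show "wgroup \<alpha> p J \<subseteq> generated (srefl \<alpha> p ` J)" by (auto simp: wgroup_def)
qed

text \<open>Flattens the nesting in \<open>weyl_v\<close>, which adjoins a reflection to a group
  that is itself generated.\<close>

lemma (in group) generate_insert_generate:
  assumes "x \<in> carrier G" "S \<subseteq> carrier G"
  shows "generate G (insert x (generate G S)) = generate G (insert x S)"
proof
  have "generate G S \<subseteq> generate G (insert x S)" by (intro mono_generate) auto
  then show "generate G (insert x (generate G S)) \<subseteq> generate G (insert x S)"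
    using assms by (intro generate_subgroup_incl generate_is_subgroup) (auto intro: generate.incl)
  show "generate G (insert x S) \<subseteq> generate G (insert x (generate G S))"
    by (intro mono_generate) (auto intro: generate.incl)
qed

section \<open>Signs\<close>

text \<open>An orthogonal map taking a coordinate vector to the direction of \<open>b\<close>
  conjugates the reflection into a diagonal matrix with a single entry -1.\<close>

lemma det_root_refl:
  fixes b :: "real ^ 'n"
  assumes "b \<noteq> 0"
  shows "det (matrix (root_refl b)) = -1"
proof -
  obtain k :: 'n where True by simp
  define a where "a = (axis k 1 :: real ^ 'n)"
  have a: "norm a = 1" by (simp add: a_def)
  obtain f where f: "orthogonal_transformation f" "f a = (1 / norm b) *\<^sub>R b"
    using orthogonal_transformation_exists_1[of a "(1 / norm b) *\<^sub>R b"] a assms by auto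
  have lf: "linear f" using f(1) by (simp add: orthogonal_transformation_linear)
  have fa: "f (c *\<^sub>R a) = (c / norm b) *\<^sub>R b" for c
    using linear_cmul[OF lf] f(2) by simp
  have bb: "b \<bullet> b = norm b * norm b" by (simp add: dot_square_norm power2_eq_square)
  have in_f: "f x \<bullet> b = norm b * (x \<bullet> a)" for x
  proof -
    have "x \<bullet> a = f x \<bullet> f a" using f(1) by (simp add: orthogonal_transformation_def)
    then show ?thesis using assms f(2) by simp
  qed
  have comm: "root_refl b \<circ> f = f \<circ> root_refl a"
  proof
    fix x
    have "root_refl b (f x) = f x - (2 * (x \<bullet> a) / norm b) *\<^sub>R b"
      using assms by (simp add: root_refl_def pairing_def in_f bb)
    also have "\<dots> = f (x - (2 * (x \<bullet> a)) *\<^sub>R a)"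
      by (simp only: linear_diff[OF lf] fa)
    also have "\<dots> = f (root_refl a x)"
      using a by (simp add: root_refl_def pairing_def dot_square_norm)
    finally show "(root_refl b \<circ> f) x = (f \<circ> root_refl a) x" by simp
  qed
  have "det (matrix (root_refl b)) * det (matrix f) = det (matrix f) * det (matrix (root_refl a))"
  proof -
    have "matrix (root_refl b) ** matrix f = matrix (root_refl b \<circ> f)"
      by (rule matrix_compose[symmetric]) (auto simp: lf linear_root_refl)
    also have "\<dots> = matrix f ** matrix (root_refl a)"
      unfolding comm by (rule matrix_compose) (auto simp: lf linear_root_refl)
    finally show ?thesis by (metis det_mul)
  qed
  moreover have "det (matrix f) \<noteq> 0"
    using orthogonal_transformation_det[OF f(1)] by auto
  moreover have "det (matrix (root_refl a)) = -1"
  proof -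
    have entry: "matrix (root_refl a) $ i $ j = (if i = j then if i = k then -1 else 1 else 0)" for i j
    proof -
      have "pairing (axis j 1) a = (if j = k then 2 else 0)"
        by (simp add: pairing_def a_def inner_axis_axis)
      then show ?thesis
        by (simp add: matrix_def root_refl_def) (simp add: a_def axis_def)
    qed
    have "det (matrix (root_refl a)) = (\<Prod>i\<in>UNIV. matrix (root_refl a) $ i $ i)"
      by (rule det_diagonal) (simp add: entry)
    also have "\<dots> = (\<Prod>i\<in>UNIV. if i = k then -1 else 1)" by (simp add: entry)
    also have "\<dots> = -1" by (simp add: prod.delta)
    finally show ?thesis .
  qed
  ultimately show ?thesis
    by (metis mult.commute mult_cancel_left)
qed

lemma det_word:
  assumes "\<And>i. i \<in> set ws \<Longrightarrow> \<alpha> i \<noteq> 0"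
  shows "det (matrix (word \<alpha> zoff ws)) = (-1) ^ length ws"
  using assms
proof (induction ws)
  case (Cons i ws)
  have "matrix (word \<alpha> zoff (i # ws)) = matrix (root_refl (\<alpha> i)) ** matrix (word \<alpha> zoff ws)"
    by (simp add: srefl_zoff matrix_compose linear_word linear_root_refl)
  then have "det (matrix (word \<alpha> zoff (i # ws))) = det (matrix (root_refl (\<alpha> i))) * det (matrix (word \<alpha> zoff ws))"
    by (simp only: det_mul)
  also have "\<dots> = (-1) ^ length (i # ws)" using Cons by (simp add: det_root_refl)
  finally show ?case .
qed simp

text \<open>Offsets affect only the translation part, so the sign is the parity of the length for
  every \<open>p\<close>.\<close>

lemma lin_sign_word:
  assumes "\<And>i. i \<in> set ws \<Longrightarrow> \<alpha> i \<noteq> 0"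
  shows "lin_sign (word \<alpha> p ws) = (-1) ^ length ws"
proof -
  have "(\<lambda>x. word \<alpha> p ws x - word \<alpha> p ws 0) = word \<alpha> zoff ws"
    by (simp add: word_diff)
  then have "lin_sign (word \<alpha> p ws) = \<lfloor>(-1) ^ length ws :: real\<rfloor>"
    using det_word[OF assms] by (simp add: lin_sign_def)
  also have "(-1) ^ length ws = (of_int ((-1) ^ length ws) :: real)" by simp
  finally show ?thesis by (simp only: floor_of_int)
qed

section \<open>The root system\<close>

locale root_data =
  fixes \<Phi> :: "(real ^ 'n) set" and \<alpha> :: "nat \<Rightarrow> real ^ 'n"
  assumes data: "simple_group_data \<Phi> \<alpha>"
begin

abbreviation "\<Lambda> \<equiv> weight_lattice \<Phi>"

lemma rs: "root_system \<Phi>" and sr: "simple_roots \<Phi> \<alpha>" and hr: "highest_root \<Phi> \<alpha> (- \<alpha> 0)"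
  using data by (auto simp: simple_group_data_def)

lemma finite_roots: "finite \<Phi>" and span_roots: "span \<Phi> = UNIV" and zero_not_root: "0 \<notin> \<Phi>"
  using rs by (auto simp: root_system_def)

lemma root_refl_root: "b \<in> \<Phi> \<Longrightarrow> c \<in> \<Phi> \<Longrightarrow> root_refl b c \<in> \<Phi>"
  using rs unfolding root_system_def by blast

lemma pairing_roots: "b \<in> \<Phi> \<Longrightarrow> c \<in> \<Phi> \<Longrightarrow> pairing c b \<in> \<int>"
  using rs unfolding root_system_def by blast

lemma reduced: "b \<in> \<Phi> \<Longrightarrow> c *\<^sub>R b \<in> \<Phi> \<Longrightarrow> c = 1 \<or> c = -1"
  using rs unfolding root_system_def by blast

lemma minus_root: "b \<in> \<Phi> \<Longrightarrow> - b \<in> \<Phi>"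
proof -
  assume b: "b \<in> \<Phi>"
  then have "b \<noteq> 0" using zero_not_root by auto
  then have "root_refl b b = - b" by (simp add: root_refl_def pairing_self scaleR_2)
  then show ?thesis using root_refl_root[OF b b] by simp
qed

lemma alpha_root: "i \<le> CARD('n) \<Longrightarrow> \<alpha> i \<in> \<Phi>"
proof (cases "i = 0")
  case True
  then show ?thesis using hr minus_root[of "- \<alpha> 0"] by (simp add: highest_root_def)
next
  case False
  assume "i \<le> CARD('n)"
  then have "i \<in> {1..CARD('n)}" using False by auto
  then show ?thesis using sr unfolding simple_roots_def by blast
qed

lemma alpha_nz: "i \<le> CARD('n) \<Longrightarrow> \<alpha> i \<noteq> 0"
  using alpha_root zero_not_root by metis

lemma alpha_sq_pos: "i \<le> CARD('n) \<Longrightarrow> \<alpha> i \<bullet> \<alpha> i > 0"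
  using alpha_nz by auto

lemma alpha_nz_subset: "J \<subseteq> {0..CARD('n)} \<Longrightarrow> i \<in> J \<Longrightarrow> \<alpha> i \<noteq> 0"
  using alpha_nz by auto

lemma sum_indep:
  assumes "(\<Sum>i\<in>{1..CARD('n)}. c i *\<^sub>R \<alpha> i) = 0" "i \<in> {1..CARD('n)}"
  shows "c i = (0::real)"
proof -
  have inj: "inj_on \<alpha> {1..CARD('n)}" and ind: "independent (\<alpha> ` {1..CARD('n)})"
    using sr by (auto simp: simple_roots_def)
  define f where "f = (\<lambda>b. c (the_inv_into {1..CARD('n)} \<alpha> b))"
  have f: "f (\<alpha> j) = c j" if "j \<in> {1..CARD('n)}" for j
    using that inj by (simp add: f_def the_inv_into_f_f)
  have "(\<Sum>b\<in>\<alpha> ` {1..CARD('n)}. f b *\<^sub>R b) = (\<Sum>i\<in>{1..CARD('n)}. c i *\<^sub>R \<alpha> i)"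
    by (subst sum.reindex[OF inj]) (auto intro!: sum.cong simp: f)
  then have "f (\<alpha> i) = 0"
    using independentD[OF ind, of "\<alpha> ` {1..CARD('n)}" f "\<alpha> i"] assms by auto
  then show ?thesis using f assms(2) by simp
qed

lemma sum_indep_eq:
  assumes "(\<Sum>i\<in>{1..CARD('n)}. c i *\<^sub>R \<alpha> i) = (\<Sum>i\<in>{1..CARD('n)}. d i *\<^sub>R \<alpha> i)" "i \<in> {1..CARD('n)}"
  shows "c i = (d i :: real)"
proof -
  have "(\<Sum>i\<in>{1..CARD('n)}. (c i - d i) *\<^sub>R \<alpha> i) = 0"
    using assms(1) by (simp add: algebra_simps sum_subtractf)
  from sum_indep[OF this assms(2)] show ?thesis by simp
qed

lemma nat_comb_or:
  "b \<in> \<Phi> \<Longrightarrow> nat_comb \<alpha> {1..CARD('n)} b \<or> nat_comb \<alpha> {1..CARD('n)} (- b)"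
  using sr by (auto simp: simple_roots_def)

lemma highest_minus: "b \<in> \<Phi> \<Longrightarrow> nat_comb \<alpha> {1..CARD('n)} (- \<alpha> 0 - b)"
  using hr by (auto simp: highest_root_def)

text \<open>No coefficient vanishes, since the highest root dominates every simple root.\<close>

lemma marks:
  obtains m :: "nat \<Rightarrow> nat" where "- \<alpha> 0 = (\<Sum>i\<in>{1..CARD('n)}. real (m i) *\<^sub>R \<alpha> i)"
    "\<And>i. i \<in> {1..CARD('n)} \<Longrightarrow> m i \<ge> 1"
proof -
  have ex: "\<exists>m::nat\<Rightarrow>nat. - \<alpha> 0 = (\<Sum>i\<in>{1..CARD('n)}. real (m i) *\<^sub>R \<alpha> i) \<and> m v \<ge> 1" if v: "v \<in> {1..CARD('n)}" for v
  proof -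
    obtain c :: "nat \<Rightarrow> nat" where c: "- \<alpha> 0 - \<alpha> v = (\<Sum>i\<in>{1..CARD('n)}. real (c i) *\<^sub>R \<alpha> i)"
      using highest_minus[OF alpha_root] v unfolding nat_comb_def by force
    have "(\<Sum>i\<in>{1..CARD('n)}. real (c i + (if i = v then 1 else 0)) *\<^sub>R \<alpha> i)
        = (\<Sum>i\<in>{1..CARD('n)}. real (c i) *\<^sub>R \<alpha> i) + (\<Sum>i\<in>{1..CARD('n)}. if i = v then \<alpha> i else 0)"
      unfolding sum.distrib[symmetric] by (intro sum.cong) (auto simp: scaleR_left_distrib)
    also have "(\<Sum>i\<in>{1..CARD('n)}. if i = v then \<alpha> i else 0) = \<alpha> v" using v by simp
    also have "(\<Sum>i\<in>{1..CARD('n)}. real (c i) *\<^sub>R \<alpha> i) + \<alpha> v = - \<alpha> 0" unfolding c[symmetric] by simp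
    finally show ?thesis by (intro exI[of _ "\<lambda>i. c i + (if i = v then 1 else 0)"]) auto
  qed
  have "1 \<in> {1..CARD('n)}" by (simp add: Suc_leI)
  from ex[OF this] obtain m :: "nat \<Rightarrow> nat" where m: "- \<alpha> 0 = (\<Sum>i\<in>{1..CARD('n)}. real (m i) *\<^sub>R \<alpha> i)" by blast
  show thesis
  proof (rule that[OF m])
    \<comment> \<open>\<open>ex\<close> yields a possibly different family for each index;
      independence of the simple roots identifies it with the fixed \<open>m\<close>.\<close>
    fix i assume i: "i \<in> {1..CARD('n)}"
    from ex[OF i] obtain m' :: "nat \<Rightarrow> nat"
      where m': "- \<alpha> 0 = (\<Sum>i\<in>{1..CARD('n)}. real (m' i) *\<^sub>R \<alpha> i)" "m' i \<ge> 1" by blast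
    have "real (m i) = real (m' i)"
      using sum_indep_eq[of "\<lambda>i. real (m i)" "\<lambda>i. real (m' i)" i] m m'(1) i by simp
    then show "m i \<ge> 1" using m'(2) by simp
  qed
qed

text \<open>Integer coefficient vectors over all of \<open>\<alpha> 0, \<dots>, \<alpha> n\<close> are the real affine roots; keeping the
  coefficients rather than their sum avoids any appeal to linear independence.\<close>

definition cvec :: "(nat \<Rightarrow> int) \<Rightarrow> real ^ 'n" where
  "cvec c = (\<Sum>i\<in>{0..CARD('n)}. of_int (c i) *\<^sub>R \<alpha> i)"

definition unit :: "nat \<Rightarrow> nat \<Rightarrow> int" where
  "unit i = (\<lambda>j. if j = i then 1 else 0)"

lemma cvec_upd: "i \<le> CARD('n) \<Longrightarrow> cvec (c(i := c i + k)) = cvec c + of_int k *\<^sub>R \<alpha> i"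
proof -
  assume i: "i \<le> CARD('n)"
  have "cvec (c(i := c i + k)) = (\<Sum>j\<in>{0..CARD('n)}. of_int (c j) *\<^sub>R \<alpha> j + (if j = i then of_int k *\<^sub>R \<alpha> j else 0))"
    unfolding cvec_def by (intro sum.cong) (auto simp: scaleR_left_distrib)
  also have "\<dots> = cvec c + of_int k *\<^sub>R \<alpha> i"
    unfolding sum.distrib using i by (simp add: cvec_def)
  finally show ?thesis .
qed

lemma cvec_unit: "i \<le> CARD('n) \<Longrightarrow> cvec (unit i) = \<alpha> i"
proof -
  assume i: "i \<le> CARD('n)"
  have "cvec (unit i) = (\<Sum>j\<in>{0..CARD('n)}. if j = i then \<alpha> j else 0)"
    unfolding cvec_def unit_def by (intro sum.cong) auto
  then show ?thesis using i by simp
qed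

section \<open>Sign coherence of affine roots\<close>

lemma sum_head: "(\<Sum>i\<in>{0..CARD('n)}. f i) = f 0 + (\<Sum>i\<in>{1..CARD('n)}. f i)" for f :: "nat \<Rightarrow> 'b::comm_monoid_add"
  using sum.atLeast_Suc_atMost[of 0 "CARD('n)" f] by simp

text \<open>With \<open>b\<close> the coefficients of the root in the simple roots and
  \<open>m\<close> those of the highest root, \<open>c i = b i + c 0 * m i\<close> and
  \<open>0 \<le> b i \<le> m i\<close> for \<open>i \<ge> 1\<close>. So \<open>c 0\<close> decides
  all signs: if it is nonnegative, so is every entry; if it is at most -1, the other entries are at
  most \<open>b i - m i \<le> 0\<close>.\<close>

lemma cvec_sign_aux:
  assumes "cvec c \<in> \<Phi>" "nat_comb \<alpha> {1..CARD('n)} (cvec c)"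
  shows "(\<forall>i\<le>CARD('n). c i \<ge> 0) \<or> (\<forall>i\<le>CARD('n). c i \<le> 0)"
proof -
  obtain m :: "nat \<Rightarrow> nat" where m: "- \<alpha> 0 = (\<Sum>i\<in>{1..CARD('n)}. real (m i) *\<^sub>R \<alpha> i)"
    using marks by blast
  obtain b :: "nat \<Rightarrow> nat" where b: "cvec c = (\<Sum>i\<in>{1..CARD('n)}. real (b i) *\<^sub>R \<alpha> i)"
    using assms(2) by (auto simp: nat_comb_def)
  obtain d :: "nat \<Rightarrow> nat" where d: "- \<alpha> 0 - cvec c = (\<Sum>i\<in>{1..CARD('n)}. real (d i) *\<^sub>R \<alpha> i)"
    using highest_minus[OF assms(1)] by (auto simp: nat_comb_def)
  have "(\<Sum>i\<in>{1..CARD('n)}. real (m i) *\<^sub>R \<alpha> i) = (\<Sum>i\<in>{1..CARD('n)}. (real (b i) + real (d i)) *\<^sub>R \<alpha> i)"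
    unfolding scaleR_left_distrib sum.distrib b[symmetric] d[symmetric] m[symmetric] by simp
  then have mbd: "m i = b i + d i" if "i \<in> {1..CARD('n)}" for i
    using sum_indep_eq[of "\<lambda>i. real (m i)" "\<lambda>i. real (b i) + real (d i)" i] that by simp
  have "cvec c = of_int (c 0) *\<^sub>R \<alpha> 0 + (\<Sum>i\<in>{1..CARD('n)}. of_int (c i) *\<^sub>R \<alpha> i)"
    unfolding cvec_def by (rule sum_head)
  also have "\<alpha> 0 = - (\<Sum>i\<in>{1..CARD('n)}. real (m i) *\<^sub>R \<alpha> i)" by (metis m minus_minus)
  finally have "(\<Sum>i\<in>{1..CARD('n)}. real (b i) *\<^sub>R \<alpha> i)
      = (\<Sum>i\<in>{1..CARD('n)}. (of_int (c i) - of_int (c 0) * real (m i)) *\<^sub>R \<alpha> i)"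
    by (simp add: b scaleR_sum_right sum_subtractf scaleR_left_diff_distrib)
  then have "real (b i) = of_int (c i) - of_int (c 0) * real (m i)" if "i \<in> {1..CARD('n)}" for i
    using sum_indep_eq[of "\<lambda>i. real (b i)" "\<lambda>i. of_int (c i) - of_int (c 0) * real (m i)" i] that by simp
  then have "real_of_int (int (b i)) = real_of_int (c i - c 0 * int (m i))" if "i \<in> {1..CARD('n)}" for i
    using that by simp
  then have bc: "c i = int (b i) + c 0 * int (m i)" if "i \<in> {1..CARD('n)}" for i
    using that by (simp only: of_int_eq_iff)
  show ?thesis
  proof (cases "c 0 \<ge> 0")
    case True
    then have "c i \<ge> 0" if "i \<le> CARD('n)" for i
      using bc[of i] that by (cases "i = 0") auto
    then show ?thesis by blast
  next
    case False
    have "c i \<le> 0" if "i \<le> CARD('n)" for i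
    proof (cases "i = 0")
      case False': False
      then have i: "i \<in> {1..CARD('n)}" using that by auto
      have "c 0 * int (m i) \<le> - 1 * int (m i)"
        using False by (intro mult_right_mono) auto
      then show ?thesis using bc[OF i] mbd[OF i] by simp
    qed (use False in auto)
    then show ?thesis by blast
  qed
qed

lemma cvec_sign:
  assumes "cvec c \<in> \<Phi>"
  shows "(\<forall>i\<le>CARD('n). c i \<ge> 0) \<or> (\<forall>i\<le>CARD('n). c i \<le> 0)"
proof (cases "nat_comb \<alpha> {1..CARD('n)} (cvec c)")
  case False
  have m: "cvec (\<lambda>i. - c i) = - cvec c" by (simp add: cvec_def sum_negf)
  then have "nat_comb \<alpha> {1..CARD('n)} (cvec (\<lambda>i. - c i))" using nat_comb_or[OF assms] False by simp
  then have "(\<forall>i\<le>CARD('n). - c i \<ge> 0) \<or> (\<forall>i\<le>CARD('n). - c i \<le> 0)"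
    using minus_root[OF assms] m by (intro cvec_sign_aux) auto
  then show ?thesis by auto
qed (use cvec_sign_aux assms in blast)

text \<open>The simple reflection written on coefficients, where it changes one entry only. The
  floor is exact when \<open>cvec c\<close> is a root, since the pairing is then an integer.\<close>

definition crefl :: "nat \<Rightarrow> (nat \<Rightarrow> int) \<Rightarrow> nat \<Rightarrow> int" where
  "crefl i c = c(i := c i - \<lfloor>pairing (cvec c) (\<alpha> i)\<rfloor>)"

lemma cvec_crefl:
  assumes "i \<le> CARD('n)" "cvec c \<in> \<Phi>"
  shows "cvec (crefl i c) = root_refl (\<alpha> i) (cvec c)"
proof -
  have "real_of_int \<lfloor>pairing (cvec c) (\<alpha> i)\<rfloor> = pairing (cvec c) (\<alpha> i)"
    using pairing_roots[OF alpha_root] assms by (auto elim: Ints_cases)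
  then show ?thesis
    using cvec_upd[OF assms(1), of c "- \<lfloor>pairing (cvec c) (\<alpha> i)\<rfloor>"]
    by (simp add: crefl_def root_refl_def)
qed

lemma crefl_root: "i \<le> CARD('n) \<Longrightarrow> cvec c \<in> \<Phi> \<Longrightarrow> cvec (crefl i c) \<in> \<Phi>"
  by (simp add: cvec_crefl root_refl_root alpha_root)

text \<open>A simple reflection permutes the positive affine roots other than its own.\<close>

lemma crefl_simple:
  assumes c: "cvec c \<in> \<Phi>" "\<forall>j\<le>CARD('n). c j \<ge> 0" and i: "i \<le> CARD('n)"
    and neg: "\<not> (\<forall>j\<le>CARD('n). crefl i c j \<ge> 0)"
  shows "\<forall>j\<le>CARD('n). c j = unit i j"
proof -
  have "\<forall>j\<le>CARD('n). crefl i c j \<le> 0"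
    using cvec_sign[OF crefl_root[OF i c(1)]] neg by blast
  \<comment> \<open>Entries other than \<open>i\<close> are unchanged by \<open>crefl i\<close>,
    hence both nonnegative and nonpositive.\<close>
  then have z: "c j = 0" if "j \<le> CARD('n)" "j \<noteq> i" for j
    using that c(2) by (force simp: crefl_def)
  have "cvec c = (\<Sum>j\<in>{0..CARD('n)}. if j = i then of_int (c i) *\<^sub>R \<alpha> i else 0)"
    unfolding cvec_def using z by (intro sum.cong) auto
  then have "cvec c = of_int (c i) *\<^sub>R \<alpha> i" using i by simp
  then have "real_of_int (c i) = 1 \<or> real_of_int (c i) = -1"
    using reduced[OF alpha_root[OF i]] c(1) by metis
  then have "c i = 1" using c(2) i by (metis neg_0_le_iff_le not_one_le_zero of_int_0_le_iff of_int_eq_1_iff)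
  then show ?thesis using z by (simp add: unit_def)
qed

section \<open>Affine functions and their pullbacks along words\<close>

text \<open>The value at \<open>x\<close> of an affine function with gradient \<open>cvec c\<close>.
  The factor \<open>(\<alpha> i \<bullet> \<alpha> i) / 2\<close> turns the coroot pairing into the
  inner product with \<open>\<alpha> i\<close>. For \<open>unit i\<close> the zero set is the wall
  of the reflection \<open>srefl \<alpha> p i\<close>.\<close>

definition lval :: "(nat \<Rightarrow> real) \<Rightarrow> (nat \<Rightarrow> int) \<Rightarrow> real ^ 'n \<Rightarrow> real" where
  "lval p c x = (\<Sum>i\<in>{0..CARD('n)}. of_int (c i) * ((\<alpha> i \<bullet> \<alpha> i) / 2 * (pairing x (\<alpha> i) + p i)))"

lemma lval_unit: "i \<le> CARD('n) \<Longrightarrow> lval p (unit i) x = (\<alpha> i \<bullet> \<alpha> i) / 2 * (pairing x (\<alpha> i) + p i)"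
proof -
  assume i: "i \<le> CARD('n)"
  have "lval p (unit i) x = (\<Sum>j\<in>{0..CARD('n)}. if j = i then (\<alpha> j \<bullet> \<alpha> j) / 2 * (pairing x (\<alpha> j) + p j) else 0)"
    unfolding lval_def unit_def by (intro sum.cong) auto
  then show ?thesis using i by simp
qed

lemma lval_add: "lval p c (x + y) = lval p c x + y \<bullet> cvec c"
proof -
  have "of_int (c i) * ((\<alpha> i \<bullet> \<alpha> i) / 2 * (pairing (x + y) (\<alpha> i) + p i))
      = of_int (c i) * ((\<alpha> i \<bullet> \<alpha> i) / 2 * (pairing x (\<alpha> i) + p i)) + of_int (c i) * (y \<bullet> \<alpha> i)"
    if "i \<le> CARD('n)" for i
  proof -
    have "\<alpha> i \<bullet> \<alpha> i / 2 * pairing y (\<alpha> i) = y \<bullet> \<alpha> i"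
      using alpha_nz[OF that] by (simp add: pairing_def)
    then have "\<alpha> i \<bullet> \<alpha> i / 2 * (pairing (x + y) (\<alpha> i) + p i)
        = \<alpha> i \<bullet> \<alpha> i / 2 * (pairing x (\<alpha> i) + p i) + y \<bullet> \<alpha> i"
      by (simp add: pairing_add field_simps)
    then show ?thesis by (simp only: distrib_left)
  qed
  then have "lval p c (x + y) = (\<Sum>i\<in>{0..CARD('n)}. of_int (c i) * ((\<alpha> i \<bullet> \<alpha> i) / 2 * (pairing x (\<alpha> i) + p i))
      + of_int (c i) * (y \<bullet> \<alpha> i))"
    unfolding lval_def by (intro sum.cong) auto
  then show ?thesis
    by (simp add: sum.distrib lval_def cvec_def inner_sum_right)
qed

lemma lval_crefl:
  assumes i: "i \<le> CARD('n)" and c: "cvec c \<in> \<Phi>"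
  shows "lval p (crefl i c) x = lval p c (srefl \<alpha> p i x)"
proof -
  define k where "k = \<lfloor>pairing (cvec c) (\<alpha> i)\<rfloor>"
  have k: "real_of_int k = pairing (cvec c) (\<alpha> i)"
    using pairing_roots[OF alpha_root] assms by (auto elim!: Ints_cases simp: k_def)
  let ?t = "(\<alpha> i \<bullet> \<alpha> i) / 2 * (pairing x (\<alpha> i) + p i)"
  have "lval p (crefl i c) x = (\<Sum>j\<in>{0..CARD('n)}. of_int (c j) * ((\<alpha> j \<bullet> \<alpha> j) / 2 * (pairing x (\<alpha> j) + p j))
      - (if j = i then of_int k * ?t else 0))"
    unfolding lval_def crefl_def k_def[symmetric] by (intro sum.cong) (auto simp: left_diff_distrib)
  also have "\<dots> = lval p c x - of_int k * ?t"
    unfolding sum_subtractf using i by (simp add: lval_def)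
  also have "of_int k * ?t = (pairing x (\<alpha> i) + p i) * (cvec c \<bullet> \<alpha> i)"
    using alpha_nz[OF i] by (simp add: k pairing_def[of "cvec c"])
  also have "lval p c x - \<dots> = lval p c (srefl \<alpha> p i x)"
    using lval_add[of p c x "- ((pairing x (\<alpha> i) + p i) *\<^sub>R \<alpha> i)"]
    by (simp add: srefl_def inner_commute)
  finally show ?thesis .
qed

text \<open>Letters are consumed from the left because the pullback of a function along
  \<open>word \<alpha> p ws\<close> meets the outermost reflection first.\<close>

primrec cact :: "nat list \<Rightarrow> (nat \<Rightarrow> int) \<Rightarrow> nat \<Rightarrow> int" where
  "cact [] c = c"
| "cact (i # ws) c = cact ws (crefl i c)"

lemma cact_snoc: "cact (ws @ [j]) c = crefl j (cact ws c)"
  by (induction ws arbitrary: c) auto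

lemma cact_root: "set ws \<subseteq> {0..CARD('n)} \<Longrightarrow> cvec c \<in> \<Phi> \<Longrightarrow> cvec (cact ws c) \<in> \<Phi>"
  by (induction ws arbitrary: c) (auto simp: crefl_root)

lemma cact_support: "set ws \<subseteq> J \<Longrightarrow> (\<And>j. j \<notin> J \<Longrightarrow> c j = 0) \<Longrightarrow> j \<notin> J \<Longrightarrow> cact ws c j = 0"
proof (induction ws arbitrary: c)
  case (Cons i ws)
  have "crefl i c l = 0" if "l \<notin> J" for l using that Cons.prems by (auto simp: crefl_def)
  then show ?case using Cons by simp
qed simp

lemma lval_cact:
  "set ws \<subseteq> {0..CARD('n)} \<Longrightarrow> cvec c \<in> \<Phi> \<Longrightarrow> lval p (cact ws c) x = lval p c (word \<alpha> p ws x)"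
  by (induction ws arbitrary: c x) (auto simp: lval_crefl crefl_root)

lemma cvec_cact:
  "set ws \<subseteq> {0..CARD('n)} \<Longrightarrow> cvec c \<in> \<Phi> \<Longrightarrow> word \<alpha> zoff ws (cvec (cact ws c)) = cvec c"
proof (induction ws arbitrary: c)
  case (Cons i ws)
  then have "word \<alpha> zoff (i # ws) (cvec (cact (i # ws) c)) = srefl \<alpha> zoff i (cvec (crefl i c))"
    by (simp add: crefl_root)
  also have "\<dots> = srefl \<alpha> zoff i (srefl \<alpha> zoff i (cvec c))"
    using Cons by (simp add: cvec_crefl srefl_zoff)
  also have "\<dots> = cvec c" using Cons by (intro srefl_invol alpha_nz) auto
  finally show ?case .
qed simp

section \<open>Exchange condition and chambers\<close>

text \<open>If the word pulls the \<open>i\<close>-th wall function back to the \<open>j\<close>-th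
  one, it conjugates one reflection into the other. Equal coefficient vectors give equality of the
  gradients and of the values at once.\<close>

lemma srefl_word_swap:
  assumes ws: "set ws \<subseteq> {0..CARD('n)}" and ij: "i \<le> CARD('n)" "j \<le> CARD('n)"
    and eq: "\<forall>l\<le>CARD('n). cact ws (unit i) l = unit j l"
  shows "srefl \<alpha> p i \<circ> word \<alpha> p ws = word \<alpha> p ws \<circ> srefl \<alpha> p j"
proof
  fix x
  have root: "cvec (unit i) \<in> \<Phi>" using ij by (simp add: cvec_unit alpha_root)
  have "cvec (cact ws (unit i)) = cvec (unit j)" unfolding cvec_def using eq by (intro sum.cong) auto
  then have h: "word \<alpha> zoff ws (\<alpha> j) = \<alpha> i"
    using cvec_cact[OF ws root] ij by (simp add: cvec_unit)
  have nz: "\<alpha> l \<noteq> 0" if "l \<in> set ws" for l using alpha_nz ws that by auto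
  have n: "\<alpha> i \<bullet> \<alpha> i = \<alpha> j \<bullet> \<alpha> j" using word_inner[where ws = ws and \<alpha> = \<alpha> and x = "\<alpha> j" and y = "\<alpha> j", OF nz] h by simp
  have "lval p (unit i) (word \<alpha> p ws x) = lval p (unit j) x"
    unfolding lval_cact[OF ws root, symmetric] unfolding lval_def using eq by (intro sum.cong) auto
  then have t: "pairing (word \<alpha> p ws x) (\<alpha> i) + p i = pairing x (\<alpha> j) + p j"
    using ij n alpha_nz[of j] by (simp add: lval_unit)
  have "word \<alpha> p ws (srefl \<alpha> p j x) = word \<alpha> p ws x + word \<alpha> zoff ws (srefl \<alpha> p j x - x)"
    by (simp flip: word_diff[of \<alpha> p])
  also have "srefl \<alpha> p j x - x = (- (pairing x (\<alpha> j) + p j)) *\<^sub>R \<alpha> j"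
    by (simp only: srefl_def scaleR_minus_left) simp
  also have "word \<alpha> zoff ws \<dots> = (- (pairing x (\<alpha> j) + p j)) *\<^sub>R \<alpha> i"
    unfolding linear_cmul[OF linear_word] h ..
  also have "word \<alpha> p ws x + \<dots> = srefl \<alpha> p i (word \<alpha> p ws x)"
    by (simp only: srefl_def t scaleR_minus_left) simp
  finally show "(srefl \<alpha> p i \<circ> word \<alpha> p ws) x = (word \<alpha> p ws \<circ> srefl \<alpha> p j) x" by simp
qed

text \<open>Pull the \<open>i\<close>-th wall function back letter by letter. If letter
  \<open>j\<close> is the first to make it negative, then by \<open>crefl_simple\<close> it was the
  \<open>j\<close>-th wall function just before, so the reflection in \<open>i\<close> moves through
  the prefix, becomes the reflection in \<open>j\<close> and cancels that letter.\<close>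

lemma exchange:
  assumes "set ws \<subseteq> J" "J \<subseteq> {0..CARD('n)}" "i \<in> J"
  shows "(\<forall>l\<le>CARD('n). cact ws (unit i) l \<ge> 0) \<or>
    (\<exists>us. set us \<subseteq> J \<and> length us < length ws \<and> srefl \<alpha> p i \<circ> word \<alpha> p ws = word \<alpha> p us)"
  using assms(1)
proof (induction ws rule: rev_induct)
  case Nil
  then show ?case by (simp add: unit_def)
next
  case (snoc j ws)
  let ?c = "cact ws (unit i)"
  have ws': "set ws \<subseteq> J" using snoc by simp
  have i: "i \<le> CARD('n)" and ws: "set ws \<subseteq> {0..CARD('n)}" and j: "j \<le> CARD('n)" "j \<in> J" using snoc assms by auto
  have root: "cvec ?c \<in> \<Phi>" using ws i by (intro cact_root) (auto simp: cvec_unit alpha_root)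
  have snoc': "word \<alpha> p (us @ [j]) = word \<alpha> p us \<circ> srefl \<alpha> p j" for us by (simp add: word_append)
  consider "\<forall>l\<le>CARD('n). ?c l \<ge> 0" | us where "set us \<subseteq> J" "length us < length ws"
      "srefl \<alpha> p i \<circ> word \<alpha> p ws = word \<alpha> p us"
    using snoc.IH[OF ws'] by blast
  then show ?case
  proof cases
    case 1
    show ?thesis
    proof (cases "\<forall>l\<le>CARD('n). crefl j ?c l \<ge> 0")
      case False
      have "srefl \<alpha> p i \<circ> word \<alpha> p ws = word \<alpha> p ws \<circ> srefl \<alpha> p j"
        by (rule srefl_word_swap[OF ws i j(1) crefl_simple[OF root 1 j(1) False]])
      then have "srefl \<alpha> p i \<circ> word \<alpha> p (ws @ [j]) = word \<alpha> p ws \<circ> (srefl \<alpha> p j \<circ> srefl \<alpha> p j)"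
        unfolding snoc' by (simp only: comp_assoc[symmetric])
      also have "srefl \<alpha> p j \<circ> srefl \<alpha> p j = id" using j by (auto simp: srefl_invol alpha_nz)
      finally show ?thesis using snoc by (intro disjI2 exI[of _ ws]) auto
    qed (simp add: cact_snoc)
  next
    case 2
    have "srefl \<alpha> p i \<circ> word \<alpha> p (ws @ [j]) = word \<alpha> p (us @ [j])"
      unfolding snoc' comp_assoc[symmetric] 2(3) ..
    then show ?thesis using 2 j by (intro disjI2 exI[of _ "us @ [j]"]) auto
  qed
qed

definition open_chamber :: "(nat \<Rightarrow> real) \<Rightarrow> nat set \<Rightarrow> (real ^ 'n) set" where
  "open_chamber p J = {x. \<forall>i\<in>J. pairing x (\<alpha> i) + p i > 0}"

definition closed_chamber :: "(nat \<Rightarrow> real) \<Rightarrow> nat set \<Rightarrow> (real ^ 'n) set" where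
  "closed_chamber p J = {x. \<forall>i\<in>J. pairing x (\<alpha> i) + p i \<ge> 0}"

lemma lval_nonneg:
  assumes "x \<in> closed_chamber p J" "\<forall>l\<le>CARD('n). c l \<ge> 0" "\<And>l. l \<notin> J \<Longrightarrow> c l = 0"
  shows "lval p c x \<ge> 0"
  unfolding lval_def
proof (rule sum_nonneg)
  fix i assume i: "i \<in> {0..CARD('n)}"
  show "0 \<le> real_of_int (c i) * (\<alpha> i \<bullet> \<alpha> i / 2 * (pairing x (\<alpha> i) + p i))"
  proof (cases "i \<in> J")
    case True
    then show ?thesis using assms i by (intro mult_nonneg_nonneg) (auto simp: closed_chamber_def)
  qed (use assms in simp)
qed

lemma lval_pos:
  assumes "x \<in> open_chamber p J" "\<forall>l\<le>CARD('n). c l \<ge> 0" "\<And>l. l \<notin> J \<Longrightarrow> c l = 0" "cvec c \<in> \<Phi>"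
  shows "lval p c x > 0"
proof -
  have "\<exists>i\<le>CARD('n). c i \<noteq> 0"
  proof (rule ccontr)
    assume "\<not> ?thesis"
    then have "cvec c = 0" unfolding cvec_def by (intro sum.neutral) auto
    then show False using assms(4) zero_not_root by simp
  qed
  then obtain i where i: "i \<le> CARD('n)" "c i \<noteq> 0" by blast
  have term_nonneg: "0 \<le> real_of_int (c i) * (\<alpha> i \<bullet> \<alpha> i / 2 * (pairing x (\<alpha> i) + p i))" if "i \<le> CARD('n)" for i
  proof (cases "i \<in> J")
    case True
    then show ?thesis using assms that by (intro mult_nonneg_nonneg) (auto simp: open_chamber_def less_imp_le)
  qed (use assms in simp)
  have "i \<in> J" "c i > 0" using i assms(2,3) by (auto simp: order_less_le)
  then have "0 < real_of_int (c i) * (\<alpha> i \<bullet> \<alpha> i / 2 * (pairing x (\<alpha> i) + p i))"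
    using assms(1) alpha_sq_pos[OF i(1)] by (intro mult_pos_pos) (auto simp: open_chamber_def)
  then show ?thesis
    unfolding lval_def using i term_nonneg by (intro sum_pos2[of _ i]) auto
qed

text \<open>Split off the first letter \<open>i\<close>, leaving \<open>us\<close>. The
  \<open>i\<close>-th wall function is positive at the image of \<open>x\<close>, hence negative
  before the last reflection is applied. Its pullback along \<open>us\<close> is negative at
  \<open>x\<close> and cannot have nonnegative coefficients, so \<open>exchange\<close> shortens the
  word.\<close>

lemma word_open_chamber:
  assumes "set ws \<subseteq> J" "J \<subseteq> {0..CARD('n)}" "x \<in> open_chamber p J" "word \<alpha> p ws x \<in> open_chamber p J"
  shows "word \<alpha> p ws = id"
  using assms(1,4)
proof (induction "length ws" arbitrary: ws rule: less_induct)
  case less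
  show ?case
  proof (cases ws)
    case (Cons i us)
    have i: "i \<in> J" "i \<le> CARD('n)" and us: "set us \<subseteq> J" "set us \<subseteq> {0..CARD('n)}" using Cons less assms by auto
    have root: "cvec (unit i) \<in> \<Phi>" using i by (simp add: cvec_unit alpha_root)
    let ?c = "cact us (unit i)"
    have s: "word \<alpha> p us x = srefl \<alpha> p i (word \<alpha> p ws x)"
      using Cons i by (simp add: srefl_invol alpha_nz)
    have "pairing (word \<alpha> p us x) (\<alpha> i) + p i = - (pairing (word \<alpha> p ws x) (\<alpha> i) + p i)"
      unfolding s using i by (simp add: srefl_def pairing_simps pairing_self alpha_nz algebra_simps)
    moreover have "pairing (word \<alpha> p ws x) (\<alpha> i) + p i > 0" using less i by (simp add: open_chamber_def)
    ultimately have "lval p ?c x < 0"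
      using i alpha_sq_pos[OF i(2)] by (simp add: lval_cact[OF us(2) root] lval_unit mult_less_0_iff)
    then have "\<not> (\<forall>l\<le>CARD('n). ?c l \<ge> 0)"
      using lval_pos[OF assms(3), of ?c] cact_support[OF us(1), of "unit i"] cact_root[OF us(2) root] i
      by (force simp: unit_def)
    then obtain vs where vs: "set vs \<subseteq> J" "length vs < length us" "srefl \<alpha> p i \<circ> word \<alpha> p us = word \<alpha> p vs"
      using exchange[OF us(1) assms(2) i(1), of p] by blast
    then have eq: "word \<alpha> p ws = word \<alpha> p vs" using Cons by simp
    then show ?thesis using less(1)[of vs] vs less(3) Cons by simp
  qed simp
qed

lemma word_closed_chamber:
  assumes "set ws \<subseteq> J" "J \<subseteq> {0..CARD('n)}" "x \<in> closed_chamber p J" "word \<alpha> p ws x \<in> closed_chamber p J"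
  shows "word \<alpha> p ws x = x"
  using assms(1,4)
proof (induction "length ws" arbitrary: ws rule: less_induct)
  case less
  show ?case
  proof (cases ws)
    case (Cons i us)
    have i: "i \<in> J" "i \<le> CARD('n)" and us: "set us \<subseteq> J" "set us \<subseteq> {0..CARD('n)}" using Cons less assms by auto
    have root: "cvec (unit i) \<in> \<Phi>" using i by (simp add: cvec_unit alpha_root)
    let ?c = "cact us (unit i)"
    have s: "word \<alpha> p us x = srefl \<alpha> p i (word \<alpha> p ws x)"
      using Cons i by (simp add: srefl_invol alpha_nz)
    have neg: "pairing (word \<alpha> p us x) (\<alpha> i) + p i = - (pairing (word \<alpha> p ws x) (\<alpha> i) + p i)"
      unfolding s using i by (simp add: srefl_def pairing_simps pairing_self alpha_nz algebra_simps)
    have ge: "pairing (word \<alpha> p ws x) (\<alpha> i) + p i \<ge> 0" using less i by (simp add: closed_chamber_def)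
    show ?thesis
    proof (cases "\<forall>l\<le>CARD('n). ?c l \<ge> 0")
      case True
      have "lval p ?c x \<ge> 0"
        using lval_nonneg[OF assms(3) True] cact_support[OF us(1), of "unit i"] i by (force simp: unit_def)
      then have "pairing (word \<alpha> p us x) (\<alpha> i) + p i \<ge> 0"
        using i alpha_sq_pos[OF i(2)] by (simp add: lval_cact[OF us(2) root] lval_unit zero_le_mult_iff)
      then have "word \<alpha> p ws x = word \<alpha> p us x"
        using neg ge by (simp add: s srefl_def)
      then show ?thesis using less(1)[of us] us less(3) Cons by simp
    next
      case False
      then obtain vs where vs: "set vs \<subseteq> J" "length vs < length us" "srefl \<alpha> p i \<circ> word \<alpha> p us = word \<alpha> p vs"
        using exchange[OF us(1) assms(2) i(1), of p] by blast
      then have eq: "word \<alpha> p ws = word \<alpha> p vs" using Cons by simp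
      then show ?thesis using less(1)[of vs] vs less(3) Cons by simp
    qed
  qed simp
qed

section \<open>Weights, orbits and half sums\<close>

lemma weight_pairing: "x \<in> \<Lambda> \<Longrightarrow> i \<le> CARD('n) \<Longrightarrow> pairing x (\<alpha> i) \<in> \<int>"
  using alpha_root by (auto simp: weight_lattice_def)

lemma weight_zero: "0 \<in> \<Lambda>"
  by (simp add: weight_lattice_def pairing_zero)

lemma weight_add: "x \<in> \<Lambda> \<Longrightarrow> y \<in> \<Lambda> \<Longrightarrow> x + y \<in> \<Lambda>"
  by (auto simp: weight_lattice_def pairing_add)

lemma weight_add_int: "x \<in> \<Lambda> \<Longrightarrow> i \<le> CARD('n) \<Longrightarrow> m \<in> \<int> \<Longrightarrow> x + m *\<^sub>R \<alpha> i \<in> \<Lambda>"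
  using alpha_root pairing_roots by (auto simp: weight_lattice_def pairing_simps)

lemma weight_srefl:
  assumes "x \<in> \<Lambda>" "i \<le> CARD('n)" "p i \<in> \<int>"
  shows "srefl \<alpha> p i x \<in> \<Lambda>"
proof -
  have "x + (- (pairing x (\<alpha> i) + p i)) *\<^sub>R \<alpha> i \<in> \<Lambda>"
    using assms by (intro weight_add_int Ints_minus Ints_add weight_pairing) auto
  then show ?thesis by (simp only: srefl_def scaleR_minus_left diff_conv_add_uminus)
qed

lemma weight_word:
  "x \<in> \<Lambda> \<Longrightarrow> set ws \<subseteq> {0..CARD('n)} \<Longrightarrow> (\<And>i. p i \<in> \<int>) \<Longrightarrow> word \<alpha> p ws x \<in> \<Lambda>"
  by (induction ws) (auto simp: weight_srefl)

lemma pairing_determines: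
  assumes "\<And>i. i \<in> {1..CARD('n)} \<Longrightarrow> pairing x (\<alpha> i) = pairing y (\<alpha> i)"
  shows "x = y"
proof -
  have nc: "(x - y) \<bullet> b = 0" if "nat_comb \<alpha> {1..CARD('n)} b" for b
  proof -
    have "(x - y) \<bullet> \<alpha> i = 0" if "i \<in> {1..CARD('n)}" for i
    proof -
      have "pairing (x - y) (\<alpha> i) = 0" using assms that by (simp add: pairing_diff)
      then show ?thesis using alpha_nz that by (simp add: pairing_def)
    qed
    then show ?thesis using that by (auto simp: nat_comb_def inner_sum_right)
  qed
  have "(x - y) \<bullet> b = 0" if "b \<in> \<Phi>" for b
    using nat_comb_or[OF that] nc[of b] nc[of "- b"] by auto
  then have "\<Phi> \<subseteq> {b. (x - y) \<bullet> b = 0}" by auto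
  then have "span \<Phi> \<subseteq> {b. (x - y) \<bullet> b = 0}"
    by (rule span_minimal) (rule subspace_hyperplane)
  then have "x - y \<in> {b. (x - y) \<bullet> b = 0}" unfolding span_roots by (rule subsetD) simp
  then have "(x - y) \<bullet> (x - y) = 0" by (rule CollectD)
  then show ?thesis by simp
qed

text \<open>Guarantees a point of least norm in an orbit that may be infinite.\<close>

definition locally_finite :: "(real ^ 'n) set \<Rightarrow> bool" where
  "locally_finite X \<longleftrightarrow> (\<forall>B. finite {x \<in> X. norm x \<le> B})"

text \<open>A weight is determined by its integral pairings with the simple roots, and by
  Cauchy-Schwarz these are bounded on a ball.\<close>

lemma weights_locally_finite: "locally_finite \<Lambda>"
  unfolding locally_finite_def
proof
  fix B :: real
  let ?S = "{x \<in> \<Lambda>. norm x \<le> B}"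
  let ?f = "\<lambda>x. \<lambda>i\<in>{1..CARD('n)}. \<lfloor>pairing x (\<alpha> i)\<rfloor>"
  have fl: "real_of_int \<lfloor>pairing x (\<alpha> i)\<rfloor> = pairing x (\<alpha> i)" if "x \<in> ?S" "i \<in> {1..CARD('n)}" for x i
    using weight_pairing[of x i] that by (auto elim: Ints_cases)
  define M where "M = (\<lambda>i. \<lceil>2 * B / norm (\<alpha> i)\<rceil>)"
  have "inj_on ?f ?S"
  proof (rule inj_onI)
    fix x y assume xy: "x \<in> ?S" "y \<in> ?S" "?f x = ?f y"
    show "x = y"
    proof (rule pairing_determines)
      fix i assume i: "i \<in> {1..CARD('n)}"
      then have "\<lfloor>pairing x (\<alpha> i)\<rfloor> = \<lfloor>pairing y (\<alpha> i)\<rfloor>" using fun_cong[OF xy(3), of i] by simp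
      then show "pairing x (\<alpha> i) = pairing y (\<alpha> i)" using fl[OF xy(1) i] fl[OF xy(2) i] by metis
    qed
  qed
  moreover have "?f ` ?S \<subseteq> PiE {1..CARD('n)} (\<lambda>i. {- M i..M i})"
  proof (intro image_subsetI PiE_I)
    fix x i assume x: "x \<in> ?S" and i: "i \<in> {1..CARD('n)}"
    have n: "norm (\<alpha> i) > 0" using alpha_nz i by simp
    have "\<bar>x \<bullet> \<alpha> i\<bar> \<le> norm x * norm (\<alpha> i)" by (rule Cauchy_Schwarz_ineq2)
    also have "\<dots> \<le> B * norm (\<alpha> i)" using x n by (intro mult_right_mono) auto
    finally have le: "\<bar>x \<bullet> \<alpha> i\<bar> \<le> B * norm (\<alpha> i)" .
    have "\<bar>pairing x (\<alpha> i)\<bar> = 2 * \<bar>x \<bullet> \<alpha> i\<bar> / (norm (\<alpha> i) * norm (\<alpha> i))"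
      by (simp add: pairing_def dot_square_norm power2_eq_square abs_mult)
    also have "\<dots> \<le> 2 * (B * norm (\<alpha> i)) / (norm (\<alpha> i) * norm (\<alpha> i))"
      using le by (intro divide_right_mono) auto
    also have "\<dots> = 2 * B / norm (\<alpha> i)" using n by simp
    also have "\<dots> \<le> real_of_int (M i)" by (simp add: M_def)
    finally have "\<bar>real_of_int \<lfloor>pairing x (\<alpha> i)\<rfloor>\<bar> \<le> real_of_int (M i)" unfolding fl[OF x i] .
    then have "\<bar>\<lfloor>pairing x (\<alpha> i)\<rfloor>\<bar> \<le> M i" by (simp only: of_int_le_iff flip: of_int_abs)
    then show "?f x i \<in> {- M i..M i}" using i by (simp add: abs_le_iff)
  qed auto
  then have "finite (?f ` ?S)" by (rule finite_subset) (auto intro: finite_PiE)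
  ultimately show "finite ?S" using finite_imageD by blast
qed

lemma locally_finite_translate:
  assumes "locally_finite X" shows "locally_finite ((\<lambda>x. x + t) ` X)"
  unfolding locally_finite_def
proof
  fix B
  have "{x \<in> (\<lambda>x. x + t) ` X. norm x \<le> B} \<subseteq> (\<lambda>x. x + t) ` {x \<in> X. norm x \<le> B + norm t}"
  proof
    fix y assume y: "y \<in> {x \<in> (\<lambda>x. x + t) ` X. norm x \<le> B}"
    then obtain x where x: "x \<in> X" "y = x + t" by auto
    have "norm x \<le> norm (x + t) + norm t" using norm_triangle_ineq4[of "x + t" t] by simp
    then show "y \<in> (\<lambda>x. x + t) ` {x \<in> X. norm x \<le> B + norm t}" using x y by auto
  qed
  then show "finite {x \<in> (\<lambda>x. x + t) ` X. norm x \<le> B}"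
    using assms unfolding locally_finite_def by (meson finite_imageI finite_subset)
qed

text \<open>For \<open>p i > 0\<close>, reflecting a point on the negative side of the wall brings
  it closer to the origin.\<close>

lemma srefl_norm:
  assumes "i \<le> CARD('n)"
  shows "(norm (srefl \<alpha> p i x))\<^sup>2 = (norm x)\<^sup>2 + (\<alpha> i \<bullet> \<alpha> i) * (p i * (pairing x (\<alpha> i) + p i))"
proof -
  define l a where "l = pairing x (\<alpha> i)" and "a = \<alpha> i \<bullet> \<alpha> i"
  have "x \<bullet> \<alpha> i = l * a / 2" using alpha_nz[OF assms] by (simp add: l_def a_def pairing_def)
  then have *: "x \<bullet> \<alpha> i = l * a / 2" "\<alpha> i \<bullet> x = l * a / 2" by (simp_all add: inner_commute)
  show ?thesis
    unfolding srefl_def power2_norm_eq_inner l_def[symmetric] inner_diff_left inner_diff_right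
      inner_scaleR_left inner_scaleR_right * a_def[symmetric]
    by (simp add: algebra_simps)
qed

text \<open>Since \<open>0\<close> lies in the open chamber, an orbit point closest to \<open>0\<close> lies in the closed one.\<close>

lemma orbit_closed_chamber:
  assumes "J \<subseteq> {0..CARD('n)}" "\<And>i. i \<in> J \<Longrightarrow> p i > 0" "locally_finite X" "x \<in> X"
    "\<And>x i. x \<in> X \<Longrightarrow> i \<in> J \<Longrightarrow> srefl \<alpha> p i x \<in> X"
  obtains ws where "set ws \<subseteq> J" "word \<alpha> p ws x \<in> closed_chamber p J" "word \<alpha> p ws x \<in> X"
proof -
  \<comment> \<open>Only the part of the orbit inside the ball through \<open>x\<close> is known to
    be finite.\<close>
  define O1 where "O1 = {word \<alpha> p ws x | ws. set ws \<subseteq> J} \<inter> {y \<in> X. norm y \<le> norm x}"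
  have wX: "word \<alpha> p ws x \<in> X" if "set ws \<subseteq> J" for ws
    using that assms(4,5) by (induction ws) auto
  have "finite O1" using assms(3) by (auto simp: O1_def locally_finite_def)
  moreover have "x \<in> O1" unfolding O1_def using assms(4) by (auto intro!: exI[of _ "[]"])
  ultimately have "arg_min_on norm O1 \<in> O1" "\<And>z. z \<in> O1 \<Longrightarrow> norm (arg_min_on norm O1) \<le> norm z"
    using arg_min_if_finite[of O1 norm] by (auto simp: not_less)
  then obtain y where y: "y \<in> O1" "\<And>z. z \<in> O1 \<Longrightarrow> norm y \<le> norm z" by blast
  then obtain ws where ws: "y = word \<alpha> p ws x" "set ws \<subseteq> J" by (auto simp: O1_def)
  have "pairing y (\<alpha> i) + p i \<ge> 0" if i: "i \<in> J" for i
  proof (rule ccontr)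
    assume neg: "\<not> ?thesis"
    have iC: "i \<le> CARD('n)" using i assms(1) by auto
    have "(\<alpha> i \<bullet> \<alpha> i) * (p i * (pairing y (\<alpha> i) + p i)) < 0"
      using neg assms(2)[OF i] alpha_sq_pos[OF iC] by (simp add: mult_less_0_iff)
    then have "(norm (srefl \<alpha> p i y))\<^sup>2 < (norm y)\<^sup>2" unfolding srefl_norm[OF iC] by simp
    then have less: "norm (srefl \<alpha> p i y) < norm y" by (simp add: power2_less_imp_less)
    have sy: "srefl \<alpha> p i y = word \<alpha> p (i # ws) x" using ws by simp
    have "srefl \<alpha> p i y \<in> O1"
      unfolding O1_def using ws i less y(1) wX[of "i # ws"] sy
      by (auto simp: O1_def intro!: exI[of _ "i # ws"])
    then show False using y(2) less by fastforce
  qed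
  then have "y \<in> closed_chamber p J" by (simp add: closed_chamber_def)
  then show thesis using that ws wX by metis
qed

section \<open>Half sums and vertices\<close>

text \<open>Every linear relation among \<open>\<alpha> 0, ..., \<alpha> n\<close> is a multiple of
  the one expressing the highest root. All coefficients of that one are nonzero, so a relation that
  misses some index is trivial.\<close>

lemma proper_indep:
  assumes "(\<Sum>i\<in>{0..CARD('n)}. c i *\<^sub>R \<alpha> i) = 0" "l \<le> CARD('n)" "c l = 0" "i \<le> CARD('n)"
  shows "c i = (0::real)"
proof -
  obtain m :: "nat \<Rightarrow> nat" where m: "- \<alpha> 0 = (\<Sum>i\<in>{1..CARD('n)}. real (m i) *\<^sub>R \<alpha> i)"
    and m1: "\<And>i. i \<in> {1..CARD('n)} \<Longrightarrow> m i \<ge> 1" using marks by blast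
  have "\<alpha> 0 = - (\<Sum>i\<in>{1..CARD('n)}. real (m i) *\<^sub>R \<alpha> i)" by (metis m minus_minus)
  then have "(\<Sum>i\<in>{1..CARD('n)}. (c i - c 0 * real (m i)) *\<^sub>R \<alpha> i) = 0"
    using assms(1) unfolding sum_head
    by (simp add: scaleR_sum_right sum_subtractf scaleR_left_diff_distrib)
  from sum_indep[OF this] have cm: "c i = c 0 * real (m i)" if "i \<in> {1..CARD('n)}" for i
    using that by force
  have c0: "c 0 = 0"
  proof (cases "l = 0")
    case False
    then have "l \<in> {1..CARD('n)}" using assms by auto
    then show ?thesis using cm[of l] m1[of l] assms by auto
  qed (use assms in simp)
  then show ?thesis using cm[of i] assms(4) by (cases "i = 0") auto
qed

lemma nat_comb_cvec:
  assumes "J \<subseteq> {0..CARD('n)}"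
  shows "nat_comb \<alpha> J b \<longleftrightarrow> (\<exists>c. b = cvec c \<and> (\<forall>i\<le>CARD('n). c i \<ge> 0) \<and> (\<forall>i. i \<notin> J \<longrightarrow> c i = 0))"
proof
  assume "nat_comb \<alpha> J b"
  then obtain c :: "nat \<Rightarrow> nat" where c: "b = (\<Sum>i\<in>J. real (c i) *\<^sub>R \<alpha> i)" by (auto simp: nat_comb_def)
  have "b = cvec (\<lambda>i. if i \<in> J then int (c i) else 0)"
    unfolding cvec_def c using assms by (intro sum.mono_neutral_cong_left) auto
  then show "\<exists>c. b = cvec c \<and> (\<forall>i\<le>CARD('n). c i \<ge> 0) \<and> (\<forall>i. i \<notin> J \<longrightarrow> c i = 0)"
    by (intro exI[of _ "\<lambda>i. if i \<in> J then int (c i) else 0"]) auto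
next
  assume "\<exists>c. b = cvec c \<and> (\<forall>i\<le>CARD('n). c i \<ge> 0) \<and> (\<forall>i. i \<notin> J \<longrightarrow> c i = 0)"
  then obtain c where c: "b = cvec c" "\<forall>i\<le>CARD('n). c i \<ge> 0" "\<forall>i. i \<notin> J \<longrightarrow> c i = 0" by blast
  have "cvec c = (\<Sum>i\<in>J. real (nat (c i)) *\<^sub>R \<alpha> i)"
    unfolding cvec_def using assms c by (intro sum.mono_neutral_cong_right) auto
  then show "nat_comb \<alpha> J b" unfolding nat_comb_def c(1) by (intro exI[of _ "\<lambda>i. nat (c i)"])
qed

text \<open>The reflection in \<open>\<alpha> i\<close> permutes the positive roots of the subsystem
  other than \<open>\<alpha> i\<close>, so their sum pairs to 0 with \<open>\<alpha> i\<close>; half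
  of \<open>\<alpha> i\<close> itself contributes 1. The omitted index \<open>l\<close> keeps
  \<open>- \<alpha> i\<close> from being positive as well.\<close>

lemma pairing_half_sum:
  assumes J: "J \<subseteq> {0..CARD('n)}" and l: "l \<le> CARD('n)" "l \<notin> J" and i: "i \<in> J"
  shows "pairing (half_sum \<Phi> \<alpha> J) (\<alpha> i) = 1"
proof -
  have iC: "i \<le> CARD('n)" using i J by auto
  let ?P = "{b \<in> \<Phi>. nat_comb \<alpha> J b}"
  let ?s = "root_refl (\<alpha> i)"
  have inv: "?s (?s b) = b" for b using srefl_invol[of \<alpha> i zoff b] alpha_nz[OF iC] by (simp add: srefl_zoff)
  have s_mem: "?s b \<in> ?P - {\<alpha> i}" if b: "b \<in> ?P - {\<alpha> i}" for b
  proof -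
    obtain c where c: "b = cvec c" "\<forall>i\<le>CARD('n). c i \<ge> 0" "\<forall>i. i \<notin> J \<longrightarrow> c i = 0"
      using b unfolding nat_comb_cvec[OF J] by blast
    have root: "cvec c \<in> \<Phi>" using b c by auto
    have "\<forall>j\<le>CARD('n). crefl i c j \<ge> 0"
    proof (rule ccontr)
      assume "\<not> ?thesis"
      then have "\<forall>j\<le>CARD('n). c j = unit i j" by (rule crefl_simple[OF root c(2) iC])
      then have "cvec c = cvec (unit i)" unfolding cvec_def by (intro sum.cong) auto
      then show False using b c cvec_unit[OF iC] by auto
    qed
    moreover have "\<forall>j. j \<notin> J \<longrightarrow> crefl i c j = 0" using c(3) i by (auto simp: crefl_def)
    ultimately have nc: "nat_comb \<alpha> J (?s b)"
      unfolding nat_comb_cvec[OF J] using cvec_crefl[OF iC root] c(1) by metis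
    have "?s b \<noteq> \<alpha> i"
    proof
      assume "?s b = \<alpha> i"
      then have "b = ?s (\<alpha> i)" using inv by metis
      then have "b = - \<alpha> i" using alpha_nz[OF iC] by (simp add: root_refl_def pairing_self scaleR_2)
      then have "cvec (c(i := c i + 1)) = 0" using c(1) cvec_upd[OF iC, of c 1] by simp
      then have "real_of_int ((c(i := c i + 1)) i) = 0"
        unfolding cvec_def by (rule proper_indep[where l = l]) (use l i iC c(3) in auto)
      then show False using c(2) iC by auto
    qed
    then show ?thesis using nc b root_refl_root[OF alpha_root[OF iC]] by auto
  qed
  define S where "S = \<Sum>(?P - {\<alpha> i})"
  have "?s S = (\<Sum>b\<in>?P - {\<alpha> i}. ?s b)" unfolding S_def by (rule linear_sum[OF linear_root_refl])
  also have "\<dots> = S"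
    unfolding S_def by (rule sum.reindex_bij_witness[of _ ?s ?s]) (use s_mem inv in auto)
  finally have "pairing S (\<alpha> i) = 0" using alpha_nz[OF iC] by (simp add: root_refl_def)
  moreover have "\<alpha> i \<in> ?P"
  proof -
    have "\<alpha> i = cvec (unit i) \<and> (\<forall>j\<le>CARD('n). unit i j \<ge> 0) \<and> (\<forall>j. j \<notin> J \<longrightarrow> unit i j = 0)"
      using i iC cvec_unit[OF iC] by (auto simp: unit_def)
    then show ?thesis using alpha_root[OF iC] nat_comb_cvec[OF J] by blast
  qed
  then have "\<Sum>?P = \<alpha> i + S" unfolding S_def using finite_roots by (intro sum.remove) auto
  ultimately show ?thesis
    using alpha_nz[OF iC] by (simp add: half_sum_def pairing_simps pairing_self)
qed

text \<open>Such vectors are multiples of the functional dual to \<open>\<alpha> v\<close>. It takes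
  the nonzero value \<open>- m v\<close> at \<open>\<alpha> 0\<close>, so rescaling prescribes the
  pairing there.\<close>

lemma fundamental_coweight:
  assumes "v \<in> {1..CARD('n)}"
  obtains q where "\<And>i. i \<in> {1..CARD('n)} \<Longrightarrow> i \<noteq> v \<Longrightarrow> pairing q (\<alpha> i) = 0" "pairing q (\<alpha> 0) = t"
proof -
  obtain m :: "nat \<Rightarrow> nat" where m: "- \<alpha> 0 = (\<Sum>i\<in>{1..CARD('n)}. real (m i) *\<^sub>R \<alpha> i)"
    and m1: "\<And>i. i \<in> {1..CARD('n)} \<Longrightarrow> m i \<ge> 1" using marks by blast
  have ind: "independent (\<alpha> ` {1..CARD('n)})" and inj: "inj_on \<alpha> {1..CARD('n)}"
    using sr by (auto simp: simple_roots_def)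
  obtain g :: "real ^ 'n \<Rightarrow> real" where g: "linear g" "\<forall>x\<in>\<alpha> ` {1..CARD('n)}. g x = (if x = \<alpha> v then 1 else 0)"
    using linear_independent_extend[OF ind, of "\<lambda>x. if x = \<alpha> v then 1 else 0"] by blast
  define w where "w = adjoint g 1"
  have gw: "g x = w \<bullet> x" for x
    using adjoint_works[OF g(1), of x 1] by (simp add: w_def inner_commute)
  have gi: "g (\<alpha> i) = (if i = v then 1 else 0)" if "i \<in> {1..CARD('n)}" for i
  proof -
    have "g (\<alpha> i) = (if \<alpha> i = \<alpha> v then 1 else 0)" using g(2) that by (meson imageI)
    also have "\<alpha> i = \<alpha> v \<longleftrightarrow> i = v" by (rule inj_on_eq_iff[OF inj that assms])
    finally show ?thesis .
  qed
  have "g (- \<alpha> 0) = (\<Sum>i\<in>{1..CARD('n)}. real (m i) * g (\<alpha> i))"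
    unfolding m by (simp add: linear_sum[OF g(1)] linear_cmul[OF g(1)])
  also have "\<dots> = (\<Sum>i\<in>{1..CARD('n)}. if i = v then real (m i) else 0)"
    by (intro sum.cong) (auto simp: gi)
  also have "\<dots> = real (m v)" using assms by simp
  finally have g0: "g (\<alpha> 0) = - real (m v)" by (simp add: linear_neg[OF g(1)])
  have mv: "real (m v) > 0" using m1[OF assms] by simp
  define q where "q = (- t * (\<alpha> 0 \<bullet> \<alpha> 0) / (2 * real (m v))) *\<^sub>R w"
  show thesis
  proof (rule that[of q])
    show "pairing q (\<alpha> i) = 0" if "i \<in> {1..CARD('n)}" "i \<noteq> v" for i
      using gi[OF that(1)] that by (simp add: q_def pairing_def gw)
    show "pairing q (\<alpha> 0) = t"
      using g0 mv alpha_nz[of 0] by (simp add: q_def pairing_def gw)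
  qed
qed

section \<open>Finiteness and signs\<close>

lemma word_root: "set ws \<subseteq> {0..CARD('n)} \<Longrightarrow> b \<in> \<Phi> \<Longrightarrow> word \<alpha> zoff ws b \<in> \<Phi>"
  by (induction ws) (auto simp: srefl_zoff root_refl_root alpha_root)

text \<open>A linear map is determined by its restriction to the roots, which span, and these maps
  send the finite set of roots to itself.\<close>

lemma finite_wgroup_linear:
  assumes "J \<subseteq> {0..CARD('n)}" shows "finite (wgroup \<alpha> zoff J)"
proof (rule finite_imageD)
  have "(\<lambda>u. restrict u \<Phi>) ` wgroup \<alpha> zoff J \<subseteq> PiE \<Phi> (\<lambda>_. \<Phi>)"
    using word_root assms by (force simp: wgroup_def)
  then show "finite ((\<lambda>u. restrict u \<Phi>) ` wgroup \<alpha> zoff J)"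
    by (rule finite_subset) (simp add: finite_PiE finite_roots)
  show "inj_on (\<lambda>u. restrict u \<Phi>) (wgroup \<alpha> zoff J)"
  proof (rule inj_onI)
    fix u w assume uw: "u \<in> wgroup \<alpha> zoff J" "w \<in> wgroup \<alpha> zoff J" "restrict u \<Phi> = restrict w \<Phi>"
    then have lin: "linear u" "linear w" by (auto simp: wgroup_def linear_word)
    have eq: "u b = w b" if "b \<in> \<Phi>" for b using fun_cong[OF uw(3), of b] that by simp
    show "u = w"
      using linear_eq_on_span[OF lin, of \<Phi>] eq span_roots by auto
  qed
qed

lemma word_vertex:
  assumes "\<And>j. j \<in> set ws \<Longrightarrow> pairing q (\<alpha> j) = - p j"
  shows "word \<alpha> p ws (x + q) = word \<alpha> zoff ws x + q"
proof -
  have "word \<alpha> (\<lambda>j. p j + pairing q (\<alpha> j)) ws = word \<alpha> zoff ws" using assms by (intro word_cong) simp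
  then show ?thesis by (simp add: word_shift)
qed

text \<open>\<open>q\<close> lies on all the walls in question; with \<open>q\<close> as origin the
  affine group becomes linear.\<close>

lemma wgroup_vertex:
  assumes "\<And>j. j \<in> J \<Longrightarrow> pairing q (\<alpha> j) = - p j"
  shows "wgroup \<alpha> p J = (\<lambda>u x. u (x - q) + q) ` wgroup \<alpha> zoff J"
proof -
  have "word \<alpha> p ws = (\<lambda>x. word \<alpha> zoff ws (x - q) + q)" if "set ws \<subseteq> J" for ws
  proof
    fix x show "word \<alpha> p ws x = word \<alpha> zoff ws (x - q) + q"
      using word_vertex[of ws q p "x - q"] assms that by auto
  qed
  then show ?thesis unfolding wgroup_def setcompr_eq_image image_image
    by (intro image_cong) auto
qed

lemma lin_sign_comp:
  assumes "J \<subseteq> {0..CARD('n)}" "u \<in> wgroup \<alpha> p J" "w \<in> wgroup \<alpha> p J"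
  shows "lin_sign (u \<circ> w) = lin_sign u * lin_sign w"
proof -
  obtain us ws where *: "u = word \<alpha> p us" "set us \<subseteq> J" "w = word \<alpha> p ws" "set ws \<subseteq> J"
    using assms by (auto simp: wgroup_def)
  have nz: "\<alpha> i \<noteq> 0" if "i \<in> set (us @ ws)" for i using that * assms(1) by (intro alpha_nz) auto
  have "lin_sign u = (-1) ^ length us" "lin_sign w = (-1) ^ length ws" "lin_sign (u \<circ> w) = (-1) ^ length (us @ ws)"
    unfolding * word_append[symmetric] using nz by (intro lin_sign_word; auto)+
  then show ?thesis by (simp add: power_add)
qed

lemma lin_sign_srefl: "i \<le> CARD('n) \<Longrightarrow> lin_sign (srefl \<alpha> p i) = -1"
  using lin_sign_word[of "[i]" \<alpha> p] alpha_nz by simp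

lemma lin_sign_id: "lin_sign (id :: real ^ 'n \<Rightarrow> real ^ 'n) = 1"
  using lin_sign_word[of "[]" \<alpha> zoff] by simp

end

section \<open>Alternating sums\<close>

lemma frag_eq_minus: "x = - x \<Longrightarrow> x = (0 :: 'a \<Rightarrow>\<^sub>0 int)"
proof (rule poly_mapping_eqI)
  fix k assume "x = - x"
  then have "Poly_Mapping.lookup x k = - Poly_Mapping.lookup x k" by (metis lookup_uminus)
  then show "Poly_Mapping.lookup x k = Poly_Mapping.lookup 0 k" by simp
qed

lemma lookup_mult_single:
  fixes x :: "'a::ab_group_add \<Rightarrow>\<^sub>0 'b::semiring_0"
  shows "Poly_Mapping.lookup (x * Poly_Mapping.single a b) k = Poly_Mapping.lookup x (k - a) * b"
proof -
  have inner: "(\<Sum>q. Poly_Mapping.lookup (Poly_Mapping.single a b) q when k = l + q) = (b when l = k - a)" for l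
  proof -
    have f: "(\<lambda>q. Poly_Mapping.lookup (Poly_Mapping.single a b) q when k = l + q)
        = (\<lambda>q. (b when k = l + q) when q = a)"
      by (auto simp: fun_eq_iff lookup_single when_def)
    have "k = l + a \<longleftrightarrow> l = k - a" by (auto simp: algebra_simps)
    then show ?thesis unfolding f Sum_any_when_equal by simp
  qed
  have g: "(\<lambda>l. Poly_Mapping.lookup x l * (b when l = k - a)) = (\<lambda>l. (Poly_Mapping.lookup x l * b) when l = k - a)"
    by (auto simp: fun_eq_iff when_def)
  show ?thesis unfolding lookup_mult inner g Sum_any_when_equal ..
qed

lemma frag_cmul_eq_single_mult: "frag_cmul k x = x * Poly_Mapping.single 0 k"
  for x :: "'a::ab_group_add \<Rightarrow>\<^sub>0 int"
  by (rule poly_mapping_eqI) (simp add: lookup_mult_single)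

lemma frag_cmul_mult: "frag_cmul k x * z = frag_cmul k (x * z)"
  for x :: "'a::ab_group_add \<Rightarrow>\<^sub>0 int"
  by (simp add: frag_cmul_eq_single_mult mult_ac)

lemma frag_extend_mult: "frag_extend h c * z = frag_extend (\<lambda>i. h i * z) c"
  for z :: "'a::ab_group_add \<Rightarrow>\<^sub>0 int"
  by (simp add: frag_extend_def sum_distrib_right frag_cmul_mult)

lemma lookup_frag_extend:
  "Poly_Mapping.lookup (frag_extend h c) k
     = (\<Sum>i\<in>Poly_Mapping.keys c. Poly_Mapping.lookup c i * Poly_Mapping.lookup (h i) k)"
  by (simp add: frag_extend_def lookup_sum)

lemma frag_extend_compose: "frag_extend f (frag_extend g c) = frag_extend (\<lambda>i. frag_extend f (g i)) c"
  unfolding frag_extend_def[of g] frag_extend_def[of "\<lambda>i. frag_extend f (g i)"]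
  by (simp add: frag_extend_sum o_def frag_extend_cmul)

lemma frag_extend_diff_fun: "frag_extend (\<lambda>i. f i - g i) c = frag_extend f c - frag_extend g c"
  by (rule poly_mapping_eqI) (simp add: lookup_frag_extend lookup_minus sum_subtractf right_diff_distrib)

text \<open>The description in \<open>exact_quotient\<close> is resolved by exhibiting one quotient
  and cancelling the denominator.\<close>

lemma exact_quotient_eq:
  assumes "\<And>y. y * b = 0 \<Longrightarrow> y = 0" "x * b = a"
  shows "exact_quotient a b = x"
  unfolding exact_quotient_def
proof (rule the_equality)
  fix y assume "y * b = a"
  then have "(y - x) * b = 0" using assms(2) by (simp add: left_diff_distrib)
  then show "y = x" using assms(1) by fastforce
qed (fact assms(2))

context root_data
begin

lemma alt_sum_srefl:
  assumes J: "J \<subseteq> {0..CARD('n)}" and i: "i \<in> J"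
  shows "alt_sum (wgroup \<alpha> p J) (srefl \<alpha> p i x) = - alt_sum (wgroup \<alpha> p J) x"
proof -
  let ?s = "srefl \<alpha> p i"
  have iC: "i \<le> CARD('n)" using i J by auto
  have ss: "u \<circ> ?s \<circ> ?s = u" for u :: "real ^ 'n \<Rightarrow> real ^ 'n"
    using alpha_nz[OF iC] by (auto simp: fun_eq_iff srefl_invol)
  have mem: "u \<circ> ?s \<in> wgroup \<alpha> p J" if "u \<in> wgroup \<alpha> p J" for u
    using comp_in_wgroup[OF that srefl_in_wgroup[OF i]] .
  have sg: "lin_sign (u \<circ> ?s) = - lin_sign u" if "u \<in> wgroup \<alpha> p J" for u
    using lin_sign_comp[OF J that srefl_in_wgroup[OF i]] lin_sign_srefl[OF iC] by simp
  have "alt_sum (wgroup \<alpha> p J) (?s x)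
      = (\<Sum>u\<in>wgroup \<alpha> p J. Poly_Mapping.single (u x) (lin_sign (u \<circ> ?s)))"
    unfolding alt_sum_def
    by (rule sum.reindex_bij_witness[of _ "\<lambda>u. u \<circ> ?s" "\<lambda>u. u \<circ> ?s"]) (simp_all only: ss mem, simp)
  also have "\<dots> = (\<Sum>u\<in>wgroup \<alpha> p J. - Poly_Mapping.single (u x) (lin_sign u))"
    by (rule sum.cong) (simp_all only: sg single_uminus)
  finally show ?thesis by (simp add: alt_sum_def sum_negf)
qed

lemma alt_sum_fixed:
  assumes "J \<subseteq> {0..CARD('n)}" "i \<in> J" "srefl \<alpha> p i x = x"
  shows "alt_sum (wgroup \<alpha> p J) x = 0"
  using alt_sum_srefl[OF assms(1,2), of p x] assms(3) by (intro frag_eq_minus) simp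

text \<open>Only the identity maps a point of the open chamber into the open chamber. Hence
  coefficients at chamber points separate the numerators of chamber points, like a dual
  basis.\<close>

lemma lookup_alt_sum_chamber:
  assumes "J \<subseteq> {0..CARD('n)}" "finite (wgroup \<alpha> p J)" "x \<in> open_chamber p J" "y \<in> open_chamber p J"
  shows "Poly_Mapping.lookup (alt_sum (wgroup \<alpha> p J) x) y = (if x = y then 1 else 0)"
proof -
  have "u = id" if "u \<in> wgroup \<alpha> p J" "u x = y" for u
    using word_open_chamber[of _ J x p] that assms(1,3,4) by (auto simp: wgroup_def)
  then have "Poly_Mapping.lookup (alt_sum (wgroup \<alpha> p J) x) y
      = (\<Sum>u\<in>wgroup \<alpha> p J. if u = id then (if x = y then 1 else 0) else 0)"
    unfolding alt_sum_def lookup_sum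
    using lin_sign_id by (intro sum.cong[OF refl]) (metis id_apply lookup_single_eq lookup_single_not_eq)
  then show ?thesis using assms(2) id_in_wgroup[of \<alpha> p J] by simp
qed

text \<open>Reduces divisibility for the affine group to the linear case.\<close>

lemma alt_sum_vertex:
  assumes J: "J \<subseteq> {0..CARD('n)}" and q: "\<And>j. j \<in> J \<Longrightarrow> pairing q (\<alpha> j) = - p j"
  shows "alt_sum (wgroup \<alpha> p J) (x + q) = alt_sum (wgroup \<alpha> zoff J) x * Poly_Mapping.single q 1"
proof -
  let ?c = "\<lambda>u x. u (x - q) + q"
  have eq: "wgroup \<alpha> p J = ?c ` wgroup \<alpha> zoff J" by (rule wgroup_vertex) (rule q)
  have inj: "inj_on ?c (wgroup \<alpha> zoff J)"
  proof (rule inj_onI)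
    fix u w assume "?c u = ?c w"
    then have "u ((x + q) - q) = w ((x + q) - q)" for x using fun_cong[of "?c u" "?c w" "x + q"] by simp
    then show "u = w" by auto
  qed
  have sg: "lin_sign (?c u) = lin_sign u" if "u \<in> wgroup \<alpha> zoff J" for u
  proof -
    have "linear u" using that by (auto simp: wgroup_def linear_word)
    then have "(\<lambda>x. ?c u x - ?c u 0) = (\<lambda>x. u x - u 0)"
      by (auto simp: linear_diff linear_0 linear_neg)
    then show ?thesis unfolding lin_sign_def by simp
  qed
  have "alt_sum (wgroup \<alpha> p J) (x + q) = (\<Sum>u\<in>wgroup \<alpha> zoff J. Poly_Mapping.single (u x + q) (lin_sign (?c u)))"
    unfolding alt_sum_def eq by (subst sum.reindex[OF inj]) simp
  also have "\<dots> = (\<Sum>u\<in>wgroup \<alpha> zoff J. Poly_Mapping.single (u x) (lin_sign u) * Poly_Mapping.single q 1)"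
    by (intro sum.cong) (simp_all only: sg mult_single, simp)
  finally show ?thesis by (simp add: alt_sum_def sum_distrib_right)
qed

lemma finite_wgroup_vertex:
  assumes J: "J \<subseteq> {0..CARD('n)}" and q: "\<And>j. j \<in> J \<Longrightarrow> pairing q (\<alpha> j) = - p j"
  shows "finite (wgroup \<alpha> p J)"
proof -
  have "wgroup \<alpha> p J = (\<lambda>u x. u (x - q) + q) ` wgroup \<alpha> zoff J" by (rule wgroup_vertex) (rule q)
  then show ?thesis using finite_wgroup_linear[OF J] by simp
qed

section \<open>Characters as exact quotients\<close>

text \<open>Leading term argument: for a key \<open>y\<close> of \<open>x\<close> with the largest
  inner product with \<open>r\<close>, the coefficient of the product at \<open>y + r\<close>
  receives a contribution from the identity alone.\<close>

lemma alt_rho_cancel: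
  assumes J: "J \<subseteq> {0..CARD('n)}" and r: "\<And>i. i \<in> J \<Longrightarrow> pairing r (\<alpha> i) = 1"
    and z: "x * alt_sum (wgroup \<alpha> zoff J) r = 0"
  shows "x = 0"
proof (rule ccontr)
  assume "x \<noteq> 0"
  let ?U = "wgroup \<alpha> zoff J"
  have ne: "Poly_Mapping.keys x \<noteq> {}" using \<open>x \<noteq> 0\<close> by simp
  define y where "y = arg_min_on (\<lambda>y. - (y \<bullet> r)) (Poly_Mapping.keys x)"
  have y: "y \<in> Poly_Mapping.keys x" "\<And>z. z \<in> Poly_Mapping.keys x \<Longrightarrow> z \<bullet> r \<le> y \<bullet> r"
    using arg_min_if_finite[OF finite_keys ne, of "\<lambda>y. - (y \<bullet> r)"] by (auto simp: y_def not_less)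
  have rC: "r \<in> open_chamber zoff J" using r by (simp add: open_chamber_def)
  have other: "Poly_Mapping.lookup x (y + r - u r) = 0" if u: "u \<in> ?U" "u \<noteq> id" for u
  proof -
    obtain us where us: "u = word \<alpha> zoff us" "set us \<subseteq> J" using u by (auto simp: wgroup_def)
    \<comment> \<open>\<open>u r\<close> and \<open>r\<close> are distinct of equal length, so the
      inner product of \<open>u r\<close> with \<open>r\<close> is strictly below that of
      \<open>r\<close> with itself.\<close>
    have "u r \<noteq> r" using word_open_chamber[OF us(2) J rC] us(1) rC u(2) by auto
    then have "(r - u r) \<bullet> (r - u r) > 0" by simp
    moreover have "u r \<bullet> u r = r \<bullet> r"
      unfolding us(1) using us(2) J alpha_nz by (intro word_inner) auto
    ultimately have "y \<bullet> r < (y + r - u r) \<bullet> r"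
      by (simp add: inner_diff_left inner_diff_right inner_add_left inner_add_right inner_commute)
    then have "y + r - u r \<notin> Poly_Mapping.keys x" using y(2) by (meson not_less)
    then show ?thesis by (simp add: in_keys_iff)
  qed
  have "Poly_Mapping.lookup (x * alt_sum ?U r) (y + r)
      = (\<Sum>u\<in>?U. Poly_Mapping.lookup x (y + r - u r) * lin_sign u)"
    unfolding alt_sum_def sum_distrib_left lookup_sum lookup_mult_single ..
  also have "\<dots> = (\<Sum>u\<in>?U. if u = id then Poly_Mapping.lookup x y else 0)"
    by (intro sum.cong) (auto simp: other lin_sign_id)
  also have "\<dots> = Poly_Mapping.lookup x y"
    using finite_wgroup_linear[OF J] id_in_wgroup[of \<alpha> zoff J] by simp
  finally show False using z y(1) by (simp add: in_keys_iff)
qed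

text \<open>An orbit point with maximal inner product with \<open>r\<close> cannot be improved by a
  simple reflection, so it lies in the closed chamber, and the orbit meets that chamber only in
  \<open>l\<close>.\<close>

lemma orbit_dominant_max:
  assumes J: "J \<subseteq> {0..CARD('n)}" and r: "\<And>i. i \<in> J \<Longrightarrow> pairing r (\<alpha> i) = 1"
    and l: "l \<in> closed_chamber zoff J" and u: "u \<in> wgroup \<alpha> zoff J" "u l \<noteq> l"
  shows "u l \<bullet> r < l \<bullet> r"
proof -
  let ?O = "(\<lambda>u. u l) ` wgroup \<alpha> zoff J"
  have max: "m = l" if m: "m \<in> ?O" "\<And>z. z \<in> ?O \<Longrightarrow> z \<bullet> r \<le> m \<bullet> r" for m
  proof -
    obtain ws where ws: "m = word \<alpha> zoff ws l" "set ws \<subseteq> J" using m(1) by (auto simp: wgroup_def)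
    have "m \<in> closed_chamber zoff J"
      unfolding closed_chamber_def
    proof (intro CollectI ballI)
      fix i assume i: "i \<in> J"
      then have iC: "i \<le> CARD('n)" using J by auto
      have "srefl \<alpha> zoff i m \<in> ?O"
        unfolding wgroup_def using ws i by (auto intro!: image_eqI[of _ _ "word \<alpha> zoff (i # ws)"] exI[of _ "i # ws"])
      then have "srefl \<alpha> zoff i m \<bullet> r \<le> m \<bullet> r" by (rule m(2))
      moreover have "srefl \<alpha> zoff i m \<bullet> r = m \<bullet> r - pairing m (\<alpha> i) * (r \<bullet> \<alpha> i)"
        by (simp add: srefl_def inner_diff_left inner_commute[of "\<alpha> i" r])
      moreover have "r \<bullet> \<alpha> i = (\<alpha> i \<bullet> \<alpha> i) / 2" using r[OF i] alpha_nz[OF iC] by (simp add: pairing_def field_simps)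
      ultimately show "0 \<le> pairing m (\<alpha> i) + zoff i"
        using alpha_sq_pos[OF iC] by (simp add: zero_le_mult_iff)
    qed
    then show ?thesis using word_closed_chamber[OF ws(2) J l] ws(1) by simp
  qed
  have ne: "?O \<noteq> {}" using u by auto
  have fin: "finite ?O" using finite_wgroup_linear[OF J] by simp
  have "arg_min_on (\<lambda>y. - (y \<bullet> r)) ?O = l"
    using arg_min_if_finite[OF fin ne, of "\<lambda>y. - (y \<bullet> r)"] by (intro max) (auto simp: not_less)
  then have le: "z \<bullet> r \<le> l \<bullet> r" if "z \<in> ?O" for z
    using arg_min_if_finite[OF fin ne, of "\<lambda>y. - (y \<bullet> r)"] that by (auto simp: not_less)
  have ul: "u l \<in> ?O" using u by auto
  have "u l \<bullet> r \<noteq> l \<bullet> r" using max[OF ul] le u(2) by fastforce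
  then show ?thesis using le[OF ul] by simp
qed

text \<open>Divisibility by the denominator, recording the invariance and the support of the
  quotient. The support \<open>X\<close> is a parameter because for W^v it is a translate of the
  weight lattice.\<close>

definition quot_by :: "nat set \<Rightarrow> real ^ 'n \<Rightarrow> (real ^ 'n) set \<Rightarrow> (real ^ 'n \<Rightarrow>\<^sub>0 int) \<Rightarrow> bool" where
  "quot_by J r X F \<longleftrightarrow> (\<exists>y. Poly_Mapping.keys y \<subseteq> X \<and>
     (\<forall>u\<in>wgroup \<alpha> zoff J. \<forall>z. Poly_Mapping.lookup y (u z) = Poly_Mapping.lookup y z) \<and>
     y * alt_sum (wgroup \<alpha> zoff J) r = F)"

lemma quot_by_zero: "quot_by J r X 0"
  unfolding quot_by_def by (intro exI[of _ 0]) simp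

lemma quot_by_diff:
  assumes "quot_by J r X F" "quot_by J r X G" shows "quot_by J r X (F - G)"
proof -
  obtain y z where "Poly_Mapping.keys y \<subseteq> X" "Poly_Mapping.keys z \<subseteq> X"
      "\<forall>u\<in>wgroup \<alpha> zoff J. \<forall>x. Poly_Mapping.lookup y (u x) = Poly_Mapping.lookup y x"
      "\<forall>u\<in>wgroup \<alpha> zoff J. \<forall>x. Poly_Mapping.lookup z (u x) = Poly_Mapping.lookup z x"
      "y * alt_sum (wgroup \<alpha> zoff J) r = F" "z * alt_sum (wgroup \<alpha> zoff J) r = G"
    using assms by (auto simp: quot_by_def)
  then show ?thesis unfolding quot_by_def
    using keys_diff[of y z]
    by (intro exI[of _ "y - z"]) (auto simp: left_diff_distrib lookup_minus)
qed

lemma quot_by_uminus: "quot_by J r X F \<Longrightarrow> quot_by J r X (- F)"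
  using quot_by_diff[OF quot_by_zero] by fastforce

lemma quot_by_add: "quot_by J r X F \<Longrightarrow> quot_by J r X G \<Longrightarrow> quot_by J r X (F + G)"
  using quot_by_diff[OF _ quot_by_uminus] by fastforce

lemma quot_by_sum: "finite S \<Longrightarrow> (\<And>s. s \<in> S \<Longrightarrow> quot_by J r X (f s)) \<Longrightarrow> quot_by J r X (\<Sum>s\<in>S. f s)"
  by (induction S rule: finite_induct) (auto simp: quot_by_zero quot_by_add)

lemma word_rho_shift:
  assumes "set ws \<subseteq> J" "\<And>i. i \<in> J \<Longrightarrow> p' i = p i + pairing r (\<alpha> i)"
  shows "word \<alpha> p ws (x + r) = word \<alpha> p' ws x + r"
proof -
  have "word \<alpha> (\<lambda>j. p j + pairing r (\<alpha> j)) ws = word \<alpha> p' ws" using assms by (intro word_cong) auto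
  then show ?thesis by (simp add: word_shift)
qed

lemma alt_sum_word:
  assumes "J \<subseteq> {0..CARD('n)}" "set ws \<subseteq> J"
  shows "alt_sum (wgroup \<alpha> p J) (word \<alpha> p ws x) = frag_cmul ((-1) ^ length ws) (alt_sum (wgroup \<alpha> p J) x)"
  using assms(2) by (induction ws) (auto simp: alt_sum_srefl[OF assms(1)])

text \<open>The product of an orbit sum with the denominator is the sum of \<open>A (\<kappa> + r)\<close> over the orbit, whose
  longest argument is \<open>l + r\<close> for the dominant orbit point \<open>l\<close>. Induction on the length of the
  argument therefore makes every \<open>A (\<kappa> + r)\<close> a multiple of the denominator.\<close>

lemma orbit_sum_mult:
  fixes l :: "real ^ 'n"
  assumes J: "J \<subseteq> {0..CARD('n)}"
  defines "U \<equiv> wgroup \<alpha> zoff J" and "Q \<equiv> (\<lambda>u. u l) ` wgroup \<alpha> zoff J"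
  shows "(\<Sum>x\<in>Q. frag_of x) * alt_sum U r = (\<Sum>x\<in>Q. alt_sum U (x + r))"
proof -
  have lin: "linear u" if "u \<in> U" for u using that by (auto simp: U_def wgroup_def linear_word)
  have bij: "bij_betw u Q Q" if u: "u \<in> U" for u
  proof -
    have nz: "\<And>i. i \<in> J \<Longrightarrow> \<alpha> i \<noteq> 0" using alpha_nz J by auto
    obtain w where w: "w \<in> U" "u \<circ> w = id" "w \<circ> u = id"
      unfolding U_def
      by (rule wgroup_inverse[where \<alpha> = \<alpha> and J = J and u = u and p = zoff]) (use nz u in \<open>auto simp: U_def\<close>)
    have cl: "a x \<in> Q" if a: "a \<in> U" and x: "x \<in> Q" for a x
    proof -
      obtain b where b: "b \<in> U" "x = b l" using x by (auto simp: Q_def U_def)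
      have "a \<circ> b \<in> U" using a b unfolding U_def by (intro comp_in_wgroup)
      then have "(a \<circ> b) l \<in> Q" unfolding Q_def U_def by (rule imageI)
      then show ?thesis using b by simp
    qed
    have wu: "w (u x) = x" "u (w x) = x" for x using fun_cong[OF w(2), of x] fun_cong[OF w(3), of x] by auto
    show ?thesis
      by (rule bij_betwI[of u Q Q w]) (use cl[OF u] cl[OF w(1)] wu in auto)
  qed
  have "(\<Sum>x\<in>Q. frag_of x) * alt_sum U r
      = (\<Sum>x\<in>Q. \<Sum>u\<in>U. Poly_Mapping.single (x + u r) (lin_sign u))"
    unfolding alt_sum_def sum_product by (simp add: mult_single)
  also have "\<dots> = (\<Sum>u\<in>U. \<Sum>x\<in>Q. Poly_Mapping.single (x + u r) (lin_sign u))"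
    by (rule sum.swap)
  also have "\<dots> = (\<Sum>u\<in>U. \<Sum>x\<in>Q. Poly_Mapping.single (u (x + r)) (lin_sign u))"
  proof (rule sum.cong[OF refl])
    fix u assume u: "u \<in> U"
    show "(\<Sum>x\<in>Q. Poly_Mapping.single (x + u r) (lin_sign u)) = (\<Sum>x\<in>Q. Poly_Mapping.single (u (x + r)) (lin_sign u))"
      unfolding linear_add[OF lin[OF u]]
      by (rule sum.reindex_bij_betw[OF bij[OF u], of "\<lambda>x. Poly_Mapping.single (x + u r) (lin_sign u)", symmetric])
  qed
  also have "\<dots> = (\<Sum>x\<in>Q. alt_sum U (x + r))"
    unfolding alt_sum_def by (rule sum.swap)
  finally show ?thesis .
qed

lemma quot_by_alt_sum:
  assumes J: "J \<subseteq> {0..CARD('n)}" and r: "\<And>i. i \<in> J \<Longrightarrow> pairing r (\<alpha> i) = 1"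
    and X: "locally_finite X" "\<And>x i. x \<in> X \<Longrightarrow> i \<in> J \<Longrightarrow> pairing x (\<alpha> i) \<in> \<int>"
      "\<And>x i m. x \<in> X \<Longrightarrow> i \<in> J \<Longrightarrow> m \<in> \<int> \<Longrightarrow> x + m *\<^sub>R \<alpha> i \<in> X"
    and x: "x \<in> X"
  shows "quot_by J r X (alt_sum (wgroup \<alpha> zoff J) (x + r))"
  using x
\<comment> \<open>Norms are real, so the induction counts the points of \<open>X\<close> whose
  shifted norm is smaller; local finiteness makes this number finite.\<close>
proof (induction "card {y \<in> X. norm (y + r) < norm (x + r)}" arbitrary: x rule: less_induct)
  case less
  let ?U = "wgroup \<alpha> zoff J"
  let ?A = "alt_sum ?U"
  \<comment> \<open>The offset 1 is the pairing with \<open>r\<close>: the shifted action has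
    positive offsets, as \<open>orbit_closed_chamber\<close> requires.\<close>
  let ?one = "\<lambda>_::nat. 1 :: real"
  have fin: "finite {y \<in> X. norm (y + r) < B}" for B
  proof (rule finite_subset)
    show "{y \<in> X. norm (y + r) < B} \<subseteq> {y \<in> X. norm y \<le> B + norm r}"
    proof
      fix y assume "y \<in> {y \<in> X. norm (y + r) < B}"
      moreover have "norm y \<le> norm (y + r) + norm r" using norm_triangle_ineq4[of "y + r" r] by simp
      ultimately show "y \<in> {y \<in> X. norm y \<le> B + norm r}" by auto
    qed
    show "finite {y \<in> X. norm y \<le> B + norm r}" using X(1) by (simp add: locally_finite_def)
  qed
  have sX: "srefl \<alpha> p i y \<in> X" if "y \<in> X" "i \<in> J" "p i \<in> \<int>" for y i and p :: "nat \<Rightarrow> real"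
  proof -
    have "y + (- (pairing y (\<alpha> i) + p i)) *\<^sub>R \<alpha> i \<in> X"
      using that by (intro X(3) Ints_minus Ints_add X(2)) auto
    then show ?thesis by (simp only: srefl_def scaleR_minus_left diff_conv_add_uminus)
  qed
  have wX: "word \<alpha> zoff ws y \<in> X" if "set ws \<subseteq> J" "y \<in> X" for ws y
    using that by (induction ws) (auto simp: sX)
  obtain ws where ws: "set ws \<subseteq> J" "word \<alpha> ?one ws x \<in> closed_chamber ?one J" "word \<alpha> ?one ws x \<in> X"
    using orbit_closed_chamber[OF J, of ?one X x] X(1) less.prems sX by auto
  define l where "l = word \<alpha> ?one ws x"
  have lr: "l + r = word \<alpha> zoff ws (x + r)"
    unfolding l_def using word_rho_shift[OF ws(1), of ?one zoff r x] r by simp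
  have A_l: "?A (l + r) = frag_cmul ((-1) ^ length ws) (?A (x + r))"
    unfolding lr by (rule alt_sum_word[OF J ws(1)])
  have nrm: "norm (l + r) = norm (x + r)"
    unfolding lr using ws(1) J alpha_nz by (intro word_norm) auto
  have l1: "pairing l (\<alpha> i) + 1 \<ge> 0" if "i \<in> J" for i
    using ws(2) that by (auto simp: l_def closed_chamber_def)
  have "quot_by J r X (?A (l + r))"
  \<comment> \<open>On a shifted wall the numerator vanishes; off all of them the pairings are
    integers above -1, so \<open>l\<close> is dominant.\<close>
  proof (cases "\<exists>i\<in>J. pairing l (\<alpha> i) + 1 = 0")
    case True
    then obtain i where i: "i \<in> J" "pairing l (\<alpha> i) + 1 = 0" by blast
    then have "srefl \<alpha> zoff i (l + r) = l + r" using r by (simp add: srefl_def pairing_add)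
    then have "?A (l + r) = 0" using alt_sum_fixed[OF J i(1)] by metis
    then show ?thesis by (simp add: quot_by_zero)
  next
    case False
    have dom: "l \<in> closed_chamber zoff J"
      unfolding closed_chamber_def
    proof (intro CollectI ballI)
      fix i assume i: "i \<in> J"
      obtain m where m: "pairing l (\<alpha> i) = of_int m" using X(2)[of l i] ws(3) i by (auto simp: l_def elim: Ints_cases)
      have "pairing l (\<alpha> i) + 1 > 0" using l1[OF i] False i by force
      then have "real_of_int (m + 1) > 0" using m by simp
      then have "m + 1 > 0" by (simp only: of_int_0_less_iff)
      then show "0 \<le> pairing l (\<alpha> i) + zoff i" using m by simp
    qed
    let ?Q = "(\<lambda>u. u l) ` ?U"
    have finQ: "finite ?Q" using finite_wgroup_linear[OF J] by simp
    have lQ: "l \<in> ?Q" using image_eqI[of l "\<lambda>u. u l" id ?U] id_in_wgroup by auto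
    have QX: "z \<in> X" if "z \<in> ?Q" for z using that wX ws(3) by (auto simp: wgroup_def l_def)
    have smaller: "quot_by J r X (?A (z + r))" if z: "z \<in> ?Q - {l}" for z
    proof (rule less.hyps)
      obtain u where u: "u \<in> ?U" "z = u l" using z by auto
      have "z \<bullet> r < l \<bullet> r" using orbit_dominant_max[OF J r dom u(1)] u(2) z by auto
      moreover have "z \<bullet> z = l \<bullet> l"
        using u J alpha_nz by (auto simp: wgroup_def intro!: word_inner)
      \<comment> \<open>\<open>z\<close> has the length of \<open>l\<close> and a smaller inner
        product with \<open>r\<close>, which makes \<open>z + r\<close> strictly shorter.\<close>
      ultimately have "(z + r) \<bullet> (z + r) < (l + r) \<bullet> (l + r)"
        by (simp add: inner_add_left inner_add_right inner_commute)
      then have lt: "norm (z + r) < norm (x + r)" unfolding nrm[symmetric] by (simp add: norm_lt)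
      show "z \<in> X" using QX z by auto
      then have "{y \<in> X. norm (y + r) < norm (z + r)} \<subset> {y \<in> X. norm (y + r) < norm (x + r)}"
        using lt by force
      then show "card {y \<in> X. norm (y + r) < norm (z + r)} < card {y \<in> X. norm (y + r) < norm (x + r)}"
        by (rule psubset_card_mono[OF fin])
    qed
    have S: "quot_by J r X ((\<Sum>z\<in>?Q. frag_of z) * ?A r)"
      unfolding quot_by_def
    proof (intro exI[of _ "\<Sum>z\<in>?Q. frag_of z"] conjI ballI allI refl)
      have lk: "Poly_Mapping.lookup (\<Sum>z\<in>?Q. frag_of z) y = (if y \<in> ?Q then 1 else 0)" for y
        using finQ by (simp add: lookup_sum)
      then show "Poly_Mapping.keys (\<Sum>z\<in>?Q. frag_of z) \<subseteq> X"
        using QX by (auto simp: in_keys_iff split: if_splits)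
      fix u y assume u: "u \<in> ?U"
      have nz: "\<And>i. i \<in> J \<Longrightarrow> \<alpha> i \<noteq> 0" using alpha_nz J by auto
      obtain w where w: "w \<in> ?U" "w \<circ> u = id"
        by (rule wgroup_inverse[where \<alpha> = \<alpha> and J = J and u = u and p = zoff]) (use nz u in auto)
      have "u y \<in> ?Q \<longleftrightarrow> y \<in> ?Q"
      proof
        assume "u y \<in> ?Q"
        then obtain a where a: "a \<in> ?U" "u y = a l" by auto
        have "y = (w \<circ> a) l" using fun_cong[OF w(2), of y] a(2) by simp
        then show "y \<in> ?Q" using comp_in_wgroup[OF w(1) a(1)] by (rule image_eqI)
      next
        assume "y \<in> ?Q"
        then obtain a where a: "a \<in> ?U" "y = a l" by auto
        have "u y = (u \<circ> a) l" using a(2) by simp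
        then show "u y \<in> ?Q" using comp_in_wgroup[OF u a(1)] by (rule image_eqI)
      qed
      then show "Poly_Mapping.lookup (\<Sum>z\<in>?Q. frag_of z) (u y) = Poly_Mapping.lookup (\<Sum>z\<in>?Q. frag_of z) y"
        unfolding lk by simp
    qed
    have "(\<Sum>z\<in>?Q. frag_of z) * ?A r = ?A (l + r) + (\<Sum>z\<in>?Q - {l}. ?A (z + r))"
      unfolding orbit_sum_mult[OF J] by (rule sum.remove[OF finQ lQ])
    then have "?A (l + r) = (\<Sum>z\<in>?Q. frag_of z) * ?A r - (\<Sum>z\<in>?Q - {l}. ?A (z + r))" by simp
    then show ?thesis
      using S smaller finQ by (simp only:) (intro quot_by_diff quot_by_sum; simp)
  qed
  then have "quot_by J r X (frag_cmul ((-1) ^ length ws) (?A (x + r)))" by (simp only: A_l)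
  then have "quot_by J r X (?A (x + r))"
    using quot_by_uminus[of J r X "- ?A (x + r)"] by (cases "even (length ws)") simp_all
  then show ?case .
qed

end

section \<open>The two induction maps\<close>

definition add_closed :: "('a \<Rightarrow>\<^sub>0 int) set \<Rightarrow> bool" where
  "add_closed H \<longleftrightarrow> 0 \<in> H \<and> (\<forall>x\<in>H. \<forall>y\<in>H. x - y \<in> H)"

lemma add_closed_zero: "add_closed H \<Longrightarrow> 0 \<in> H"
  and add_closed_diff: "add_closed H \<Longrightarrow> x \<in> H \<Longrightarrow> y \<in> H \<Longrightarrow> x - y \<in> H"
  by (auto simp: add_closed_def)

lemma add_closed_uminus: "add_closed H \<Longrightarrow> x \<in> H \<Longrightarrow> - x \<in> H"
  using add_closed_diff[OF _ add_closed_zero] by fastforce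

lemma add_closed_add: "add_closed H \<Longrightarrow> x \<in> H \<Longrightarrow> y \<in> H \<Longrightarrow> x + y \<in> H"
  using add_closed_diff[OF _ _ add_closed_uminus, of H x y] by simp

lemma add_closed_cmul:
  assumes "add_closed H" "x \<in> H" shows "frag_cmul m x \<in> H"
proof -
  have n: "frag_cmul (int n) x \<in> H" for n
    by (induction n) (auto simp: assms add_closed_zero add_closed_add frag_cmul_distrib)
  show ?thesis
  proof (cases "m \<ge> 0")
    case True then show ?thesis using n[of "nat m"] by simp
  next
    case False
    then show ?thesis using add_closed_uminus[OF assms(1) n[of "nat (- m)"]] by simp
  qed
qed

lemma add_closed_sign:
  assumes "add_closed H" "frag_cmul ((-1) ^ m) x \<in> H" shows "x \<in> H"
  using add_closed_cmul[OF assms, of "(-1) ^ m"] by (simp flip: power_add)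

lemma add_closed_extend:
  assumes "add_closed H" "\<And>i. i \<in> Poly_Mapping.keys c \<Longrightarrow> f i \<in> H"
  shows "frag_extend f c \<in> H"
proof -
  have "(\<Sum>i\<in>S. frag_cmul (Poly_Mapping.lookup c i) (f i)) \<in> H" if "finite S" "S \<subseteq> Poly_Mapping.keys c" for S
    using that by (induction S rule: finite_induct)
      (auto simp: add_closed_zero[OF assms(1)] intro!: add_closed_add[OF assms(1)] add_closed_cmul[OF assms(1)] assms(2))
  then show ?thesis unfolding frag_extend_def by simp
qed

lemma add_closed_trivial: "add_closed {0}"
  by (simp add: add_closed_def)

locale fusion_data = root_data \<Phi> \<alpha> for \<Phi> :: "(real ^ 'n) set" and \<alpha> :: "nat \<Rightarrow> real ^ 'n" +
  fixes k v :: nat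
  assumes v: "v \<in> {1..CARD('n)}"
begin


text \<open>The offsets of \<open>W\<^sup>v\<close>, and those of the affine Weyl group acting with centre \<open>- \<rho>\<close>.\<close>

definition pk :: "nat \<Rightarrow> real" where "pk i = (if i = 0 then real k else 0)"
definition pd :: "nat \<Rightarrow> real" where "pd i = (if i = 0 then real k + 1 else 1)"

abbreviation "dot \<equiv> srefl \<alpha> pd"
abbreviation "\<rho> \<equiv> rho \<Phi> \<alpha>"
abbreviation "\<rho>e \<equiv> rho_e \<Phi> \<alpha> v"
abbreviation "\<rho>v \<equiv> rho_v \<Phi> \<alpha> v"
abbreviation "ch \<equiv> weyl_char \<Phi> \<alpha>"
abbreviation "be \<equiv> basis_e \<Phi> \<alpha> v"

definition psi :: "real ^ 'n \<Rightarrow> (real ^ 'n \<Rightarrow>\<^sub>0 int)" where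
  "psi x = exact_quotient (alt_sum (weyl_v \<alpha> k v) (x + \<rho>v)) (alt_sum (weyl_v \<alpha> 0 v) \<rho>v)"

section \<open>The given groups and weight sets in terms of words and chambers\<close>

lemma pd_pos: "pd i > 0" and pd_int: "pd i \<in> \<int>"
  by (auto simp: pd_def)

lemma J_subset: "{1..CARD('n)} \<subseteq> {0..CARD('n)}" "({1..CARD('n)} - {v}) \<subseteq> {0..CARD('n)}" "({0..CARD('n)} - {v}) \<subseteq> {0..CARD('n)}" "{0..CARD('n)} \<subseteq> {0..CARD('n)}"
  by auto

lemma rho_pairing: "i \<in> {1..CARD('n)} \<Longrightarrow> pairing \<rho> (\<alpha> i) = 1"
  unfolding rho_def by (rule pairing_half_sum[where l = 0]) auto

lemma rho_e_pairing: "i \<in> ({1..CARD('n)} - {v}) \<Longrightarrow> pairing \<rho>e (\<alpha> i) = 1"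
  unfolding rho_e_def by (rule pairing_half_sum[where l = 0]) auto

lemma rho_v_pairing: "i \<in> ({0..CARD('n)} - {v}) \<Longrightarrow> pairing \<rho>v (\<alpha> i) = 1"
  unfolding rho_v_def by (rule pairing_half_sum[where l = v]) (use v in auto)

lemma weyl_eq: "weyl \<alpha> = wgroup \<alpha> zoff {1..CARD('n)}"
  unfolding weyl_def srefl_zoff[symmetric] by (rule generated_srefl) (auto simp: alpha_nz)

lemma weyl_e_eq: "weyl_e \<alpha> v = wgroup \<alpha> zoff ({1..CARD('n)} - {v})"
  unfolding weyl_e_def srefl_zoff[symmetric] by (rule generated_srefl) (auto simp: alpha_nz)

lemma level_refl_eq: "p 0 = real m \<Longrightarrow> level_refl \<alpha> m = srefl \<alpha> p 0"
  by (auto simp: fun_eq_iff level_refl_def srefl_def level_def pairing_minus_right algebra_simps)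

lemma weyl_v_eq:
  assumes p: "p 0 = real m" "\<And>i. i \<noteq> 0 \<Longrightarrow> p i = 0"
  shows "weyl_v \<alpha> m v = wgroup \<alpha> p ({0..CARD('n)} - {v})"
proof -
  interpret B: group "BijGroup (UNIV :: (real ^ 'n) set)" by (rule group_BijGroup)
  have carr: "srefl \<alpha> p i \<in> carrier (BijGroup UNIV)" if "i \<in> {0..CARD('n)}" for i
    using bij_srefl[of \<alpha> i p] alpha_nz that by (simp add: BijGroup_def Bij_def)
  have "root_refl (\<alpha> i) = srefl \<alpha> p i" if "i \<in> ({1..CARD('n)} - {v})" for i
    unfolding srefl_zoff[symmetric] using that p(2) by (intro srefl_cong) auto
  then have "weyl_e \<alpha> v = generated (srefl \<alpha> p ` ({1..CARD('n)} - {v}))" unfolding weyl_e_def by (simp cong: image_cong_simp)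
  then have "weyl_v \<alpha> m v = generated (insert (srefl \<alpha> p 0) (generated (srefl \<alpha> p ` ({1..CARD('n)} - {v}))))"
    unfolding weyl_v_def level_refl_eq[of p, OF p(1)] by simp
  also have "\<dots> = generated (insert (srefl \<alpha> p 0) (srefl \<alpha> p ` ({1..CARD('n)} - {v})))"
    using carr by (intro B.generate_insert_generate) auto
  also have "insert (srefl \<alpha> p 0) (srefl \<alpha> p ` ({1..CARD('n)} - {v})) = srefl \<alpha> p ` ({0..CARD('n)} - {v})"
  proof -
    have "({0..CARD('n)} - {v}) = insert 0 ({1..CARD('n)} - {v})" using v by auto
    then show ?thesis by simp
  qed
  also have "generated (srefl \<alpha> p ` ({0..CARD('n)} - {v})) = wgroup \<alpha> p ({0..CARD('n)} - {v})"
    by (rule generated_srefl) (auto simp: alpha_nz)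
  finally show ?thesis .
qed

lemma weyl_v_k: "weyl_v \<alpha> k v = wgroup \<alpha> pk ({0..CARD('n)} - {v})"
  by (rule weyl_v_eq) (auto simp: pk_def)

lemma weyl_v_0: "weyl_v \<alpha> 0 v = wgroup \<alpha> zoff ({0..CARD('n)} - {v})"
  by (rule weyl_v_eq) auto

lemma affine_weyl_eq: "affine_weyl \<Phi> \<alpha> k = wgroup \<alpha> pd {0..CARD('n)}"
proof -
  have "(\<lambda>x. root_refl (\<alpha> i) (x + \<rho>) - \<rho>) = dot i" if "i \<in> {1..CARD('n)}" for i
    using rho_pairing[OF that] that
    by (auto simp: fun_eq_iff root_refl_def srefl_def pairing_add pd_def algebra_simps)
  then have "(\<lambda>i x. root_refl (\<alpha> i) (x + \<rho>) - \<rho>) ` {1..CARD('n)} = dot ` {1..CARD('n)}" by (rule image_cong[OF refl])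
  moreover have "level_refl \<alpha> (k + 1) = dot 0" by (rule level_refl_eq) (simp add: pd_def)
  moreover have "{0..CARD('n)} = insert 0 {1..CARD('n)}" by auto
  ultimately have "affine_weyl \<Phi> \<alpha> k = generated (dot ` {0..CARD('n)})"
    unfolding affine_weyl_def by simp
  also have "\<dots> = wgroup \<alpha> pd {0..CARD('n)}" by (rule generated_srefl) (auto simp: alpha_nz)
  finally show ?thesis .
qed

lemma dot_shift:
  assumes "pd i = p i + pairing r (\<alpha> i)"
  shows "srefl \<alpha> p i (x + r) = dot i x + r"
proof -
  have "srefl \<alpha> (\<lambda>j. p j + pairing r (\<alpha> j)) i = dot i" using assms by (intro srefl_cong) simp
  then show ?thesis by (simp add: srefl_shift)
qed

lemma offset_w: "i \<in> {1..CARD('n)} \<Longrightarrow> pd i = zoff i + pairing \<rho> (\<alpha> i)"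
  using rho_pairing[of i] by (auto simp: pd_def)

lemma offset_e: "i \<in> ({1..CARD('n)} - {v}) \<Longrightarrow> pd i = zoff i + pairing \<rho>e (\<alpha> i)"
  using rho_e_pairing[of i] by (auto simp: pd_def)

lemma offset_v: "i \<in> ({0..CARD('n)} - {v}) \<Longrightarrow> pd i = pk i + pairing \<rho>v (\<alpha> i)"
  using rho_v_pairing[of i] by (auto simp: pd_def pk_def)

lemma dot_weight: "x \<in> \<Lambda> \<Longrightarrow> i \<le> CARD('n) \<Longrightarrow> dot i x \<in> \<Lambda>"
  by (rule weight_srefl) (auto simp: pd_int)

lemma dot_word_weight: "x \<in> \<Lambda> \<Longrightarrow> set ws \<subseteq> {0..CARD('n)} \<Longrightarrow> word \<alpha> pd ws x \<in> \<Lambda>"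
  by (rule weight_word) (auto simp: pd_int)

lemma dot_orbit:
  assumes "J \<subseteq> {0..CARD('n)}" "x \<in> \<Lambda>"
  obtains ws where "set ws \<subseteq> J" "word \<alpha> pd ws x \<in> closed_chamber pd J" "word \<alpha> pd ws x \<in> \<Lambda>"
proof -
  have s: "dot i y \<in> \<Lambda>" if "y \<in> \<Lambda>" "i \<in> J" for y i using that assms(1) by (intro dot_weight) auto
  show thesis
    by (rule orbit_closed_chamber[where p = pd, OF assms(1) pd_pos weights_locally_finite assms(2)]) (use s that in blast)+
qed

lemma closed_cases:
  assumes "z \<in> closed_chamber p J" "J \<subseteq> {0..CARD('n)}"
  obtains (wall) i where "i \<in> J" "srefl \<alpha> p i z = z" | (interior) "z \<in> open_chamber p J"
proof (cases "\<exists>i\<in>J. pairing z (\<alpha> i) + p i = 0")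
  case True
  then obtain i where i: "i \<in> J" "pairing z (\<alpha> i) + p i = 0" by blast
  then show thesis by (intro wall[of i]) (simp_all add: srefl_def)
next
  case False
  then have "z \<in> open_chamber p J" using assms(1) by (force simp: open_chamber_def closed_chamber_def)
  then show thesis by (rule interior)
qed

lemma int_gt_minus_one:
  assumes "(t::real) \<in> \<int>" "t > - 1" shows "t \<ge> 0"
proof -
  obtain m where m: "t = of_int m" using assms(1) by (auto elim: Ints_cases)
  then have "real_of_int (-1) < real_of_int m" using assms by simp
  then have "-1 < m" by (simp only: of_int_less_iff)
  then show ?thesis using m by simp
qed

text \<open>By integrality, a pairing is nonnegative exactly when it exceeds -1. Dominant weights
  are thus those strictly inside the shifted walls; the alcove arises likewise from level below
  \<open>k + 1\<close>.\<close>

lemma dominant_eq: "dominant \<Phi> \<alpha> = \<Lambda> \<inter> open_chamber pd {1..CARD('n)}"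
proof -
  have "pairing x (\<alpha> i) \<ge> 0 \<longleftrightarrow> pairing x (\<alpha> i) + pd i > 0" if "x \<in> \<Lambda>" "i \<in> {1..CARD('n)}" for x i
    using int_gt_minus_one[OF weight_pairing[of x i]] that by (force simp: pd_def)
  then show ?thesis by (auto simp: dominant_def open_chamber_def)
qed

lemma dominant_e_eq: "dominant_e \<Phi> \<alpha> v = \<Lambda> \<inter> open_chamber pd ({1..CARD('n)} - {v})"
proof -
  have "pairing x (\<alpha> i) \<ge> 0 \<longleftrightarrow> pairing x (\<alpha> i) + pd i > 0" if "x \<in> \<Lambda>" "i \<in> ({1..CARD('n)} - {v})" for x i
    using int_gt_minus_one[OF weight_pairing[of x i]] that by (force simp: pd_def)
  then show ?thesis unfolding dominant_e_def open_chamber_def by blast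
qed

lemma alcove_eq: "alcove \<Phi> \<alpha> k = \<Lambda> \<inter> open_chamber pd {0..CARD('n)}"
proof -
  have l: "level \<alpha> x \<le> real k \<longleftrightarrow> pairing x (\<alpha> 0) + pd 0 > 0" if "x \<in> \<Lambda>" for x
    using int_gt_minus_one[OF Ints_add[OF weight_pairing[OF that, of 0] Ints_of_nat[of k]]]
    by (force simp: pd_def level_def pairing_minus_right)
  have "{0..CARD('n)} = insert 0 {1..CARD('n)}" by auto
  then have "open_chamber pd {0..CARD('n)} = {x. pairing x (\<alpha> 0) + pd 0 > 0} \<inter> open_chamber pd {1..CARD('n)}"
    unfolding open_chamber_def by auto
  then show ?thesis unfolding alcove_def dominant_eq using l by auto
qed

lemma quot_by_weights:
  assumes "J \<subseteq> {0..CARD('n)}" "\<And>i. i \<in> J \<Longrightarrow> pairing r (\<alpha> i) = 1" "x \<in> \<Lambda>"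
  shows "quot_by J r \<Lambda> (alt_sum (wgroup \<alpha> zoff J) (x + r))"
  using assms weights_locally_finite weight_pairing weight_add_int
  by (intro quot_by_alt_sum) auto

lemma cancel_w: "y * alt_sum (wgroup \<alpha> zoff {1..CARD('n)}) \<rho> = 0 \<Longrightarrow> y = 0"
  by (rule alt_rho_cancel[OF J_subset(1) rho_pairing])

lemma cancel_e: "y * alt_sum (wgroup \<alpha> zoff ({1..CARD('n)} - {v})) \<rho>e = 0 \<Longrightarrow> y = 0"
  by (rule alt_rho_cancel[OF J_subset(2) rho_e_pairing])

lemma cancel_v: "y * alt_sum (wgroup \<alpha> zoff ({0..CARD('n)} - {v})) \<rho>v = 0 \<Longrightarrow> y = 0"
  by (rule alt_rho_cancel[OF J_subset(3) rho_v_pairing])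

section \<open>Numerator identities and antisymmetry\<close>

lemma chi_mult:
  assumes "x \<in> \<Lambda>"
  shows "ch x * alt_sum (wgroup \<alpha> zoff {1..CARD('n)}) \<rho> = alt_sum (wgroup \<alpha> zoff {1..CARD('n)}) (x + \<rho>)"
proof -
  obtain y where y: "y * alt_sum (wgroup \<alpha> zoff {1..CARD('n)}) \<rho> = alt_sum (wgroup \<alpha> zoff {1..CARD('n)}) (x + \<rho>)"
    using quot_by_weights[OF J_subset(1) rho_pairing assms] by (auto simp: quot_by_def)
  have "ch x = y" unfolding weyl_char_def weyl_eq by (rule exact_quotient_eq[OF cancel_w y])
  then show ?thesis using y by simp
qed

lemma be_mult:
  assumes "x \<in> \<Lambda>"
  shows "be x * alt_sum (wgroup \<alpha> zoff ({1..CARD('n)} - {v})) \<rho>e = alt_sum (wgroup \<alpha> zoff ({1..CARD('n)} - {v})) (x + \<rho>e)"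
    and "be x \<in> carrier (rep_Ze \<Phi> \<alpha> v)"
proof -
  obtain y where y: "y * alt_sum (wgroup \<alpha> zoff ({1..CARD('n)} - {v})) \<rho>e = alt_sum (wgroup \<alpha> zoff ({1..CARD('n)} - {v})) (x + \<rho>e)"
      "Poly_Mapping.keys y \<subseteq> \<Lambda>"
      "\<forall>u\<in>wgroup \<alpha> zoff ({1..CARD('n)} - {v}). \<forall>z. Poly_Mapping.lookup y (u z) = Poly_Mapping.lookup y z"
    using quot_by_weights[OF J_subset(2) rho_e_pairing assms] by (auto simp: quot_by_def)
  have "be x = y" unfolding basis_e_def weyl_e_eq by (rule exact_quotient_eq[OF cancel_e y(1)])
  then show "be x * alt_sum (wgroup \<alpha> zoff ({1..CARD('n)} - {v})) \<rho>e = alt_sum (wgroup \<alpha> zoff ({1..CARD('n)} - {v})) (x + \<rho>e)"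
    "be x \<in> carrier (rep_Ze \<Phi> \<alpha> v)"
    using y by (simp_all add: rep_Ze_def invariants_def weyl_e_eq)
qed

text \<open>The common fixed point of W^v, on the line that the edge from the origin to the vertex
  spans.\<close>

lemma vertex: "\<exists>q. \<forall>i\<in>({0..CARD('n)} - {v}). pairing q (\<alpha> i) = - pk i"
proof -
  obtain q where q: "\<And>i. i \<in> {1..CARD('n)} \<Longrightarrow> i \<noteq> v \<Longrightarrow> pairing q (\<alpha> i) = 0" "pairing q (\<alpha> 0) = - real k"
    using fundamental_coweight[OF v] by blast
  show ?thesis by (rule exI[of _ q]) (use q in \<open>auto simp: pk_def\<close>)
qed

lemma finite_weyl_v: "finite (wgroup \<alpha> pk ({0..CARD('n)} - {v}))"
proof -
  obtain q where "\<forall>i\<in>({0..CARD('n)} - {v}). pairing q (\<alpha> i) = - pk i" using vertex by blast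
  then have q: "\<And>i. i \<in> ({0..CARD('n)} - {v}) \<Longrightarrow> pairing q (\<alpha> i) = - pk i" by blast
  show ?thesis by (rule finite_wgroup_vertex[OF J_subset(3), of q]) (rule q)
qed

lemma psi_mult:
  assumes "x \<in> \<Lambda>"
  shows "psi x * alt_sum (wgroup \<alpha> zoff ({0..CARD('n)} - {v})) \<rho>v = alt_sum (wgroup \<alpha> pk ({0..CARD('n)} - {v})) (x + \<rho>v)"
proof -
  obtain q where "\<forall>i\<in>({0..CARD('n)} - {v}). pairing q (\<alpha> i) = - pk i" using vertex by blast
  then have q: "\<And>i. i \<in> ({0..CARD('n)} - {v}) \<Longrightarrow> pairing q (\<alpha> i) = - pk i" by blast
  \<comment> \<open>\<open>q\<close> need not be a weight, so divisibility is applied to translated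
    weights. Their pairings with the walls of W^v stay integral because those of \<open>q\<close>
    are.\<close>
  let ?X = "(\<lambda>x. x + - q) ` \<Lambda>"
  have "quot_by ({0..CARD('n)} - {v}) \<rho>v ?X (alt_sum (wgroup \<alpha> zoff ({0..CARD('n)} - {v})) ((x + - q) + \<rho>v))"
  proof (rule quot_by_alt_sum[OF J_subset(3) rho_v_pairing])
    show "locally_finite ?X" by (rule locally_finite_translate[OF weights_locally_finite])
    show "x + - q \<in> ?X" using assms by (rule imageI)
  next
    fix z i assume z: "z \<in> ?X" and i: "i \<in> ({0..CARD('n)} - {v})"
    then obtain y where y: "y \<in> \<Lambda>" "z = y + - q" by auto
    have "pairing z (\<alpha> i) = pairing y (\<alpha> i) + pk i" using q[OF i] y(2) by (simp add: pairing_diff)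
    moreover have "pk i \<in> \<int>" by (simp add: pk_def)
    ultimately show "pairing z (\<alpha> i) \<in> \<int>" using weight_pairing[OF y(1), of i] i by auto
    fix m :: real assume "m \<in> \<int>"
    then have "y + m *\<^sub>R \<alpha> i \<in> \<Lambda>" using y(1) i by (intro weight_add_int) auto
    then have "(y + m *\<^sub>R \<alpha> i) + - q \<in> ?X" by (rule imageI)
    then show "z + m *\<^sub>R \<alpha> i \<in> ?X" unfolding y(2) by (simp add: algebra_simps)
  qed
  then obtain y where y: "y * alt_sum (wgroup \<alpha> zoff ({0..CARD('n)} - {v})) \<rho>v = alt_sum (wgroup \<alpha> zoff ({0..CARD('n)} - {v})) (x - q + \<rho>v)"
    by (auto simp: quot_by_def)
  have "alt_sum (wgroup \<alpha> pk ({0..CARD('n)} - {v})) (x + \<rho>v) = alt_sum (wgroup \<alpha> pk ({0..CARD('n)} - {v})) ((x - q + \<rho>v) + q)"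
    by (simp add: algebra_simps)
  also have "\<dots> = (y * alt_sum (wgroup \<alpha> zoff ({0..CARD('n)} - {v})) \<rho>v) * Poly_Mapping.single q 1"
    unfolding y by (rule alt_sum_vertex[OF J_subset(3)]) (rule q)
  finally have yq: "(y * Poly_Mapping.single q 1) * alt_sum (wgroup \<alpha> zoff ({0..CARD('n)} - {v})) \<rho>v = alt_sum (wgroup \<alpha> pk ({0..CARD('n)} - {v})) (x + \<rho>v)"
    by (simp add: mult_ac)
  have "psi x = y * Poly_Mapping.single q 1"
    unfolding psi_def weyl_v_k weyl_v_0 by (rule exact_quotient_eq[OF cancel_v yq])
  then show ?thesis using yq by simp
qed

text \<open>For \<open>H = {0}\<close> this is antisymmetry; the other case of interest is an ideal \<open>H\<close>.\<close>

definition alternating :: "(real ^ 'n \<Rightarrow>\<^sub>0 int) set \<Rightarrow> nat set \<Rightarrow> (real ^ 'n \<Rightarrow> (real ^ 'n \<Rightarrow>\<^sub>0 int)) \<Rightarrow> bool" where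
  "alternating H J f \<longleftrightarrow> (\<forall>x\<in>\<Lambda>. \<forall>i\<in>J. f (dot i x) + f x \<in> H)"

lemma alternating_word:
  assumes "alternating H J f" "add_closed H" "J \<subseteq> {0..CARD('n)}" "set ws \<subseteq> J" "x \<in> \<Lambda>"
  shows "f (word \<alpha> pd ws x) - frag_cmul ((-1) ^ length ws) (f x) \<in> H"
  using assms(4)
proof (induction ws)
  case Nil
  then show ?case using assms(2) by (simp add: add_closed_zero)
next
  case (Cons i ws)
  let ?z = "word \<alpha> pd ws x"
  have "?z \<in> \<Lambda>" using Cons assms by (intro dot_word_weight) auto
  then have "f (dot i ?z) + f ?z \<in> H" using assms(1) Cons by (simp add: alternating_def)
  moreover have "f ?z - frag_cmul ((-1) ^ length ws) (f x) \<in> H" using Cons by simp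
  ultimately have "(f (dot i ?z) + f ?z) - (f ?z - frag_cmul ((-1) ^ length ws) (f x)) \<in> H"
    using assms(2) add_closed_diff by blast
  moreover have "(f (dot i ?z) + f ?z) - (f ?z - frag_cmul ((-1) ^ length ws) (f x))
      = f (word \<alpha> pd (i # ws) x) - frag_cmul ((-1) ^ length (i # ws)) (f x)"
  proof -
    have "frag_cmul (- ((-1) ^ length ws)) (f x) = - frag_cmul ((-1) ^ length ws) (f x)" by simp
    then show ?thesis by (simp del: minus_frag_cmul)
  qed
  ultimately show ?case by simp
qed

lemma alternating_word_0:
  assumes "alternating {0} J f" "J \<subseteq> {0..CARD('n)}" "set ws \<subseteq> J" "x \<in> \<Lambda>"
  shows "f (word \<alpha> pd ws x) = frag_cmul ((-1) ^ length ws) (f x)"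
  using alternating_word[OF assms(1) add_closed_trivial assms(2-4)] by simp

lemma alternating_word_mem:
  assumes "alternating H J f" "add_closed H" "J \<subseteq> {0..CARD('n)}" "set ws \<subseteq> J" "x \<in> \<Lambda>"
    and "f (word \<alpha> pd ws x) \<in> H"
  shows "f x \<in> H"
proof -
  have "f (word \<alpha> pd ws x) - (f (word \<alpha> pd ws x) - frag_cmul ((-1) ^ length ws) (f x)) \<in> H"
    using alternating_word[OF assms(1-5)] assms(2,6) add_closed_diff by blast
  then have "frag_cmul ((-1) ^ length ws) (f x) \<in> H" by simp
  then show ?thesis by (rule add_closed_sign[OF assms(2)])
qed

text \<open>Stated for \<open>{0}\<close> alone: twice \<open>f x\<close> is 0, and the group ring
  has no 2-torsion, whereas a quotient by \<open>H\<close> may have some.\<close>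

lemma alternating_fixed:
  assumes "alternating {0} J f" "i \<in> J" "x \<in> \<Lambda>" "dot i x = x"
  shows "f x = 0"
proof -
  have "f x + f x = 0" using assms by (force simp: alternating_def)
  then have "f x = - f x" by (simp add: eq_neg_iff_add_eq_0)
  then show ?thesis by (rule frag_eq_minus)
qed

lemma alternating_subset: "alternating H J f \<Longrightarrow> J' \<subseteq> J \<Longrightarrow> alternating H J' f"
  by (auto simp: alternating_def)

text \<open>Antisymmetry of the numerators passes to the quotients by cancelling the denominator
  \<open>d\<close>.\<close>

lemma alternating_quotient:
  assumes "J \<subseteq> {0..CARD('n)}" "\<And>y. y * d = 0 \<Longrightarrow> y = 0"
    "\<And>x. x \<in> \<Lambda> \<Longrightarrow> f x * d = alt_sum (wgroup \<alpha> p J) (x + r)"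
    "\<And>i. i \<in> J \<Longrightarrow> pd i = p i + pairing r (\<alpha> i)"
  shows "alternating {0} J f"
  unfolding alternating_def
proof (intro ballI)
  fix x i assume x: "x \<in> \<Lambda>" and i: "i \<in> J"
  have "dot i x \<in> \<Lambda>" using x i assms(1) by (intro dot_weight) auto
  then have "f (dot i x) * d = alt_sum (wgroup \<alpha> p J) (srefl \<alpha> p i (x + r))"
    by (simp add: assms(3) dot_shift[of i p r x, OF assms(4)[OF i]])
  also have "\<dots> = - (f x * d)" by (simp add: assms(3)[OF x] alt_sum_srefl[OF assms(1) i])
  finally have "(f (dot i x) + f x) * d = 0" by (simp add: distrib_right)
  then show "f (dot i x) + f x \<in> {0}" using assms(2) by simp
qed

lemma alternating_chi: "alternating {0} {1..CARD('n)} ch"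
  by (rule alternating_quotient[OF J_subset(1) cancel_w chi_mult offset_w])

lemma alternating_be: "alternating {0} ({1..CARD('n)} - {v}) be"
  by (rule alternating_quotient[OF J_subset(2) cancel_e be_mult(1) offset_e])

lemma alternating_psi: "alternating {0} ({0..CARD('n)} - {v}) psi"
  by (rule alternating_quotient[OF J_subset(3) cancel_v psi_mult offset_v])

section \<open>The basis of R[Z_e]\<close>

text \<open>Up to sign, \<open>c\<close> is the dominant weight in the dot orbit of
  \<open>x\<close>, or 0 if the orbit meets a wall. The same \<open>c\<close> serves every
  antisymmetric \<open>f\<close>; with \<open>be\<close>, \<open>psi\<close> and \<open>ch\<close>
  this evaluates both induction maps at \<open>be x\<close> for weights that are not
  dominant.\<close>

lemma e_expansion:
  assumes x: "x \<in> \<Lambda>"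
  obtains c where "Poly_Mapping.keys c \<subseteq> dominant_e \<Phi> \<alpha> v"
    "\<And>f. alternating {0} ({1..CARD('n)} - {v}) f \<Longrightarrow> frag_extend f c = f x"
proof -
  obtain ws where ws: "set ws \<subseteq> ({1..CARD('n)} - {v})" "word \<alpha> pd ws x \<in> closed_chamber pd ({1..CARD('n)} - {v})" "word \<alpha> pd ws x \<in> \<Lambda>"
    using dot_orbit[OF J_subset(2) x] by blast
  define z where "z = word \<alpha> pd ws x"
  have fz: "frag_cmul ((-1) ^ length ws) (f z) = f x" if "alternating {0} ({1..CARD('n)} - {v}) f" for f
    unfolding z_def alternating_word_0[OF that J_subset(2) ws(1) x] by (simp flip: power_add)
  from ws(2) J_subset(2) show thesis unfolding z_def[symmetric]
  proof (cases rule: closed_cases)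
    case (wall i)
    show ?thesis
    proof (rule that[of 0])
      fix f assume f: "alternating {0} ({1..CARD('n)} - {v}) f"
      have "f z = 0" using alternating_fixed[OF f wall(1) _ wall(2)] ws(3) by (simp add: z_def)
      then show "frag_extend f 0 = f x" using fz[OF f] by simp
    qed simp
  next
    case interior
    show ?thesis
    proof (rule that[of "frag_cmul ((-1) ^ length ws) (frag_of z)"])
      show "Poly_Mapping.keys (frag_cmul ((-1) ^ length ws) (frag_of z)) \<subseteq> dominant_e \<Phi> \<alpha> v"
        using interior ws(3) by (auto simp: dominant_e_eq z_def)
    qed (simp add: frag_extend_cmul fz)
  qed
qed

lemma open_shift:
  assumes "\<And>i. i \<in> J \<Longrightarrow> pd i = p i + pairing r (\<alpha> i)"
  shows "x + r \<in> open_chamber p J \<longleftrightarrow> x \<in> open_chamber pd J"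
  unfolding open_chamber_def using assms by (auto simp: pairing_add algebra_simps)

lemma open_shift_e: "x + \<rho>e \<in> open_chamber zoff ({1..CARD('n)} - {v}) \<longleftrightarrow> x \<in> open_chamber pd ({1..CARD('n)} - {v})"
  by (rule open_shift) (rule offset_e)

lemma open_shift_v: "x + \<rho>v \<in> open_chamber pk ({0..CARD('n)} - {v}) \<longleftrightarrow> x \<in> open_chamber pd ({0..CARD('n)} - {v})"
  by (rule open_shift) (rule offset_v)

text \<open>After multiplication by the denominator, the coefficient at \<open>z + \<rho>e\<close>
  is \<open>c\<close> at \<open>z\<close>.\<close>

lemma be_independent:
  assumes "Poly_Mapping.keys c \<subseteq> dominant_e \<Phi> \<alpha> v" "frag_extend be c = 0"
  shows "c = 0"
proof (rule poly_mapping_eqI)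
  fix z
  let ?A = "alt_sum (wgroup \<alpha> zoff ({1..CARD('n)} - {v}))"
  have inC: "i + \<rho>e \<in> open_chamber zoff ({1..CARD('n)} - {v})" if "i \<in> Poly_Mapping.keys c" for i
    using that assms(1) unfolding open_shift_e dominant_e_eq by blast
  have "0 = frag_extend (\<lambda>i. be i * ?A \<rho>e) c" using assms(2) frag_extend_mult[of be c "?A \<rho>e"] by simp
  also have "\<dots> = frag_extend (\<lambda>i. ?A (i + \<rho>e)) c"
    using assms(1) by (intro frag_extend_eq be_mult(1)) (auto simp: dominant_e_eq)
  finally have zero: "frag_extend (\<lambda>i. ?A (i + \<rho>e)) c = 0" by simp
  show "Poly_Mapping.lookup c z = Poly_Mapping.lookup 0 z"
  proof (cases "z \<in> Poly_Mapping.keys c")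
    case True
    have "0 = (\<Sum>i\<in>Poly_Mapping.keys c. Poly_Mapping.lookup c i * Poly_Mapping.lookup (?A (i + \<rho>e)) (z + \<rho>e))"
      using zero lookup_frag_extend[of "\<lambda>i. ?A (i + \<rho>e)" c "z + \<rho>e"] by simp
    also have "\<dots> = (\<Sum>i\<in>Poly_Mapping.keys c. if i = z then Poly_Mapping.lookup c z else 0)"
      using lookup_alt_sum_chamber[OF J_subset(2) finite_wgroup_linear[OF J_subset(2)] inC inC[OF True]]
      by (intro sum.cong) auto
    also have "\<dots> = Poly_Mapping.lookup c z" using True by simp
    finally show ?thesis by simp
  qed (simp add: in_keys_iff)
qed

lemma extend_e_eq:
  assumes "Poly_Mapping.keys c \<subseteq> dominant_e \<Phi> \<alpha> v"
  shows "extend_e \<Phi> \<alpha> v f (frag_extend be c) = frag_extend f c"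
proof -
  have "(THE c'. Poly_Mapping.keys c' \<subseteq> dominant_e \<Phi> \<alpha> v \<and> frag_extend be c' = frag_extend be c) = c"
  proof (rule the_equality)
    fix c' assume c': "Poly_Mapping.keys c' \<subseteq> dominant_e \<Phi> \<alpha> v \<and> frag_extend be c' = frag_extend be c"
    have "c' - c = 0"
    proof (rule be_independent)
      show "Poly_Mapping.keys (c' - c) \<subseteq> dominant_e \<Phi> \<alpha> v" using keys_diff[of c' c] c' assms by blast
      show "frag_extend be (c' - c) = 0" using c' by (simp add: frag_extend_diff)
    qed
    then show "c' = c" by simp
  qed (use assms in simp)
  then show ?thesis by (simp add: extend_e_def)
qed

text \<open>\<open>orbit_closed_chamber\<close> needs positive offsets, so the linear chamber is
  reached through the translate by \<open>- r\<close>, where all offsets become 1.\<close>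

lemma reach_closed:
  assumes J: "J \<subseteq> {0..CARD('n)}" and r: "\<And>i. i \<in> J \<Longrightarrow> pairing r (\<alpha> i) = 1"
  obtains ws where "set ws \<subseteq> J" "word \<alpha> zoff ws z \<in> closed_chamber zoff J"
proof -
  let ?one = "\<lambda>_::nat. 1 :: real"
  let ?X = "(\<lambda>u. u z - r) ` wgroup \<alpha> zoff J"
  have "finite ?X" using finite_wgroup_linear[OF J] by simp
  then have lf: "locally_finite ?X" by (auto simp: locally_finite_def)
  have "id z - r \<in> ?X" by (rule imageI) (rule id_in_wgroup)
  then have zX: "z - r \<in> ?X" by simp
  have cl: "srefl \<alpha> ?one i x \<in> ?X" if x: "x \<in> ?X" and i: "i \<in> J" for x i
  proof -
    obtain u where u: "u \<in> wgroup \<alpha> zoff J" "x = u z - r" using x by auto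
    have "srefl \<alpha> ?one i x = srefl \<alpha> zoff i (u z) - r"
      using r[OF i] by (simp add: u(2) srefl_def pairing_diff)
    then show ?thesis using comp_in_wgroup[OF srefl_in_wgroup[OF i] u(1)] by (intro image_eqI) auto
  qed
  obtain ws where ws: "set ws \<subseteq> J" "word \<alpha> ?one ws (z - r) \<in> closed_chamber ?one J"
    by (rule orbit_closed_chamber[where p = ?one, OF J _ lf zX]) (use cl in \<open>auto simp only: zero_less_one\<close>)
  have "word \<alpha> zoff ws z = word \<alpha> ?one ws (z - r) + r"
    using word_rho_shift[OF ws(1), of ?one zoff r "z - r"] r by simp
  then have "word \<alpha> zoff ws z \<in> closed_chamber zoff J"
    using ws(2) r by (auto simp: closed_chamber_def pairing_add)
  then show thesis using that ws(1) by blast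
qed

lemma lookup_mult_alt_sum_srefl:
  assumes J: "J \<subseteq> {0..CARD('n)}" and i: "i \<in> J"
    and x: "\<And>u z. u \<in> wgroup \<alpha> zoff J \<Longrightarrow> Poly_Mapping.lookup x (u z) = Poly_Mapping.lookup x z"
  shows "Poly_Mapping.lookup (x * alt_sum (wgroup \<alpha> zoff J) y) (srefl \<alpha> zoff i z)
      = - Poly_Mapping.lookup (x * alt_sum (wgroup \<alpha> zoff J) y) z"
proof -
  let ?s = "srefl \<alpha> zoff i"
  let ?U = "wgroup \<alpha> zoff J"
  have iC: "i \<le> CARD('n)" using i J by auto
  have ss: "?s (?s y) = y" for y by (rule srefl_invol) (rule alpha_nz[OF iC])
  have lin: "?s (a - b) = ?s a - ?s b" for a b
    unfolding srefl_zoff by (rule linear_diff[OF linear_root_refl])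
  have ss': "?s \<circ> (?s \<circ> u) = u" for u :: "real ^ 'n \<Rightarrow> real ^ 'n" by (auto simp: fun_eq_iff ss)
  have mem: "?s \<circ> u \<in> ?U" if "u \<in> ?U" for u using comp_in_wgroup[OF srefl_in_wgroup[OF i] that] .
  have sg: "lin_sign (?s \<circ> u) = - lin_sign u" if "u \<in> ?U" for u
    using lin_sign_comp[OF J srefl_in_wgroup[OF i] that] lin_sign_srefl[OF iC] by simp
  have lk: "Poly_Mapping.lookup (x * alt_sum ?U y) z = (\<Sum>u\<in>?U. Poly_Mapping.lookup x (z - u y) * lin_sign u)" for z
    unfolding alt_sum_def sum_distrib_left lookup_sum lookup_mult_single ..
  have "(\<Sum>u\<in>?U. Poly_Mapping.lookup x (?s z - u y) * lin_sign u)
      = (\<Sum>u\<in>?U. Poly_Mapping.lookup x (?s z - ?s (u y)) * lin_sign (?s \<circ> u))"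
    by (rule sum.reindex_bij_witness[of _ "\<lambda>u. ?s \<circ> u" "\<lambda>u. ?s \<circ> u"]) (simp_all only: ss' mem, simp add: ss)
  also have "\<dots> = (\<Sum>u\<in>?U. - (Poly_Mapping.lookup x (z - u y) * lin_sign u))"
  proof (rule sum.cong[OF refl])
    fix u assume u: "u \<in> ?U"
    show "Poly_Mapping.lookup x (?s z - ?s (u y)) * lin_sign (?s \<circ> u) = - (Poly_Mapping.lookup x (z - u y) * lin_sign u)"
      unfolding lin[symmetric] x[OF srefl_in_wgroup[OF i]] sg[OF u] by simp
  qed
  finally show ?thesis unfolding lk by (simp add: sum_negf)
qed

text \<open>Multiplication by the denominator makes \<open>x\<close> an antisymmetric
  \<open>F\<close>, whose coefficients in the open chamber prescribe \<open>c\<close>. The remainder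
  \<open>G\<close> is antisymmetric and 0 in the open chamber; it is 0 on walls by antisymmetry, and
  every point can be moved into the closed chamber.\<close>

lemma be_span:
  assumes x: "x \<in> carrier (rep_Ze \<Phi> \<alpha> v)"
  obtains c where "Poly_Mapping.keys c \<subseteq> dominant_e \<Phi> \<alpha> v" "frag_extend be c = x"
proof -
  let ?U = "wgroup \<alpha> zoff ({1..CARD('n)} - {v})"
  let ?A = "alt_sum ?U"
  let ?C = "open_chamber zoff ({1..CARD('n)} - {v})"
  let ?h = "\<lambda>z. if z \<in> ?C then frag_of (z - \<rho>e) else 0"
  have xk: "Poly_Mapping.keys x \<subseteq> \<Lambda>"
    and xi: "\<And>u z. u \<in> ?U \<Longrightarrow> Poly_Mapping.lookup x (u z) = Poly_Mapping.lookup x z"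
    using x by (auto simp: rep_Ze_def invariants_def weyl_e_eq)
  define F where "F = x * ?A \<rho>e"
  define c where "c = frag_extend ?h F"
  \<comment> \<open>\<open>\<rho>e\<close> need not be a weight, but \<open>F\<close> lives on the
    coset \<open>\<Lambda> + \<rho>e\<close>: each \<open>u \<rho>e\<close> is a dot image of 0 plus
    \<open>\<rho>e\<close>.\<close>
  have Fk: "z - \<rho>e \<in> \<Lambda>" if z: "z \<in> Poly_Mapping.keys F" for z
  proof -
    obtain a b where ab: "z = a + b" "a \<in> Poly_Mapping.keys x" "b \<in> Poly_Mapping.keys (?A \<rho>e)"
      using z keys_mult[of x "?A \<rho>e"] unfolding F_def by blast
    obtain u where u: "u \<in> ?U" "b = u \<rho>e"
    proof (rule ccontr)
      assume "\<not> thesis"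
      then have "\<And>u. u \<in> ?U \<Longrightarrow> u \<rho>e \<noteq> b" using that by blast
      then have "Poly_Mapping.lookup (?A \<rho>e) b = 0"
        unfolding alt_sum_def lookup_sum by (intro sum.neutral) (auto simp: lookup_single when_def)
      then show False using ab(3) by (simp add: in_keys_iff)
    qed
    obtain ws where ws: "u = word \<alpha> zoff ws" "set ws \<subseteq> ({1..CARD('n)} - {v})" using u(1) by (auto simp: wgroup_def)
    have "b = word \<alpha> pd ws 0 + \<rho>e"
      using word_rho_shift[OF ws(2), of pd zoff \<rho>e 0] offset_e by (simp add: u(2) ws(1))
    moreover have "word \<alpha> pd ws 0 \<in> \<Lambda>" using ws(2) weight_zero by (intro dot_word_weight) auto
    ultimately show ?thesis using ab xk weight_add[of a "word \<alpha> pd ws 0"] by auto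
  qed
  have ck: "Poly_Mapping.keys c \<subseteq> dominant_e \<Phi> \<alpha> v"
  proof
    fix y assume "y \<in> Poly_Mapping.keys c"
    then obtain z where z: "z \<in> Poly_Mapping.keys F" "y \<in> Poly_Mapping.keys (?h z)"
      using keys_frag_extend[of ?h F] unfolding c_def by blast
    then have "z \<in> ?C" "y = z - \<rho>e" by (auto split: if_splits)
    then have "y + \<rho>e \<in> ?C" "y \<in> \<Lambda>" using Fk[OF z(1)] by auto
    then show "y \<in> dominant_e \<Phi> \<alpha> v" unfolding open_shift_e dominant_e_eq by blast
  qed
  define G where "G = F - frag_extend (\<lambda>i. ?A (i + \<rho>e)) c"
  have cA: "frag_extend (\<lambda>i. ?A (i + \<rho>e)) c = frag_extend (\<lambda>z. if z \<in> ?C then ?A z else 0) F"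
    unfolding c_def frag_extend_compose by (intro frag_extend_eq) simp
  have F_anti: "Poly_Mapping.lookup F (srefl \<alpha> zoff i z) = - Poly_Mapping.lookup F z" if i: "i \<in> ({1..CARD('n)} - {v})" for i z
    unfolding F_def by (rule lookup_mult_alt_sum_srefl) (use i xi in auto)
  have A_anti: "Poly_Mapping.lookup (?A y) (srefl \<alpha> zoff i z) = - Poly_Mapping.lookup (?A y) z" if i: "i \<in> ({1..CARD('n)} - {v})" for y i z
  proof -
    have "u z = 0 \<longleftrightarrow> z = 0" if u: "u \<in> ?U" for u z
    proof -
      have "u 0 = 0" using u by (auto simp: wgroup_def linear_0[OF linear_word])
      moreover have "inj u" using bij_wgroup[OF alpha_nz_subset[OF J_subset(2)] u] by (simp add: bij_is_inj)
      ultimately show ?thesis by (metis injD)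
    qed
    \<comment> \<open>The unit is supported at 0, which every \<open>u\<close> fixes and no other
      point reaches. It is thus invariant, and the numerator alone becomes a case of the product
      lemma.\<close>
    then have "Poly_Mapping.lookup (1 * ?A y) (srefl \<alpha> zoff i z) = - Poly_Mapping.lookup (1 * ?A y) z"
      by (intro lookup_mult_alt_sum_srefl[OF J_subset(2) i]) (simp add: lookup_one when_def)
    then show ?thesis by simp
  qed
  have G_anti: "Poly_Mapping.lookup G (srefl \<alpha> zoff i z) = - Poly_Mapping.lookup G z" if i: "i \<in> ({1..CARD('n)} - {v})" for i z
    unfolding G_def lookup_minus lookup_frag_extend F_anti[OF i] A_anti[OF i] by (simp add: sum_negf)
  have G_word: "Poly_Mapping.lookup G (word \<alpha> zoff ws z) = (-1) ^ length ws * Poly_Mapping.lookup G z"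
    if "set ws \<subseteq> ({1..CARD('n)} - {v})" for ws z
    using that by (induction ws) (auto simp: G_anti)
  have G_open: "Poly_Mapping.lookup G z = 0" if z: "z \<in> ?C" for z
  proof -
    have "Poly_Mapping.lookup (frag_extend (\<lambda>i. ?A (i + \<rho>e)) c) z
        = (\<Sum>y\<in>Poly_Mapping.keys F. if y = z then Poly_Mapping.lookup F z else 0)"
      unfolding cA lookup_frag_extend
      using lookup_alt_sum_chamber[OF J_subset(2) finite_wgroup_linear[OF J_subset(2)] _ z] z
      by (intro sum.cong) auto
    also have "\<dots> = Poly_Mapping.lookup F z" by (simp add: in_keys_iff)
    finally show ?thesis by (simp add: G_def lookup_minus)
  qed
  have "G = 0"
  proof (rule poly_mapping_eqI)
    fix z
    obtain ws where ws: "set ws \<subseteq> ({1..CARD('n)} - {v})" "word \<alpha> zoff ws z \<in> closed_chamber zoff ({1..CARD('n)} - {v})"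
      using reach_closed[OF J_subset(2) rho_e_pairing] by blast
    let ?z = "word \<alpha> zoff ws z"
    have "Poly_Mapping.lookup G ?z = 0"
      using ws(2) J_subset(2)
    proof (cases rule: closed_cases)
      case (wall i)
      then show ?thesis using G_anti[OF wall(1), of ?z] by simp
    qed (rule G_open)
    then show "Poly_Mapping.lookup G z = Poly_Mapping.lookup 0 z" using G_word[OF ws(1), of z] by simp
  qed
  then have "frag_extend (\<lambda>i. ?A (i + \<rho>e)) c = F" by (simp add: G_def)
  moreover have "frag_extend be c * ?A \<rho>e = frag_extend (\<lambda>i. ?A (i + \<rho>e)) c"
    unfolding frag_extend_mult using ck by (intro frag_extend_eq be_mult(1)) (auto simp: dominant_e_eq)
  ultimately have "(frag_extend be c - x) * ?A \<rho>e = 0" by (simp add: F_def left_diff_distrib)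
  from cancel_e[OF this] have "frag_extend be c = x" by simp
  then show thesis using that ck by blast
qed

section \<open>Kernel, fusion generators and values of the maps\<close>

definition ker_ev :: "(real ^ 'n \<Rightarrow>\<^sub>0 int) set" where
  "ker_ev = a_kernel (rep_Ze \<Phi> \<alpha> v) (rep_Zv \<Phi> \<alpha> k v) (d_ev \<Phi> \<alpha> k v)"

definition fusion_gens :: "(real ^ 'n \<Rightarrow>\<^sub>0 int) set" where
  "fusion_gens = {ch \<mu> - frag_cmul (lin_sign a) (ch (a \<mu>)) | \<mu> a.
         \<mu> \<in> dominant \<Phi> \<alpha> \<and> \<mu> \<notin> alcove \<Phi> \<alpha> k \<union> singular \<Phi> \<alpha> k \<and>
         a \<in> affine_weyl \<Phi> \<alpha> k \<and> a \<mu> \<in> alcove \<Phi> \<alpha> k}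
      \<union> ch ` (dominant \<Phi> \<alpha> \<inter> singular \<Phi> \<alpha> k)"

lemma ker_ev_iff: "x \<in> ker_ev \<longleftrightarrow> x \<in> carrier (rep_Ze \<Phi> \<alpha> v) \<and> d_ev \<Phi> \<alpha> k v x = 0"
  by (auto simp: ker_ev_def a_kernel_def kernel_def rep_Zv_def invariants_def)

lemma d_ev_extend:
  "Poly_Mapping.keys c \<subseteq> dominant_e \<Phi> \<alpha> v \<Longrightarrow> d_ev \<Phi> \<alpha> k v (frag_extend be c) = frag_extend psi c"
  unfolding d_ev_def psi_def[abs_def] by (rule extend_e_eq)

lemma d_eo_extend:
  "Poly_Mapping.keys c \<subseteq> dominant_e \<Phi> \<alpha> v \<Longrightarrow> d_eo \<Phi> \<alpha> v (frag_extend be c) = frag_extend ch c"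
  unfolding d_eo_def by (rule extend_e_eq)

lemma alternating_e: "alternating {0} ({1..CARD('n)} - {v}) ch" "alternating {0} ({1..CARD('n)} - {v}) psi"
  by (rule alternating_subset[OF alternating_chi]; force) (rule alternating_subset[OF alternating_psi]; force)

lemma rep_Ze_add:
  "x \<in> carrier (rep_Ze \<Phi> \<alpha> v) \<Longrightarrow> y \<in> carrier (rep_Ze \<Phi> \<alpha> v) \<Longrightarrow> x + y \<in> carrier (rep_Ze \<Phi> \<alpha> v)"
  using keys_add[of x y] by (auto simp: rep_Ze_def invariants_def lookup_add)

section \<open>The fusion generators lie in the image of the kernel\<close>

lemma alternating_image:
  assumes H: "add_closed H" and im: "d_eo \<Phi> \<alpha> v ` ker_ev \<subseteq> H"
  shows "alternating H {0..CARD('n)} ch" and "x \<in> \<Lambda> \<Longrightarrow> i \<le> CARD('n) \<Longrightarrow> dot i x = x \<Longrightarrow> ch x \<in> H"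
proof -
  have zero: "ch (dot 0 x) + ch x \<in> H" if x: "x \<in> \<Lambda>" for x
  proof -
    have sx: "dot 0 x \<in> \<Lambda>" using x by (rule dot_weight) simp
    obtain c where c: "Poly_Mapping.keys c \<subseteq> dominant_e \<Phi> \<alpha> v"
      "\<And>f. alternating {0} ({1..CARD('n)} - {v}) f \<Longrightarrow> frag_extend f c = f x" using e_expansion[OF x] by blast
    obtain c' where c': "Poly_Mapping.keys c' \<subseteq> dominant_e \<Phi> \<alpha> v"
      "\<And>f. alternating {0} ({1..CARD('n)} - {v}) f \<Longrightarrow> frag_extend f c' = f (dot 0 x)" using e_expansion[OF sx] by blast
    have k: "Poly_Mapping.keys (c' + c) \<subseteq> dominant_e \<Phi> \<alpha> v" using keys_add[of c' c] c(1) c'(1) by blast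
    \<comment> \<open>One combination \<open>c' + c\<close> represents the sum of the values at
      \<open>dot 0 x\<close> and \<open>x\<close> for \<open>be\<close>, \<open>psi\<close> and
      \<open>ch\<close> simultaneously: the kernel element, its image under \<open>d_ev\<close> and
      its image under \<open>d_eo\<close>.\<close>
    have e: "frag_extend f (c' + c) = f (dot 0 x) + f x" if "alternating {0} ({1..CARD('n)} - {v}) f" for f
      using c(2)[OF that] c'(2)[OF that] by (simp add: frag_extend_add)
    \<comment> \<open>Since \<open>v \<noteq> 0\<close>, the affine reflection belongs to
      W^v.\<close>
    have "psi (dot 0 x) + psi x \<in> {0}" using alternating_psi v x by (simp add: alternating_def)
    then have "d_ev \<Phi> \<alpha> k v (frag_extend be (c' + c)) = 0"
      using d_ev_extend[OF k] e[OF alternating_e(2)] by simp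
    moreover have "frag_extend be (c' + c) \<in> carrier (rep_Ze \<Phi> \<alpha> v)"
      unfolding e[OF alternating_be] using be_mult(2) x sx by (intro rep_Ze_add) auto
    ultimately have "d_eo \<Phi> \<alpha> v (frag_extend be (c' + c)) \<in> H" using im by (auto simp: ker_ev_iff)
    then show ?thesis unfolding d_eo_extend[OF k] e[OF alternating_e(1)] .
  qed
  show "alternating H {0..CARD('n)} ch"
    unfolding alternating_def
  proof (intro ballI)
    fix x i assume x: "x \<in> \<Lambda>" and i: "i \<in> {0..CARD('n)}"
    show "ch (dot i x) + ch x \<in> H"
    proof (cases "i = 0")
      case False
      then have "ch (dot i x) + ch x = 0" using alternating_chi x i by (auto simp: alternating_def)
      then show ?thesis using add_closed_zero[OF H] by simp
    qed (use zero x in simp)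
  qed
  assume x: "x \<in> \<Lambda>" and i: "i \<le> CARD('n)" and fx: "dot i x = x"
  show "ch x \<in> H"
  proof (cases "i = 0")
    case True
    obtain c where c: "Poly_Mapping.keys c \<subseteq> dominant_e \<Phi> \<alpha> v"
      "\<And>f. alternating {0} ({1..CARD('n)} - {v}) f \<Longrightarrow> frag_extend f c = f x" using e_expansion[OF x] by blast
    have "psi x = 0" using alternating_fixed[OF alternating_psi _ x, of 0] fx True v by auto
    then have "d_ev \<Phi> \<alpha> k v (be x) = 0"
      using d_ev_extend[OF c(1)] c(2)[OF alternating_e(2)] c(2)[OF alternating_be] by simp
    then have "d_eo \<Phi> \<alpha> v (be x) \<in> H" using im be_mult(2)[OF x] by (auto simp: ker_ev_iff)
    then show ?thesis
      using d_eo_extend[OF c(1)] c(2)[OF alternating_e(1)] c(2)[OF alternating_be] by simp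
  next
    case False
    then have "ch x = 0" using alternating_fixed[OF alternating_chi _ x fx] i by auto
    then show ?thesis using add_closed_zero[OF H] by simp
  qed
qed

lemma lin_sign_dot_word: "set ws \<subseteq> {0..CARD('n)} \<Longrightarrow> lin_sign (word \<alpha> pd ws) = (-1) ^ length ws"
  using alpha_nz by (intro lin_sign_word) auto

lemma dot_word_group: "set ws \<subseteq> {0..CARD('n)} \<Longrightarrow> word \<alpha> pd ws \<in> wgroup \<alpha> pd {0..CARD('n)}"
  unfolding wgroup_def by blast

lemma affine_inverse:
  assumes "u \<in> wgroup \<alpha> pd {0..CARD('n)}"
  obtains w where "w \<in> wgroup \<alpha> pd {0..CARD('n)}" "u \<circ> w = id" "w \<circ> u = id"
  using wgroup_inverse[OF alpha_nz_subset[OF J_subset(4)] assms] by blast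

lemma singular_iff: "x \<in> singular \<Phi> \<alpha> k \<longleftrightarrow> x \<in> \<Lambda> \<and> (\<exists>a\<in>wgroup \<alpha> pd {0..CARD('n)}. a \<noteq> id \<and> a x = x)"
  by (simp add: singular_def affine_weyl_eq)

lemma singular_wall: "x \<in> \<Lambda> \<Longrightarrow> i \<le> CARD('n) \<Longrightarrow> dot i x = x \<Longrightarrow> x \<in> singular \<Phi> \<alpha> k"
proof -
  assume *: "x \<in> \<Lambda>" "i \<le> CARD('n)" "dot i x = x"
  have "dot i \<noteq> id" by (rule srefl_neq_id) (rule alpha_nz[OF *(2)])
  moreover have "dot i \<in> wgroup \<alpha> pd {0..CARD('n)}" using *(2) by (intro srefl_in_wgroup) simp
  ultimately show ?thesis unfolding singular_iff using * by blast
qed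

lemma singular_open: "x \<in> open_chamber pd {0..CARD('n)} \<Longrightarrow> x \<notin> singular \<Phi> \<alpha> k"
proof
  assume x: "x \<in> open_chamber pd {0..CARD('n)}" and "x \<in> singular \<Phi> \<alpha> k"
  then obtain a where a: "a \<in> wgroup \<alpha> pd {0..CARD('n)}" "a \<noteq> id" "a x = x" by (auto simp: singular_iff)
  then obtain ws where ws: "a = word \<alpha> pd ws" "set ws \<subseteq> {0..CARD('n)}" by (auto simp: wgroup_def)
  have "word \<alpha> pd ws = id"
    by (rule word_open_chamber[OF ws(2) J_subset(4) x]) (use a(3) ws(1) x in simp)
  then show False using a(2) ws(1) by simp
qed

text \<open>Stabilizers along an orbit are conjugate.\<close>

lemma singular_move:
  assumes w: "w \<in> wgroup \<alpha> pd {0..CARD('n)}" and x: "x \<in> singular \<Phi> \<alpha> k"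
  shows "w x \<in> singular \<Phi> \<alpha> k"
proof -
  obtain a where a: "a \<in> wgroup \<alpha> pd {0..CARD('n)}" "a \<noteq> id" "a x = x" and xl: "x \<in> \<Lambda>"
    using x by (auto simp: singular_iff)
  obtain u where u: "u \<in> wgroup \<alpha> pd {0..CARD('n)}" "w \<circ> u = id" "u \<circ> w = id" using affine_inverse[OF w] by blast
  have ux: "u (w x) = x" and wu: "w (u y) = y" and uw: "u (w y) = y" for y
    using fun_cong[OF u(3), of x] fun_cong[OF u(2), of y] fun_cong[OF u(3), of y] by auto
  let ?b = "w \<circ> (a \<circ> u)"
  have "?b \<in> wgroup \<alpha> pd {0..CARD('n)}" using w a(1) u(1) by (intro comp_in_wgroup)
  moreover have "?b (w x) = w x" using ux a(3) by simp
  moreover have "?b \<noteq> id"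
  proof
    assume b: "?b = id"
    have "a y = y" for y
    proof -
      have "w (a (u (w y))) = w y" using fun_cong[OF b, of "w y"] by simp
      then have "u (w (a y)) = u (w y)" using uw by simp
      then show ?thesis using uw by simp
    qed
    then show False using a(2) by auto
  qed
  moreover have "w x \<in> \<Lambda>" using w xl dot_word_weight by (auto simp: wgroup_def)
  ultimately show ?thesis unfolding singular_iff by blast
qed

text \<open>A singular weight moves into the closed alcove and must land on a wall, since interior
  stabilizers are trivial; there \<open>ch\<close> lies in \<open>H\<close>. The other generators
  are antisymmetry along a word.\<close>

lemma gens_in_image:
  assumes H: "add_closed H" and im: "d_eo \<Phi> \<alpha> v ` ker_ev \<subseteq> H"
  shows "fusion_gens \<subseteq> H"
proof -
  note alt = alternating_image(1)[OF assms] and wall_in = alternating_image(2)[OF assms]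
  have "ch x \<in> H" if x: "x \<in> singular \<Phi> \<alpha> k" for x
  proof -
    have xl: "x \<in> \<Lambda>" using x by (simp add: singular_iff)
    obtain ws where ws: "set ws \<subseteq> {0..CARD('n)}" "word \<alpha> pd ws x \<in> closed_chamber pd {0..CARD('n)}"
        "word \<alpha> pd ws x \<in> \<Lambda>" using dot_orbit[OF J_subset(4) xl] by blast
    have "ch (word \<alpha> pd ws x) \<in> H"
      using ws(2) J_subset(4)
    proof (cases rule: closed_cases)
      case (wall i)
      then show ?thesis using wall_in[OF ws(3)] by simp
    next
      case interior
      have "word \<alpha> pd ws x \<in> singular \<Phi> \<alpha> k" by (rule singular_move[OF dot_word_group x]) (use ws(1) in auto)
      then show ?thesis using singular_open[OF interior] by simp
    qed
    then show ?thesis by (rule alternating_word_mem[OF alt H J_subset(4) ws(1) xl])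
  qed
  moreover have "ch x - frag_cmul (lin_sign a) (ch (a x)) \<in> H"
    if "x \<in> \<Lambda>" and a: "a \<in> affine_weyl \<Phi> \<alpha> k" for x a
  proof -
    obtain ws where ws: "a = word \<alpha> pd ws" "set ws \<subseteq> {0..CARD('n)}" using a by (auto simp: affine_weyl_eq wgroup_def)
    let ?s = "(-1) ^ length ws :: int"
    have "ch (a x) - frag_cmul ?s (ch x) \<in> H"
      unfolding ws(1) by (rule alternating_word[OF alt H J_subset(4) ws(2) that(1)])
    then have "frag_cmul ?s (frag_cmul ?s (ch x) - ch (a x)) \<in> H"
      using add_closed_cmul[OF H add_closed_uminus[OF H], of _ ?s] by fastforce
    moreover have "frag_cmul ?s (frag_cmul ?s (ch x) - ch (a x)) = ch x - frag_cmul ?s (ch (a x))"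
      by (rule poly_mapping_eqI) (simp add: lookup_minus right_diff_distrib flip: power_add mult.assoc)
    moreover have "lin_sign a = ?s" unfolding ws(1) by (rule lin_sign_dot_word[OF ws(2)])
    ultimately show ?thesis by simp
  qed
  ultimately show ?thesis unfolding fusion_gens_def dominant_eq by blast
qed

section \<open>The image of the kernel lies in the fusion ideal\<close>

text \<open>The generators mention dominant weights only. W moves any singular weight either to a
  dominant singular one or onto a wall of W, where \<open>ch\<close> is 0.\<close>

lemma gens_singular:
  assumes H: "add_closed H" and gens: "fusion_gens \<subseteq> H" and x: "x \<in> singular \<Phi> \<alpha> k"
  shows "ch x \<in> H"
proof -
  have xl: "x \<in> \<Lambda>" using x by (simp add: singular_iff)
  obtain ws where ws: "set ws \<subseteq> {1..CARD('n)}" "word \<alpha> pd ws x \<in> closed_chamber pd {1..CARD('n)}"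
      "word \<alpha> pd ws x \<in> \<Lambda>" using dot_orbit[OF J_subset(1) xl] by blast
  have "ch (word \<alpha> pd ws x) \<in> H"
    using ws(2) J_subset(1)
  proof (cases rule: closed_cases)
    case (wall i)
    then show ?thesis using alternating_fixed[OF alternating_chi wall(1) ws(3)] add_closed_zero[OF H] by simp
  next
    case interior
    have "word \<alpha> pd ws x \<in> singular \<Phi> \<alpha> k" by (rule singular_move[OF dot_word_group x]) (use ws(1) in auto)
    then have "word \<alpha> pd ws x \<in> dominant \<Phi> \<alpha> \<inter> singular \<Phi> \<alpha> k" using interior ws(3) by (simp add: dominant_eq)
    then show ?thesis using gens unfolding fusion_gens_def by blast
  qed
  moreover have "ch (word \<alpha> pd ws x) = frag_cmul ((-1) ^ length ws) (ch x)"
    by (rule alternating_word_0[OF alternating_chi J_subset(1) ws(1) xl])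
  ultimately show ?thesis using add_closed_sign[OF H] by metis
qed

text \<open>Extends the generators from dominant weights to all regular ones: some \<open>w\<close>
  in W makes \<open>x\<close> dominant, and \<open>a\<close> is replaced by \<open>a\<close>
  composed with the inverse of \<open>w\<close>, with the signs multiplying accordingly.\<close>

lemma gens_regular:
  assumes H: "add_closed H" and gens: "fusion_gens \<subseteq> H" and x: "x \<in> \<Lambda>" "x \<notin> singular \<Phi> \<alpha> k"
    and a: "a \<in> wgroup \<alpha> pd {0..CARD('n)}" "a x \<in> alcove \<Phi> \<alpha> k"
  shows "ch x - frag_cmul (lin_sign a) (ch (a x)) \<in> H"
proof -
  obtain ws where ws: "set ws \<subseteq> {1..CARD('n)}" "word \<alpha> pd ws x \<in> closed_chamber pd {1..CARD('n)}"
      "word \<alpha> pd ws x \<in> \<Lambda>" using dot_orbit[OF J_subset(1) x(1)] by blast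
  define w where "w = word \<alpha> pd ws"
  define s where "s = ((-1) ^ length ws :: int)"
  have ws0: "set ws \<subseteq> {0..CARD('n)}" using ws(1) by auto
  have w: "w \<in> wgroup \<alpha> pd {0..CARD('n)}" unfolding w_def by (rule dot_word_group[OF ws0])
  have ss: "s * s = 1" by (simp add: s_def flip: power_add)
  have chw: "ch (w x) = frag_cmul s (ch x)"
    unfolding w_def s_def by (rule alternating_word_0[OF alternating_chi J_subset(1) ws(1) x(1)])
  have sw: "lin_sign w = s" unfolding w_def s_def by (rule lin_sign_dot_word[OF ws0])
  obtain u where u: "u \<in> wgroup \<alpha> pd {0..CARD('n)}" "w \<circ> u = id" "u \<circ> w = id" using affine_inverse[OF w] by blast
  have uw: "u (w y) = y" for y using fun_cong[OF u(3), of y] by simp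
  have wx: "w x \<notin> singular \<Phi> \<alpha> k"
  proof
    assume "w x \<in> singular \<Phi> \<alpha> k"
    then have "u (w x) \<in> singular \<Phi> \<alpha> k" by (rule singular_move[OF u(1)])
    then show False using x(2) uw by simp
  qed
  let ?b = "a \<circ> u"
  have b: "?b \<in> wgroup \<alpha> pd {0..CARD('n)}" using a(1) u(1) by (rule comp_in_wgroup)
  have bw: "?b \<circ> w = a" by (simp add: comp_assoc u(3))
  have bwx: "?b (w x) = a x" using uw by simp
  have sb: "lin_sign a = lin_sign ?b * s" using lin_sign_comp[OF J_subset(4) b w] bw sw by simp
  have dom: "w x \<in> dominant \<Phi> \<alpha>"
    using ws(2) J_subset(1)
  proof (cases rule: closed_cases)
    case (wall i)
    then show ?thesis using singular_wall[of "w x" i] wx ws(3) by (simp add: w_def)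
  next
    case interior
    then show ?thesis using ws(3) by (simp add: dominant_eq w_def)
  qed
  have "ch (w x) - frag_cmul (lin_sign ?b) (ch (?b (w x))) \<in> H"
  \<comment> \<open>A weight already in the alcove gives no generator, but then \<open>?b\<close>
    must be the identity and the difference is 0.\<close>
  proof (cases "w x \<in> alcove \<Phi> \<alpha> k")
    case True
    obtain us where us: "?b = word \<alpha> pd us" "set us \<subseteq> {0..CARD('n)}" using b by (auto simp: wgroup_def)
    have "word \<alpha> pd us (w x) = a x" using bwx unfolding us(1) .
    then have "word \<alpha> pd us = id"
      using True a(2) by (intro word_open_chamber[OF us(2) J_subset(4)]) (auto simp: alcove_eq)
    then have "?b = id" using us(1) by simp
    then show ?thesis using add_closed_zero[OF H] lin_sign_id bwx by simp
  next
    case False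
    then have "ch (w x) - frag_cmul (lin_sign ?b) (ch (?b (w x))) \<in> fusion_gens"
      unfolding fusion_gens_def affine_weyl_eq using False dom wx b a(2) bwx
      by (intro UnI1 CollectI exI[of _ "w x"] exI[of _ ?b]) simp
    then show ?thesis using gens by blast
  qed
  then have "frag_cmul s (frag_cmul s (ch x) - frag_cmul (lin_sign ?b) (ch (a x))) \<in> H"
    using add_closed_cmul[OF H] unfolding bwx chw by blast
  moreover have "frag_cmul s (frag_cmul s (ch x) - frag_cmul (lin_sign ?b) (ch (a x)))
      = frag_cmul (s * s) (ch x) - frag_cmul (lin_sign ?b * s) (ch (a x))"
    by (rule poly_mapping_eqI) (simp add: lookup_minus algebra_simps)
  ultimately show ?thesis by (simp add: ss sb)
qed

text \<open>For regular \<open>x\<close>, the weights \<open>x\<close> and \<open>dot i x\<close>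
  have the same representative in the alcove, reached by \<open>a\<close> and by
  \<open>a \<circ> dot i\<close>. The signs of these are opposite, so the alcove terms cancel in the
  sum.\<close>

lemma alternating_gens:
  assumes H: "add_closed H" and gens: "fusion_gens \<subseteq> H"
  shows "alternating H {0..CARD('n)} ch"
  unfolding alternating_def
proof (intro ballI)
  fix x i assume x: "x \<in> \<Lambda>" and i: "i \<in> {0..CARD('n)}"
  have s: "dot i \<in> wgroup \<alpha> pd {0..CARD('n)}" using i by (rule srefl_in_wgroup)
  have iC: "i \<le> CARD('n)" using i by simp
  have sx: "dot i x \<in> \<Lambda>" using x iC by (rule dot_weight)
  have ssx: "dot i (dot i x) = x" by (rule srefl_invol) (rule alpha_nz[OF iC])
  show "ch (dot i x) + ch x \<in> H"
  proof (cases "x \<in> singular \<Phi> \<alpha> k")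
    case True
    then show ?thesis
      using gens_singular[OF assms] singular_move[OF s] add_closed_add[OF H] by blast
  next
    case False
    have reg: "dot i x \<notin> singular \<Phi> \<alpha> k" using False singular_move[OF s, of "dot i x"] ssx by auto
    obtain ws where ws: "set ws \<subseteq> {0..CARD('n)}" "word \<alpha> pd ws x \<in> closed_chamber pd {0..CARD('n)}"
      "word \<alpha> pd ws x \<in> \<Lambda>" using dot_orbit[OF J_subset(4) x] by blast
    define a where "a = word \<alpha> pd ws"
    have a: "a \<in> wgroup \<alpha> pd {0..CARD('n)}" unfolding a_def by (rule dot_word_group[OF ws(1)])
    have ax: "a x \<in> alcove \<Phi> \<alpha> k"
      using ws(2) J_subset(4)
    proof (cases rule: closed_cases)
      case (wall j)
      then have "a x \<in> singular \<Phi> \<alpha> k" using singular_wall[of "a x" j] ws(3) by (simp add: a_def)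
      moreover obtain u where u: "u \<in> wgroup \<alpha> pd {0..CARD('n)}" "u \<circ> a = id" using affine_inverse[OF a] by blast
      moreover have "u (a x) = x" using fun_cong[OF u(2), of x] by simp
      ultimately show ?thesis using singular_move[of u "a x"] False by simp
    next
      case interior
      then show ?thesis using ws(3) by (simp add: alcove_eq a_def)
    qed
    let ?b = "a \<circ> dot i"
    have b: "?b \<in> wgroup \<alpha> pd {0..CARD('n)}" using a s by (rule comp_in_wgroup)
    have bx: "?b (dot i x) = a x" using ssx by simp
    have sb: "lin_sign ?b = - lin_sign a"
      using lin_sign_comp[OF J_subset(4) a s] lin_sign_srefl[OF iC] by simp
    have 1: "ch x - frag_cmul (lin_sign a) (ch (a x)) \<in> H" by (rule gens_regular[OF assms x False a ax])
    have "ch (dot i x) - frag_cmul (lin_sign ?b) (ch (?b (dot i x))) \<in> H"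
      by (rule gens_regular[OF assms sx reg b]) (use ax bx in simp)
    then have 2: "ch (dot i x) - frag_cmul (- lin_sign a) (ch (a x)) \<in> H" unfolding bx sb .
    have "(ch (dot i x) - frag_cmul (- lin_sign a) (ch (a x))) + (ch x - frag_cmul (lin_sign a) (ch (a x)))
        = ch (dot i x) + ch x"
      by (rule poly_mapping_eqI) (simp add: lookup_minus lookup_add)
    with add_closed_add[OF H 2 1] show ?thesis by (simp only:)
  qed
qed

text \<open>Reading off the coefficients at the regular dominant points for \<open>W\<^sup>v\<close> and replacing each such point
  by the corresponding character reproduces \<open>ch x\<close> modulo \<open>H\<close> from the numerator of \<open>psi x\<close>;
  hence the image of an element of the kernel vanishes modulo \<open>H\<close>.\<close>

lemma image_in_gens:
  assumes H: "add_closed H" and gens: "fusion_gens \<subseteq> H"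
  shows "d_eo \<Phi> \<alpha> v ` ker_ev \<subseteq> H"
proof
  let ?J = "{0..CARD('n)} - {v}"
  let ?A = "alt_sum (wgroup \<alpha> pk ?J)"
  let ?C = "open_chamber pk ?J"
  define h where "h = (\<lambda>z. if z \<in> ?C then ch (z - \<rho>v) else 0)"
  define g where "g = (\<lambda>x. ch x - frag_extend h (?A (x + \<rho>v)))"
  have alt: "alternating H ?J g"
    unfolding alternating_def
  proof (intro ballI)
    fix x i assume x: "x \<in> \<Lambda>" and i: "i \<in> ?J"
    have "dot i x + \<rho>v = srefl \<alpha> pk i (x + \<rho>v)" by (rule dot_shift[symmetric]) (rule offset_v[OF i])
    then have "?A (dot i x + \<rho>v) = - ?A (x + \<rho>v)" using alt_sum_srefl[OF J_subset(3) i] by simp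
    then have "g (dot i x) + g x = ch (dot i x) + ch x" by (simp add: g_def frag_extend_minus)
    then show "g (dot i x) + g x \<in> H" using alternating_gens[OF assms] x i by (auto simp: alternating_def)
  qed
  have gH: "g x \<in> H" if x: "x \<in> \<Lambda>" for x
  proof -
    obtain ws where ws: "set ws \<subseteq> ?J" "word \<alpha> pd ws x \<in> closed_chamber pd ?J"
        "word \<alpha> pd ws x \<in> \<Lambda>" using dot_orbit[OF J_subset(3) x] by blast
    define z where "z = word \<alpha> pd ws x"
    have zl: "z \<in> \<Lambda>" using ws(3) by (simp add: z_def)
    have "g z \<in> H"
      using ws(2) J_subset(3) unfolding z_def[symmetric]
    proof (cases rule: closed_cases)
      case (wall i)
      \<comment> \<open>On a wall the numerator vanishes, and \<open>ch z\<close> lies in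
        \<open>H\<close> because \<open>z\<close> is singular.\<close>
      have "srefl \<alpha> pk i (z + \<rho>v) = dot i z + \<rho>v" by (rule dot_shift) (rule offset_v[OF wall(1)])
      then have "?A (z + \<rho>v) = 0" using wall by (intro alt_sum_fixed[OF J_subset(3) wall(1)]) simp
      then have "g z = ch z" by (simp add: g_def)
      moreover have "z \<in> singular \<Phi> \<alpha> k" using wall zl by (intro singular_wall[of z i]) auto
      ultimately show ?thesis using gens_singular[OF assms] by simp
    next
      case interior
      then have zC: "z + \<rho>v \<in> ?C" using open_shift_v by blast
      note lk = lookup_alt_sum_chamber[OF J_subset(3) finite_weyl_v zC]
      \<comment> \<open>Among the points of the numerator only \<open>z + \<rho>v\<close> lies in
        the open chamber, with coefficient 1, so \<open>h\<close> returns exactly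
        \<open>ch z\<close>.\<close>
      have "frag_extend h (?A (z + \<rho>v)) = (\<Sum>y\<in>Poly_Mapping.keys (?A (z + \<rho>v)). if y = z + \<rho>v then ch z else 0)"
        unfolding frag_extend_def using zC by (intro sum.cong) (auto simp: h_def lk)
      also have "\<dots> = ch z" using lk[OF zC] by (simp add: in_keys_iff)
      finally show ?thesis using add_closed_zero[OF H] by (simp add: g_def)
    qed
    then show ?thesis unfolding z_def by (rule alternating_word_mem[OF alt H J_subset(3) ws(1) x])
  qed
  fix y assume "y \<in> d_eo \<Phi> \<alpha> v ` ker_ev"
  then obtain x where x: "x \<in> carrier (rep_Ze \<Phi> \<alpha> v)" "d_ev \<Phi> \<alpha> k v x = 0" "y = d_eo \<Phi> \<alpha> v x"
    by (auto simp: ker_ev_iff)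
  obtain c where c: "Poly_Mapping.keys c \<subseteq> dominant_e \<Phi> \<alpha> v" "frag_extend be c = x" by (rule be_span[OF x(1)])
  have cl: "i \<in> \<Lambda>" if "i \<in> Poly_Mapping.keys c" for i using c(1) that by (auto simp: dominant_e_eq)
  have "frag_extend psi c = 0" using x(2) d_ev_extend[OF c(1)] c(2) by simp
  then have "frag_extend (\<lambda>i. psi i * alt_sum (wgroup \<alpha> zoff ?J) \<rho>v) c = 0"
    using frag_extend_mult[of psi c "alt_sum (wgroup \<alpha> zoff ?J) \<rho>v"] by simp
  moreover have "frag_extend (\<lambda>i. psi i * alt_sum (wgroup \<alpha> zoff ?J) \<rho>v) c = frag_extend (\<lambda>i. ?A (i + \<rho>v)) c"
    by (intro frag_extend_eq psi_mult cl)
  ultimately have zero: "frag_extend (\<lambda>i. ?A (i + \<rho>v)) c = 0" by simp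
  \<comment> \<open>The \<open>h\<close> part depends on \<open>c\<close> only through the summed
    numerators, which the kernel condition makes 0.\<close>
  have "frag_extend g c = frag_extend ch c - frag_extend h (frag_extend (\<lambda>i. ?A (i + \<rho>v)) c)"
    unfolding g_def frag_extend_diff_fun frag_extend_compose ..
  also have "\<dots> = y" using x(3) d_eo_extend[OF c(1)] c(2) zero by simp
  finally show "y \<in> H" using add_closed_extend[OF H, of c g] gH cl by auto
qed

lemma ideal_add_closed:
  assumes "ideal I (rep_G \<Phi> \<alpha>)"
  shows "add_closed I"
proof -
  interpret ideal I "rep_G \<Phi> \<alpha>" by fact
  have add: "x \<oplus>\<^bsub>rep_G \<Phi> \<alpha>\<^esub> y = x + y" and zero: "\<zero>\<^bsub>rep_G \<Phi> \<alpha>\<^esub> = 0" for x y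
    by (simp_all add: rep_G_def invariants_def)
  have neg: "- y \<in> I" if y: "y \<in> I" for y
  proof -
    have "\<ominus>\<^bsub>rep_G \<Phi> \<alpha>\<^esub> y + y = 0"
      using l_neg[of y] Icarr[OF y] by (simp add: add zero)
    then have "\<ominus>\<^bsub>rep_G \<Phi> \<alpha>\<^esub> y = - y" by (simp add: eq_neg_iff_add_eq_0)
    then show ?thesis using additive_subgroup.a_inv_closed[OF additive_subgroup_axioms y] by simp
  qed
  have "0 \<in> I" using additive_subgroup.zero_closed[OF additive_subgroup_axioms] by (simp add: zero)
  moreover have "x - y \<in> I" if "x \<in> I" "y \<in> I" for x y
    using additive_subgroup.a_closed[OF additive_subgroup_axioms that(1) neg[OF that(2)]] by (simp add: add)
  ultimately show ?thesis by (simp add: add_closed_def)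
qed

lemma fusion_ideal_eq: "fusion_ideal \<Phi> \<alpha> k = Idl\<^bsub>rep_G \<Phi> \<alpha>\<^esub> (d_eo \<Phi> \<alpha> v ` ker_ev)"
proof -
  have "fusion_gens \<subseteq> I \<longleftrightarrow> d_eo \<Phi> \<alpha> v ` ker_ev \<subseteq> I" if "ideal I (rep_G \<Phi> \<alpha>)" for I
    using gens_in_image image_in_gens ideal_add_closed[OF that] by blast
  then have "{I. ideal I (rep_G \<Phi> \<alpha>) \<and> fusion_gens \<subseteq> I} = {I. ideal I (rep_G \<Phi> \<alpha>) \<and> d_eo \<Phi> \<alpha> v ` ker_ev \<subseteq> I}"
    by blast
  then show ?thesis unfolding fusion_ideal_def fusion_gens_def[symmetric] genideal_def by simp
qed

end

theorem lemma2p3: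
  fixes \<Phi> :: "(real ^ 'n) set" and \<alpha> :: "nat \<Rightarrow> real ^ 'n" and k v :: nat
  assumes "simple_group_data \<Phi> \<alpha>"
    and "k \<ge> 1"
    and "v \<in> {1..CARD('n)}"
  shows "fusion_ring \<Phi> \<alpha> k =
           rep_G \<Phi> \<alpha> Quot Idl\<^bsub>rep_G \<Phi> \<alpha>\<^esub>
             (d_eo \<Phi> \<alpha> v ` a_kernel (rep_Ze \<Phi> \<alpha> v) (rep_Zv \<Phi> \<alpha> k v) (d_ev \<Phi> \<alpha> k v)) \<and>
         fusion_ideal \<Phi> \<alpha> k =
           Idl\<^bsub>rep_G \<Phi> \<alpha>\<^esub>
             (d_eo \<Phi> \<alpha> v ` a_kernel (rep_Ze \<Phi> \<alpha> v) (rep_Zv \<Phi> \<alpha> k v) (d_ev \<Phi> \<alpha> k v))"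
proof -
  interpret fusion_data \<Phi> \<alpha> k v by unfold_locales (use assms in auto)
  show ?thesis using fusion_ideal_eq unfolding fusion_ring_def ker_ev_def by simp
qed

end
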